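(* Let $k$ be an algebraically closed field of characteristic zero and let $p,q$ be prime numbers, not necessarily distinct. Let $D$ be an irreducible homogeneous locally nilpotent derivation of rank $2$ and degree $d=pq-2$ on $k[U,V,W]$ with $DU=0$, and let $P\in k[U,V,W]$ be a homogeneous polynomial (of degree $d+2=pq$) such that $\ker(D)=k[U,P]$ and $D=\Delta_{(U,P)}$. Then $D$ is not triangularizable if and only if, for $(a,b)=(p,q)$ or for $(a,b)=(q,p)$, there exist a linear system of variables $\{X,Y,Z\}$ of $k[U,V,W]$, a homogeneous polynomial $h(X,Y)\in k[X,Y]$ of degree $b$ which is monic in $Y$, an element $\gamma\in k^*$ and elements $c_1,\dots,c_a\in k$ with $c_a\neq 0$ such that $D=\gamma\,\Delta_{(X,P)}$ and $$P=T^{a}+c_1X^{b}T^{a-1}+\dots+c_iX^{ib}T^{a-i}+\dots+c_{a-1}X^{ab-b}T+c_aX^{ab-1}Y,\qquad T=h(X,Y)+X^{b-1}Z.$$ Moreover, in this case $\deg_D(Y)=a$, $\deg_D(Z)=ab=pq$, and $T$ is a local slice of $D$.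
   Context: Let $k$ be a field of characteristic zero and $B=k[U,V,W]$ the polynomial ring in three variables. A locally nilpotent derivation (LND) of $B$ is a $k$-derivation $D:B\to B$ such that for each $b\in B$ there is $n$ with $D^n b=0$. Homogeneous and degree: $B$ has the standard grading $\deg U=\deg V=\deg W=1$, $B=\bigoplus_i B_i$. A nonzero $D$ is homogeneous of degree $d\in\mathbb{Z}$ if $D(B_i)\subseteq B_{i+d}$ for all $i$. Irreducible: the ideal of $B$ generated by $D(B)$ is not contained in any proper principal ideal of $B$. Rank: the smallest positive integer $r$ for which there is a coordinate system $\{V_1,V_2,V_3\}$ of $B$ (i.e. $B=k[V_1,V_2,V_3]$) with $DV_i\neq 0$ for $i\le r$ and $DV_i=0$ for $i>r$. Triangularizable: there is a coordinate system $\{X_1,X_2,X_3\}$ of $B$ with $DX_1\in k$, $DX_2\in k[X_1]$ and $DX_3\in k[X_1,X_2]$. A linear system of variables $\{X,Y,Z\}$ of $B$ is a coordinate system consisting of homogeneous linear forms in $U,V,W$ (i.e. a $k$-basis of $B_1$). Jacobian derivation: for $f_1,f_2\in B$, $\Delta_{(f_1,f_2)}(g)=\frac{\partial(f_1,f_2,g)}{\partial(U,V,W)}$ (Jacobian determinant). Computing it with respect to another linear system of variables $\{X,Y,Z\}$ changes it only by a nonzero constant factor. Degree function: for $b\neq 0$, $\deg_D(b)=\max\{n\ge 0: D^n b\neq 0\}$, and $\deg_D(0)=-\infty$. A local slice of $D$ is an element $r\in B$ with $Dr\in\ker(D)\setminus\{0\}$. *)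

theory Defs
  imports
    "HOL-Analysis.Determinants"
    "HOL-Computational_Algebra.Computational_Algebra"
    "HOL-Library.Extended"
begin

text \<open>
  The ring \<open>B = k[U,V,W]\<close> is rendered as the iterated polynomial ring \<open>k[U][V][W]\<close>: the
  coefficient of \<open>U\<^sup>i V\<^sup>j W\<^sup>l\<close> in \<open>f\<close> is \<open>coeff (coeff (coeff f l) j) i\<close>.
\<close>

type_synonym 'k poly3 = "'k poly poly poly"

definition scal :: "'k::field \<Rightarrow> 'k poly3" where
  "scal c = [:[:[:c:]:]:]"

definition varU :: "'k::field poly3" where
  "varU = [:[:[:0, 1:]:]:]"

definition varV :: "'k::field poly3" where
  "varV = [:[:0, 1:]:]"

definition varW :: "'k::field poly3" where
  "varW = [:0, 1:]"

definition dU :: "'k::field poly3 \<Rightarrow> 'k poly3" where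
  "dU = map_poly (map_poly pderiv)"

definition dV :: "'k::field poly3 \<Rightarrow> 'k poly3" where
  "dV = map_poly pderiv"

definition dW :: "'k::field poly3 \<Rightarrow> 'k poly3" where
  "dW = pderiv"

definition jacobian_deriv :: "'k::field poly3 \<Rightarrow> 'k poly3 \<Rightarrow> 'k poly3 \<Rightarrow> 'k poly3" where
  "jacobian_deriv f1 f2 g =
     det (vector [vector [dU f1, dV f1, dW f1],
                  vector [dU f2, dV f2, dW f2],
                  vector [dU g,  dV g,  dW g]] :: 'k poly3 ^ 3 ^ 3)"

text \<open>The graded piece of degree \<open>n\<close> for the standard grading; it is \<open>{0}\<close> for \<open>n < 0\<close>.\<close>

definition graded_piece :: "int \<Rightarrow> 'k::field poly3 set" where
  "graded_piece n =
     {f. \<forall>i j l. coeff (coeff (coeff f l) j) i \<noteq> 0 \<longrightarrow> int i + int j + int l = n}"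

text \<open>\<open>subalg_gen S\<close> is the \<open>k\<close>-subalgebra \<open>k[S]\<close> of \<open>B\<close>.\<close>

inductive_set subalg_gen :: "'k::field poly3 set \<Rightarrow> 'k poly3 set" for S where
  const: "scal c \<in> subalg_gen S"
| gen: "s \<in> S \<Longrightarrow> s \<in> subalg_gen S"
| add: "f \<in> subalg_gen S \<Longrightarrow> g \<in> subalg_gen S \<Longrightarrow> f + g \<in> subalg_gen S"
| mult: "f \<in> subalg_gen S \<Longrightarrow> g \<in> subalg_gen S \<Longrightarrow> f * g \<in> subalg_gen S"

text \<open>
  Three generators of \<open>B\<close> are automatically algebraically independent, since \<open>B\<close> has
  transcendence degree 3 over \<open>k\<close>.
\<close>

definition coordinate_system :: "'k::field poly3 \<Rightarrow> 'k poly3 \<Rightarrow> 'k poly3 \<Rightarrow> bool" where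
  "coordinate_system X Y Z \<longleftrightarrow> subalg_gen {X, Y, Z} = UNIV"

definition linear_system_of_variables :: "'k::field poly3 \<Rightarrow> 'k poly3 \<Rightarrow> 'k poly3 \<Rightarrow> bool" where
  "linear_system_of_variables X Y Z \<longleftrightarrow>
     coordinate_system X Y Z \<and>
     X \<in> graded_piece 1 \<and> Y \<in> graded_piece 1 \<and> Z \<in> graded_piece 1"

definition k_derivation :: "('k::field poly3 \<Rightarrow> 'k poly3) \<Rightarrow> bool" where
  "k_derivation D \<longleftrightarrow>
     (\<forall>f g. D (f + g) = D f + D g) \<and>
     (\<forall>c f. D (scal c * f) = scal c * D f) \<and>
     (\<forall>f g. D (f * g) = D f * g + f * D g)"

definition lnd :: "('k::field poly3 \<Rightarrow> 'k poly3) \<Rightarrow> bool" where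
  "lnd D \<longleftrightarrow> k_derivation D \<and> (\<forall>b. \<exists>n. (D ^^ n) b = 0)"

definition deriv_ker :: "('k::field poly3 \<Rightarrow> 'k poly3) \<Rightarrow> 'k poly3 set" where
  "deriv_ker D = {b. D b = 0}"

definition homogeneous_deriv :: "('k::field poly3 \<Rightarrow> 'k poly3) \<Rightarrow> int \<Rightarrow> bool" where
  "homogeneous_deriv D d \<longleftrightarrow>
     (\<exists>b. D b \<noteq> 0) \<and> (\<forall>i. D ` graded_piece i \<subseteq> graded_piece (i + d))"

text \<open>
  The ideal generated by \<open>D(B)\<close> is its span in \<open>B\<close> regarded as a module over itself; the
  principal ideal generated by \<open>f\<close> is \<open>range ((*) f)\<close>.
\<close>

definition irreducible_deriv :: "('k::field poly3 \<Rightarrow> 'k poly3) \<Rightarrow> bool" where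
  "irreducible_deriv D \<longleftrightarrow>
     \<not> (\<exists>f. range ((*) f) \<noteq> UNIV \<and> module.span (*) (range D) \<subseteq> range ((*) f))"

text \<open>Only meaningful for \<open>D \<noteq> 0\<close>, in which case the set of admissible \<open>r\<close> is nonempty.\<close>

definition deriv_rank :: "('k::field poly3 \<Rightarrow> 'k poly3) \<Rightarrow> nat" where
  "deriv_rank D = (LEAST r. 0 < r \<and> r \<le> 3 \<and>
     (\<exists>V :: nat \<Rightarrow> 'k poly3. coordinate_system (V 1) (V 2) (V 3) \<and>
        (\<forall>i\<in>{1..3}. (i \<le> r \<longrightarrow> D (V i) \<noteq> 0) \<and> (r < i \<longrightarrow> D (V i) = 0))))"

definition triangularizable :: "('k::field poly3 \<Rightarrow> 'k poly3) \<Rightarrow> bool" where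
  "triangularizable D \<longleftrightarrow>
     (\<exists>X1 X2 X3. coordinate_system X1 X2 X3 \<and>
        D X1 \<in> range scal \<and> D X2 \<in> subalg_gen {X1} \<and> D X3 \<in> subalg_gen {X1, X2})"

definition deg_deriv :: "('k::field poly3 \<Rightarrow> 'k poly3) \<Rightarrow> 'k poly3 \<Rightarrow> nat extended" where
  "deg_deriv D b = (if b = 0 then Minf else Fin (Max {n. (D ^^ n) b \<noteq> 0}))"

definition local_slice :: "('k::field poly3 \<Rightarrow> 'k poly3) \<Rightarrow> 'k poly3 \<Rightarrow> bool" where
  "local_slice D r \<longleftrightarrow> D r \<in> deriv_ker D - {0}"

text \<open>
  A form in two variables is an element of \<open>k[x][y]\<close>, the coefficient of \<open>x\<^sup>i y\<^sup>j\<close> being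
  \<open>coeff (coeff h j) i\<close>; it is monic in the second variable iff its leading coefficient is 1.
\<close>

definition homogeneous2 :: "nat \<Rightarrow> 'k::field poly poly \<Rightarrow> bool" where
  "homogeneous2 n h \<longleftrightarrow> (\<forall>i j. coeff (coeff h j) i \<noteq> 0 \<longrightarrow> i + j = n)"

definition eval2 :: "'k::field poly poly \<Rightarrow> 'k poly3 \<Rightarrow> 'k poly3 \<Rightarrow> 'k poly3" where
  "eval2 h X Y = poly (map_poly (\<lambda>c. poly (map_poly scal c) X) h) Y"

definition slice_form ::
    "nat \<Rightarrow> 'k::field poly poly \<Rightarrow> 'k poly3 \<Rightarrow> 'k poly3 \<Rightarrow> 'k poly3 \<Rightarrow> 'k poly3" where
  "slice_form b h X Y Z = eval2 h X Y + X ^ (b - 1) * Z"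

definition normal_form ::
    "('k::field poly3 \<Rightarrow> 'k poly3) \<Rightarrow> 'k poly3 \<Rightarrow> nat \<Rightarrow> nat \<Rightarrow>
     'k poly3 \<Rightarrow> 'k poly3 \<Rightarrow> 'k poly3 \<Rightarrow> 'k poly poly \<Rightarrow> 'k \<Rightarrow> (nat \<Rightarrow> 'k) \<Rightarrow> bool" where
  "normal_form D P a b X Y Z h \<gamma> c \<longleftrightarrow>
     linear_system_of_variables X Y Z \<and>
     homogeneous2 b h \<and> lead_coeff h = 1 \<and>
     \<gamma> \<noteq> 0 \<and> c a \<noteq> 0 \<and>
     D = (\<lambda>g. scal \<gamma> * jacobian_deriv X P g) \<and>
     (let T = slice_form b h X Y Z in
      P = T ^ a + (\<Sum>i=1..a-1. scal (c i) * X ^ (i * b) * T ^ (a - i))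
            + scal (c a) * X ^ (a * b - 1) * Y)"

end

theory Submission
  imports Defs
begin

text \<open>
  Setting \<open>U = 1\<close> turns \<open>D\<close> into the Jacobian derivation of the plane polynomial \<open>f = P(1,V,W)\<close>
  of degree \<open>pq\<close>, which is again locally nilpotent. For every weighting of the two variables the
  leading form \<open>g\<close> of \<open>f\<close> inherits this property; since kernels are factorially closed, \<open>g\<close> is
  a constant times a power of \<open>x\<close>, \<open>y\<close> or \<open>y\<^sup>s - l x\<^sup>t\<close> with \<open>s = 1\<close> or \<open>t = 1\<close>. Walking along the
  edges of the Newton polygon, and removing an edge by an elementary substitution, leaves only two
  possibilities for \<open>f\<close> because \<open>p\<close> and \<open>q\<close> are prime: \<open>G(y) + e x\<close>, which makes \<open>D\<close>
  triangularizable, and \<open>G(H(y) - l x) + e y\<close>, whose homogenization is the normal form.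

  Conversely, in a normal form \<open>T\<close> is a local slice, so \<open>Y\<close> and \<open>Z\<close> have degrees \<open>a\<close> and \<open>ab\<close>,
  and no linear form \<open>L\<close> satisfies \<open>D(D L) = 0 \<noteq> D L\<close>; but the linear part of the second coordinate
  of a triangular system would be such a form.
\<close>

subsection \<open>Locally nilpotent derivations of a domain\<close>

text \<open>Where the hypotheses enter. Irreducibility keeps \<open>U\<close> from dividing
  \<open>P\<close>, so \<open>f\<close> has degree exactly \<open>pq\<close>. Since \<open>D\<close>
  is homogeneous, each element of the kernel of \<open>jac f\<close> lifts to a homogeneous element
  of \<open>ker D\<close>, so that kernel is \<open>k[f]\<close>; this rules out
  \<open>f = G(r)\<close> with \<open>deg G > 1\<close>, that is, \<open>e = 0\<close> in the second
  shape of \<open>f\<close>. Characteristic zero makes degrees additive, hence kernels factorially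
  closed, and algebraic closure splits an edge form into factors \<open>y^s - l x^t\<close>.

  Primality acts through the exponents. The edge at a vertex \<open>(0,n)\<close> has
  \<open>n = s m\<close>, and \<open>s > 1\<close> forces \<open>t = 1\<close>: such an edge runs
  down to the \<open>x\<close>-axis and cannot be removed by changing \<open>y\<close> alone. For
  \<open>n = pq\<close> either \<open>m = 1\<close>, which gives the first shape, or
  \<open>m\<close> and \<open>s\<close> are the two primes. In that case \<open>y^s - l x\<close> is
  made a coordinate, and the polynomial acquires a vertex \<open>(0,m)\<close> with \<open>m\<close>
  prime: a further edge is either removable or forces the linear shape.\<close>

locale ring_derivation =
  fixes \<delta> :: "'r::{idom,ring_char_0} \<Rightarrow> 'r"
  assumes add: "\<delta> (f + g) = \<delta> f + \<delta> g"
    and mult: "\<delta> (f * g) = \<delta> f * g + f * \<delta> g"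
begin

lemma zero [simp]: "\<delta> 0 = 0"
  using add[of 0 0] by simp

lemma one [simp]: "\<delta> 1 = 0"
  using mult[of 1 1] by simp

lemma uminus: "\<delta> (- f) = - \<delta> f"
  using add[of f "- f"] by (simp add: eq_neg_iff_add_eq_0 add.commute)

lemma diff: "\<delta> (f - g) = \<delta> f - \<delta> g"
  using add[of f "- g"] by (simp add: uminus)

lemma sum: "\<delta> (sum F A) = (\<Sum>i\<in>A. \<delta> (F i))"
  by (induction A rule: infinite_finite_induct) (auto simp: add)

lemma power_Suc: "\<delta> (f ^ Suc n) = of_nat (Suc n) * f ^ n * \<delta> f"
  by (induction n) (auto simp: mult algebra_simps)

lemma power: "\<delta> (f ^ n) = of_nat n * f ^ (n - 1) * \<delta> f"
proof (cases n)
  case (Suc m)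
  then show ?thesis by (simp only: power_Suc diff_Suc_1)
qed simp

lemma funpow_zero [simp]: "(\<delta> ^^ n) 0 = 0"
  by (induction n) auto

lemma funpow_add: "(\<delta> ^^ n) (f + g) = (\<delta> ^^ n) f + (\<delta> ^^ n) g"
  by (induction n) (auto simp: add)

lemma funpow_mono: "(\<delta> ^^ m) f = 0 \<Longrightarrow> m \<le> n \<Longrightarrow> (\<delta> ^^ n) f = 0"
  using Nat.funpow_add[of "n - m" m \<delta>] by simp

lemma funpow_ker_mult: "\<delta> f = 0 \<Longrightarrow> (\<delta> ^^ n) (f * g) = f * (\<delta> ^^ n) g"
  by (induction n) (auto simp: mult)

lemma nilpotent_add:
  assumes "\<exists>n. (\<delta> ^^ n) f = 0" "\<exists>n. (\<delta> ^^ n) g = 0"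
  shows "\<exists>n. (\<delta> ^^ n) (f + g) = 0"
proof -
  from assms obtain m n where "(\<delta> ^^ m) f = 0" "(\<delta> ^^ n) g = 0" by blast
  then have "(\<delta> ^^ max m n) f = 0" "(\<delta> ^^ max m n) g = 0"
    by (auto elim: funpow_mono)
  then have "(\<delta> ^^ max m n) (f + g) = 0"
    by (simp add: funpow_add)
  then show ?thesis ..
qed

lemma nilpotent_sum:
  "(\<And>i. i \<in> A \<Longrightarrow> \<exists>n. (\<delta> ^^ n) (F i) = 0) \<Longrightarrow> \<exists>n. (\<delta> ^^ n) (sum F A) = 0"
  by (induction A rule: infinite_finite_induct) (auto intro: nilpotent_add)

text \<open>In the Leibniz expansion every other term applies \<delta> too often to \<open>f\<close>
  or to \<open>g\<close>. One derivation is split off at a time, and Pascal's rule adds the two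
  binomial coefficients.\<close>

lemma leibniz_top:
  "(\<delta> ^^ Suc m) f = 0 \<Longrightarrow> (\<delta> ^^ Suc n) g = 0 \<Longrightarrow>
     (\<delta> ^^ (m + n)) (f * g) = of_nat ((m + n) choose m) * (\<delta> ^^ m) f * (\<delta> ^^ n) g"
proof (induction "m + n" arbitrary: m n f g)
  case 0
  then show ?case by simp
next
  case (Suc k)
  show ?case
  proof (cases "m = 0 \<or> n = 0")
    case True
    then show ?thesis
    proof
      assume "m = 0"
      then show ?thesis using Suc.prems by (simp add: funpow_ker_mult)
    next
      assume "n = 0"
      then show ?thesis
        using Suc.prems funpow_ker_mult[of g m f] by (simp add: mult.commute)
    qed
  next
    case False
    then obtain m' n' where m: "m = Suc m'" and n: "n = Suc n'"
      by (meson not0_implies_Suc)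
    have 1: "(\<delta> ^^ (m' + n)) (\<delta> f * g) =
        of_nat ((m' + n) choose m') * (\<delta> ^^ m') (\<delta> f) * (\<delta> ^^ n) g"
      using Suc.hyps(2) Suc.prems m by (intro Suc.hyps(1)) (auto simp: funpow_swap1)
    have 2: "(\<delta> ^^ (m + n')) (f * \<delta> g) =
        of_nat ((m + n') choose m) * (\<delta> ^^ m) f * (\<delta> ^^ n') (\<delta> g)"
      using Suc.hyps(2) Suc.prems n by (intro Suc.hyps(1)) (auto simp: funpow_swap1)
    have "(\<delta> ^^ (m + n)) (f * g) = (\<delta> ^^ (m' + n)) (\<delta> (f * g))"
      using m by (simp add: funpow_swap1)
    also have "\<dots> = (\<delta> ^^ (m' + n)) (\<delta> f * g) + (\<delta> ^^ (m + n')) (f * \<delta> g)"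
      using m n by (simp add: mult funpow_add del: funpow.simps)
    finally show ?thesis
      unfolding 1 2 using m n by (simp add: funpow_swap1 algebra_simps)
  qed
qed

text \<open>The degree as a relation instead of a maximum: no finiteness has to be checked, and 0
  simply has no degree.\<close>

definition has_deg :: "'r \<Rightarrow> nat \<Rightarrow> bool" where
  "has_deg f n \<longleftrightarrow> (\<delta> ^^ n) f \<noteq> 0 \<and> (\<delta> ^^ Suc n) f = 0"

lemma has_deg_nonzero: "has_deg f n \<Longrightarrow> f \<noteq> 0"
  by (auto simp: has_deg_def)

lemma has_deg_0_iff: "has_deg f 0 \<longleftrightarrow> f \<noteq> 0 \<and> \<delta> f = 0"
  by (simp add: has_deg_def)

lemma has_deg_set:
  assumes "has_deg f n"
  shows "{k. (\<delta> ^^ k) f \<noteq> 0} = {..n}"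
proof -
  have "(\<delta> ^^ k) f \<noteq> 0 \<longleftrightarrow> k \<le> n" for k
    using assms funpow_mono[of "Suc n" f k] funpow_mono[of k f n]
    unfolding has_deg_def by (metis not_less_eq_eq)
  then show ?thesis by auto
qed

lemma has_deg_unique: "has_deg f m \<Longrightarrow> has_deg f n \<Longrightarrow> m = n"
  by (drule has_deg_set)+ (metis atMost_eq_iff)

lemma has_deg_ex: "f \<noteq> 0 \<Longrightarrow> (\<delta> ^^ n) f = 0 \<Longrightarrow> \<exists>m. has_deg f m"
proof (induction n)
  case (Suc n)
  then show ?case by (cases "(\<delta> ^^ n) f = 0") (auto simp: has_deg_def)
qed auto

text \<open>The binomial coefficient of \<open>leibniz_top\<close> is nonzero in characteristic
  zero, so the product of the last nonzero iterates survives; being a product of kernel elements, it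
  is killed by one more step.\<close>

lemma has_deg_mult:
  assumes "has_deg f m" "has_deg g n"
  shows "has_deg (f * g) (m + n)"
proof -
  have f: "\<delta> ((\<delta> ^^ m) f) = 0" "(\<delta> ^^ m) f \<noteq> 0" and g: "\<delta> ((\<delta> ^^ n) g) = 0" "(\<delta> ^^ n) g \<noteq> 0"
    using assms by (auto simp: has_deg_def)
  have eq: "(\<delta> ^^ (m + n)) (f * g) = of_nat ((m + n) choose m) * ((\<delta> ^^ m) f * (\<delta> ^^ n) g)"
    using leibniz_top[of m f n g] f g by (simp add: mult.assoc)
  have of_nat: "\<delta> (of_nat k) = 0" for k
    by (induction k) (auto simp: add)
  have "\<delta> ((\<delta> ^^ (m + n)) (f * g)) = 0"
    unfolding eq by (simp add: mult of_nat f g)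
  moreover have "(\<delta> ^^ (m + n)) (f * g) \<noteq> 0"
    unfolding eq using f g by (simp add: binomial_eq_0_iff)
  ultimately show ?thesis by (simp add: has_deg_def)
qed

lemma has_deg_power: "has_deg f m \<Longrightarrow> has_deg (f ^ n) (n * m)"
proof (induction n)
  case (Suc n)
  then show ?case using has_deg_mult[of f m "f ^ n" "n * m"] by simp
qed (simp add: has_deg_0_iff)

lemma has_deg_ker_mult: "has_deg f m \<Longrightarrow> \<delta> u = 0 \<Longrightarrow> u \<noteq> 0 \<Longrightarrow> has_deg (u * f) m"
  using has_deg_mult[of u 0 f m] by (simp add: has_deg_0_iff)

text \<open>Reads off the degree of a variable from an identity in which it occurs only with a
  kernel factor.\<close>

lemma has_deg_ker_cancel:
  assumes "has_deg (u * f) m" "\<delta> u = 0"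
  shows "has_deg f m"
  using assms unfolding has_deg_def
  by (metis funpow_ker_mult mult_eq_0_iff)

lemma has_deg_add:
  assumes "has_deg f m" "(\<delta> ^^ m) g = 0"
  shows "has_deg (f + g) m"
  using assms funpow_mono[of m g "Suc m"]
  unfolding has_deg_def by (simp add: funpow_add del: funpow.simps)

lemma has_deg_deriv: "has_deg f (Suc n) \<Longrightarrow> has_deg (\<delta> f) n"
  by (simp add: has_deg_def funpow_swap1)

text \<open>Degrees add and cannot be negative, so a nonzero product of degree 0 has factors of
  degree 0.\<close>

lemma ker_factor:
  assumes nil: "\<And>h. \<exists>n. (\<delta> ^^ n) h = 0" and "\<delta> (f * g) = 0" "f * g \<noteq> 0"
  shows "\<delta> f = 0"
proof -
  from assms obtain m n where "has_deg f m" "has_deg g n"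
    using has_deg_ex by (metis mult_eq_0_iff)
  then have "has_deg (f * g) (m + n)" "has_deg (f * g) 0"
    using has_deg_mult assms by (auto simp: has_deg_0_iff)
  then show ?thesis
    using \<open>has_deg f m\<close> has_deg_unique has_deg_0_iff by (metis add_is_0)
qed

end

subsection \<open>Substitution into polynomials in two variables\<close>

definition ring_map :: "('a::comm_ring_1 \<Rightarrow> 'b::comm_ring_1) \<Rightarrow> bool" where
  "ring_map \<phi> \<longleftrightarrow> \<phi> 1 = 1 \<and> (\<forall>a b. \<phi> (a + b) = \<phi> a + \<phi> b) \<and> (\<forall>a b. \<phi> (a * b) = \<phi> a * \<phi> b)"

lemma ring_map_add: "ring_map \<phi> \<Longrightarrow> \<phi> (a + b) = \<phi> a + \<phi> b"
  and ring_map_mult: "ring_map \<phi> \<Longrightarrow> \<phi> (a * b) = \<phi> a * \<phi> b"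
  and ring_map_1: "ring_map \<phi> \<Longrightarrow> \<phi> 1 = 1"
  by (auto simp: ring_map_def)

lemma ring_map_0: "ring_map \<phi> \<Longrightarrow> \<phi> 0 = 0"
  using ring_map_add[of \<phi> 0 0] by simp

lemma ring_map_uminus: "ring_map \<phi> \<Longrightarrow> \<phi> (- a) = - \<phi> a"
  using ring_map_add[of \<phi> a "- a"] by (simp add: ring_map_0 eq_neg_iff_add_eq_0 add.commute)

lemma ring_map_diff: "ring_map \<phi> \<Longrightarrow> \<phi> (a - b) = \<phi> a - \<phi> b"
  using ring_map_add[of \<phi> a "- b"] by (simp add: ring_map_uminus)

lemma ring_map_power: "ring_map \<phi> \<Longrightarrow> \<phi> (a ^ n) = \<phi> a ^ n"
  by (induction n) (auto simp: ring_map_1 ring_map_mult)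

lemma ring_map_sum: "ring_map \<phi> \<Longrightarrow> \<phi> (sum F A) = (\<Sum>i\<in>A. \<phi> (F i))"
  by (induction A rule: infinite_finite_induct) (auto simp: ring_map_0 ring_map_add)

lemmas ring_map_simps = ring_map_0 ring_map_1 ring_map_add ring_map_mult ring_map_uminus
  ring_map_diff ring_map_power ring_map_sum

lemma ring_map_comp: "ring_map \<phi> \<Longrightarrow> ring_map \<psi> \<Longrightarrow> ring_map (\<lambda>a. \<psi> (\<phi> a))"
  by (auto simp: ring_map_def)

lemma ring_map_map_poly:
  assumes "ring_map \<phi>"
  shows "ring_map (map_poly \<phi>)"
proof -
  have add: "map_poly \<phi> (a + b) = map_poly \<phi> a + map_poly \<phi> b" for a b
    using assms by (intro poly_eqI) (simp add: coeff_map_poly ring_map_simps)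
  have "map_poly \<phi> (a * b) = map_poly \<phi> a * map_poly \<phi> b" for a b
    using assms by (intro poly_eqI) (simp add: coeff_map_poly ring_map_simps coeff_mult)
  then show ?thesis
    using assms add by (auto simp: ring_map_def)
qed

lemma ring_map_poly: "ring_map (\<lambda>F. poly F y)"
  by (simp add: ring_map_def)

definition peval :: "('a::comm_ring_1 \<Rightarrow> 'b::comm_ring_1) \<Rightarrow> 'a poly \<Rightarrow> 'b \<Rightarrow> 'b" where
  "peval \<phi> F y = poly (map_poly \<phi> F) y"

lemma ring_map_peval: "ring_map \<phi> \<Longrightarrow> ring_map (\<lambda>F. peval \<phi> F y)"
  unfolding peval_def by (rule ring_map_comp[OF ring_map_map_poly ring_map_poly])

lemma peval_pCons: "ring_map \<phi> \<Longrightarrow> peval \<phi> (pCons a F) y = \<phi> a + y * peval \<phi> F y"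
  by (simp add: peval_def map_poly_pCons ring_map_0)

lemma peval_0: "peval \<phi> 0 y = 0"
  by (simp add: peval_def)

lemma peval_altdef:
  assumes "ring_map \<phi>" "degree F \<le> n"
  shows "peval \<phi> F y = (\<Sum>i\<le>n. \<phi> (coeff F i) * y ^ i)"
proof -
  have "degree (map_poly \<phi> F) \<le> n"
    using map_poly_degree_leq assms(2) by (rule le_trans)
  then have "peval \<phi> F y = (\<Sum>i\<le>n. coeff (map_poly \<phi> F) i * y ^ i)"
    unfolding peval_def poly_altdef
    by (intro sum.mono_neutral_left) (auto simp: coeff_eq_0)
  then show ?thesis using assms(1) by (simp add: coeff_map_poly ring_map_0)
qed

lemma ring_map_peval_commute:
  assumes "ring_map \<phi>" "ring_map \<psi>"
  shows "\<psi> (peval \<phi> F y) = peval (\<lambda>a. \<psi> (\<phi> a)) F (\<psi> y)"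
proof (induction F)
  case (pCons a F)
  then show ?case using assms
    by (simp add: peval_pCons ring_map_comp[OF assms] ring_map_add ring_map_mult)
qed (simp add: peval_0 assms ring_map_0)

lemma peval_pcompose:
  assumes "ring_map \<phi>"
  shows "peval \<phi> (pcompose F G) y = peval \<phi> F (peval \<phi> G y)"
  by (induction F)
    (simp_all add: peval_0 peval_pCons assms pcompose_pCons ring_map_add[OF ring_map_peval]
      ring_map_mult[OF ring_map_peval])

text \<open>Chain rule with nonconstant coefficients: the first summand differentiates the
  coefficients, as the inner variable of \<open>subst2\<close> requires.\<close>

lemma deriv_peval:
  fixes \<delta> :: "'b::{idom,ring_char_0} \<Rightarrow> 'b"
  assumes "ring_map \<phi>" "ring_derivation \<delta>"
  shows "\<delta> (peval \<phi> F y) = poly (map_poly (\<lambda>a. \<delta> (\<phi> a)) F) y + peval \<phi> (pderiv F) y * \<delta> y"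
proof -
  interpret ring_derivation \<delta> by fact
  note hom = ring_map_peval[OF assms(1), of y]
  show ?thesis
  proof (induction F)
    case (pCons a F)
    then show ?case
      by (simp add: peval_pCons assms(1) add mult map_poly_pCons ring_map_0 pderiv_pCons
          ring_map_add[OF hom] algebra_simps)
  qed (simp add: peval_0)
qed

definition cst :: "'k::comm_ring_1 \<Rightarrow> 'k poly poly" where
  "cst a = [:[:a:]:]"

definition varx :: "'k::comm_ring_1 poly poly" where
  "varx = [:[:0, 1:]:]"

definition vary :: "'k::comm_ring_1 poly poly" where
  "vary = [:0, 1:]"

lemma ring_map_cst: "ring_map cst"
  by (auto simp: ring_map_def cst_def one_pCons)

lemmas cst_simps = ring_map_simps[OF ring_map_cst]

lemma cst_eq_0_iff [simp]: "cst a = 0 \<longleftrightarrow> a = 0"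
  by (simp add: cst_def)

text \<open>With \<open>cst\<close> for \<sigma> this is an endomorphism of \<open>k[x,y]\<close>,
  with \<open>scal\<close> it is the evaluation \<open>eval2\<close> in \<open>B\<close>; one chain
  rule serves both.\<close>

definition subst2 :: "('k::comm_ring_1 \<Rightarrow> 'b::comm_ring_1) \<Rightarrow> 'k poly poly \<Rightarrow> 'b \<Rightarrow> 'b \<Rightarrow> 'b" where
  "subst2 \<sigma> F x y = peval (\<lambda>c. peval \<sigma> c x) F y"

lemma ring_map_subst2: "ring_map \<sigma> \<Longrightarrow> ring_map (\<lambda>F. subst2 \<sigma> F x y)"
  unfolding subst2_def by (erule ring_map_peval[OF ring_map_peval])

lemmas subst2_simps = ring_map_simps[OF ring_map_subst2]

lemma subst2_cst [simp]: "ring_map \<sigma> \<Longrightarrow> subst2 \<sigma> (cst a) x y = \<sigma> a"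
  by (simp add: subst2_def cst_def peval_def map_poly_pCons ring_map_0)

lemma subst2_varx [simp]: "ring_map \<sigma> \<Longrightarrow> subst2 \<sigma> varx x y = x"
  by (simp add: subst2_def varx_def peval_def map_poly_pCons ring_map_0 ring_map_1)

lemma subst2_vary [simp]: "ring_map \<sigma> \<Longrightarrow> subst2 \<sigma> vary x y = y"
  by (simp add: subst2_def vary_def peval_def map_poly_pCons ring_map_0 ring_map_1)

lemma subst2_altdef:
  assumes "ring_map \<sigma>" "degree F \<le> n" "\<And>j. degree (coeff F j) \<le> m"
  shows "subst2 \<sigma> F x y = (\<Sum>j\<le>n. \<Sum>i\<le>m. \<sigma> (coeff (coeff F j) i) * x ^ i * y ^ j)"
  unfolding subst2_def
  by (subst peval_altdef[OF ring_map_peval[OF assms(1)] assms(2)],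
      subst peval_altdef[OF assms(1) assms(3)])
    (simp add: sum_distrib_right)

lemma degree_bound: "\<exists>m. \<forall>j. degree (coeff (F :: 'a::zero poly poly) j) \<le> m"
proof
  show "\<forall>j. degree (coeff F j) \<le> Max ((\<lambda>j. degree (coeff F j)) ` {..degree F})"
  proof
    fix j
    show "degree (coeff F j) \<le> Max ((\<lambda>j. degree (coeff F j)) ` {..degree F})"
      by (cases "j \<le> degree F") (auto intro!: Max_ge simp: coeff_eq_0)
  qed
qed

lemma ring_map_subst2_commute:
  assumes "ring_map \<sigma>" "ring_map \<psi>"
  shows "\<psi> (subst2 \<sigma> F x y) = subst2 (\<lambda>a. \<psi> (\<sigma> a)) F (\<psi> x) (\<psi> y)"
  unfolding subst2_def
  by (subst ring_map_peval_commute[OF ring_map_peval[OF assms(1)] assms(2)])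
    (simp add: ring_map_peval_commute[OF assms])

lemma subst2_id: "subst2 cst F varx vary = F"
proof (induction F)
  case (pCons c F)
  have "peval cst c varx = [:c:]"
  proof (induction c)
    case (pCons a c)
    then show ?case by (simp add: peval_pCons ring_map_cst) (simp add: cst_def varx_def)
  qed (simp add: peval_0)
  with pCons show ?case
    by (simp add: subst2_def peval_pCons ring_map_peval ring_map_cst) (simp add: vary_def)
qed (simp add: subst2_def peval_0)

lemma subst2_subst2:
  "ring_map \<sigma> \<Longrightarrow> subst2 \<sigma> (subst2 cst F x' y') x y = subst2 \<sigma> F (subst2 \<sigma> x' x y) (subst2 \<sigma> y' x y)"
  by (subst ring_map_subst2_commute[OF ring_map_cst ring_map_subst2]) simp_all

text \<open>A polynomial in one variable is read as one in the second variable only, so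
  \<open>x\<close> is arbitrary and the rules for \<open>subst2\<close> apply to composites
  \<open>G(r)\<close>.\<close>

lemma peval_cst_eq_subst2: "peval cst G r = subst2 cst (map_poly (\<lambda>a. [:a:]) G) x r"
  by (induction G)
    (simp_all add: peval_0 subst2_def peval_pCons ring_map_cst ring_map_peval map_poly_pCons)

section \<open>Partial derivatives, the chain rule and the Jacobian of the plane\<close>

definition dx :: "'k::idom poly poly \<Rightarrow> 'k poly poly" where
  "dx = map_poly pderiv"

definition dy :: "'k::idom poly poly \<Rightarrow> 'k poly poly" where
  "dy = pderiv"

lemma coeff_dx: "coeff (coeff (dx F) j) i = of_nat (Suc i) * coeff (coeff F j) (Suc i)"
  by (simp add: dx_def coeff_map_poly coeff_pderiv)

lemma coeff_of_nat_mult: "coeff (of_nat n * c) i = of_nat n * coeff c i"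
  by (induction n) (simp_all only: of_nat_Suc distrib_right coeff_add mult_1, simp)

lemma coeff_dy: "coeff (coeff (dy F) j) i = of_nat (Suc j) * coeff (coeff F (Suc j)) i"
  by (simp add: dy_def coeff_pderiv coeff_of_nat_mult del: of_nat_Suc)

lemma ring_derivation_map_pderiv:
  assumes "ring_derivation (\<delta> :: 'b::{idom,ring_char_0} \<Rightarrow> 'b)"
  shows "ring_derivation (map_poly \<delta>)"
proof -
  interpret ring_derivation \<delta> by fact
  have "map_poly \<delta> (a * b) = map_poly \<delta> a * b + a * map_poly \<delta> b" for a b
    by (rule poly_eqI, simp add: coeff_map_poly coeff_mult, simp add: sum mult, simp add: sum.distrib)
  moreover have "map_poly \<delta> (a + b) = map_poly \<delta> a + map_poly \<delta> b" for a b
    by (rule poly_eqI) (simp add: coeff_map_poly add)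
  ultimately show ?thesis by (simp add: ring_derivation_def)
qed

lemma ring_derivation_pderiv: "ring_derivation (pderiv :: 'b::{idom,ring_char_0} poly \<Rightarrow> _)"
  by standard (simp_all add: pderiv_add pderiv_mult)

lemma ring_derivation_dx: "ring_derivation (dx :: 'k::{idom,ring_char_0} poly poly \<Rightarrow> _)"
  unfolding dx_def by (intro ring_derivation_map_pderiv ring_derivation_pderiv)

lemma ring_derivation_dy: "ring_derivation (dy :: 'k::{idom,ring_char_0} poly poly \<Rightarrow> _)"
  unfolding dy_def by (rule ring_derivation_pderiv)

lemma deriv_subst2:
  fixes \<delta> :: "'b::{idom,ring_char_0} \<Rightarrow> 'b" and \<sigma> :: "'k::idom \<Rightarrow> 'b"
  assumes "ring_map \<sigma>" "ring_derivation \<delta>" "\<And>a. \<delta> (\<sigma> a) = 0"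
  shows "\<delta> (subst2 \<sigma> F x y) = subst2 \<sigma> (dx F) x y * \<delta> x + subst2 \<sigma> (dy F) x y * \<delta> y"
proof -
  interpret ring_derivation \<delta> by fact
  have inner: "\<delta> (peval \<sigma> c x) = peval \<sigma> (pderiv c) x * \<delta> x" for c
  proof -
    have "poly (map_poly (\<lambda>a. \<delta> (\<sigma> a)) c) x = 0"
      by (simp add: assms(3) poly_altdef coeff_map_poly)
    then show ?thesis using deriv_peval[OF assms(1,2)] by simp
  qed
  have "poly (map_poly (\<lambda>c. peval \<sigma> (pderiv c) x * \<delta> x) F) y =
        poly (map_poly (\<lambda>c. peval \<sigma> c x) (dx F)) y * \<delta> x"
    unfolding dx_def
    by (induction F)
      (simp_all add: map_poly_pCons peval_0 ring_map_0[OF ring_map_peval[OF assms(1)]] algebra_simps)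
  then show ?thesis
    unfolding subst2_def
    by (subst deriv_peval[OF ring_map_peval[OF assms(1)] assms(2)]) (simp only: inner, simp add: peval_def dy_def)
qed

definition jac :: "'k::idom poly poly \<Rightarrow> 'k poly poly \<Rightarrow> 'k poly poly" where
  "jac F G = dx F * dy G - dy F * dx G"

lemma ring_derivation_jac: "ring_derivation (jac (F :: 'k::{idom,ring_char_0} poly poly))"
proof -
  interpret dx: ring_derivation "dx :: 'k poly poly \<Rightarrow> _" by (rule ring_derivation_dx)
  interpret dy: ring_derivation "dy :: 'k poly poly \<Rightarrow> _" by (rule ring_derivation_dy)
  show ?thesis
    by standard (simp_all add: jac_def dx.add dy.add dx.mult dy.mult algebra_simps)
qed

lemma dx_simps [simp]: "dx (cst a) = 0" "dx varx = 1" "dx vary = 0"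
  and dy_simps [simp]: "dy (cst a) = 0" "dy varx = 0" "dy vary = 1"
  by (simp_all add: dx_def dy_def cst_def varx_def vary_def map_poly_pCons pderiv_pCons one_pCons)

lemma jac_self [simp]: "jac F F = 0"
  by (simp add: jac_def)

lemma jac_cst [simp]: "jac F (cst a) = 0"
  by (simp add: jac_def)

text \<open>Chain rule for Jacobians: a substitution multiplies them by its own Jacobian, which is
  constant for the coordinate changes used later.\<close>

lemma jac_subst2:
  fixes F G x y :: "'k::{idom,ring_char_0} poly poly"
  shows "jac (subst2 cst F x y) (subst2 cst G x y) = subst2 cst (jac F G) x y * jac x y"
proof -
  note simps = deriv_subst2[OF ring_map_cst ring_derivation_dx] deriv_subst2[OF ring_map_cst ring_derivation_dy]
  show ?thesis
    by (simp add: jac_def simps subst2_simps ring_map_cst algebra_simps)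
qed

lemma jac_peval:
  fixes r :: "'k::{idom,ring_char_0} poly poly"
  shows "jac (peval cst G r) r = 0"
  using jac_subst2[of "map_poly (\<lambda>a. [:a:]) G" r r vary]
  by (simp add: peval_cst_eq_subst2[of G r r] ring_map_cst)

definition loc_nil :: "'k::{idom,ring_char_0} poly poly \<Rightarrow> bool" where
  "loc_nil F \<longleftrightarrow> (\<forall>h. \<exists>n. (jac F ^^ n) h = 0)"

text \<open>The hypotheses make \<open>F \<mapsto> subst2 cst F x y\<close> a surjection multiplying Jacobians by a constant.\<close>

lemma loc_nil_subst2:
  fixes f :: "'k::{idom,ring_char_0} poly poly"
  assumes f: "loc_nil f" and J: "jac x y = cst e"
    and inv: "subst2 cst x' x y = varx" "subst2 cst y' x y = vary"
  shows "loc_nil (subst2 cst f x y)"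
  unfolding loc_nil_def
proof
  fix h
  let ?S = "\<lambda>F. subst2 cst F x y"
  interpret d: ring_derivation "jac (?S f)" by (rule ring_derivation_jac)
  have step: "(jac (?S f) ^^ n) (?S G) = cst (e ^ n) * ?S ((jac f ^^ n) G)" for n G
  proof (induction n)
    case (Suc n)
    have "jac (?S f) (cst (e ^ n) * ?S ((jac f ^^ n) G)) =
        cst (e ^ n) * (?S (jac f ((jac f ^^ n) G)) * jac x y)"
      by (simp add: d.mult jac_subst2)
    then show ?case using Suc by (simp add: J cst_simps mult_ac)
  qed (simp add: cst_simps)
  have "?S (subst2 cst h x' y') = h"
    by (simp add: subst2_subst2 ring_map_cst inv subst2_id)
  moreover obtain n where "(jac f ^^ n) (subst2 cst h x' y') = 0"
    using f by (auto simp: loc_nil_def)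
  ultimately have "(jac (?S f) ^^ n) h = 0"
    using step[of n "subst2 cst h x' y'"] by (simp add: subst2_simps ring_map_cst)
  then show "\<exists>n. (jac (?S f) ^^ n) h = 0" ..
qed

subsection \<open>Leading forms with respect to weights\<close>

text \<open>
  The weights are \<open>s\<close> for \<open>x\<close> and \<open>t\<close> for \<open>y\<close>; the leading form \<open>g\<close> is zero if \<open>F\<close> has weight less than \<open>M\<close>.
\<close>

definition leading_form ::
    "nat \<Rightarrow> nat \<Rightarrow> int \<Rightarrow> 'k::comm_ring_1 poly poly \<Rightarrow> 'k poly poly \<Rightarrow> bool" where
  "leading_form s t M F g \<longleftrightarrow> (\<forall>i j.
     coeff (coeff g j) i = (if int (s * i + t * j) = M then coeff (coeff F j) i else 0) \<and>
     (int (s * i + t * j) > M \<longrightarrow> coeff (coeff F j) i = 0))"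

lemma leading_formD:
  assumes "leading_form s t M F g"
  shows "int (s * i + t * j) = M \<Longrightarrow> coeff (coeff g j) i = coeff (coeff F j) i"
    and "int (s * i + t * j) \<noteq> M \<Longrightarrow> coeff (coeff g j) i = 0"
    and "int (s * i + t * j) > M \<Longrightarrow> coeff (coeff F j) i = 0"
  using assms unfolding leading_form_def by presburger+

lemma poly2_eqI: "(\<And>i j. coeff (coeff F j) i = coeff (coeff G j) i) \<Longrightarrow> F = G"
  by (simp add: poly_eq_iff)

lemma coeff_mult2:
  "coeff (coeff (F * G) j) i =
     (\<Sum>b\<le>j. \<Sum>a\<le>i. coeff (coeff F b) a * coeff (coeff G (j - b)) (i - a))"
  by (simp add: coeff_mult coeff_sum)

lemma leading_form_0: "leading_form s t M 0 g \<longleftrightarrow> g = 0"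
  by (auto simp: leading_form_def intro: poly2_eqI)

lemma leading_form_unique: "leading_form s t M F g \<Longrightarrow> leading_form s t M F g' \<Longrightarrow> g = g'"
  by (intro poly2_eqI) (auto simp: leading_form_def)

lemma leading_form_add:
  "leading_form s t M F f \<Longrightarrow> leading_form s t M G g \<Longrightarrow> leading_form s t M (F + G) (f + g)"
  by (auto simp: leading_form_def)

lemma leading_form_uminus: "leading_form s t M F f \<Longrightarrow> leading_form s t M (- F) (- f)"
  by (auto simp: leading_form_def)

lemma leading_form_diff:
  "leading_form s t M F f \<Longrightarrow> leading_form s t M G g \<Longrightarrow> leading_form s t M (F - G) (f - g)"
  using leading_form_add[OF _ leading_form_uminus] by fastforce

lemma leading_form_sum:
  "(\<And>i. i \<in> A \<Longrightarrow> leading_form s t M (F i) (f i)) \<Longrightarrow>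
     leading_form s t M (\<Sum>i\<in>A. F i) (\<Sum>i\<in>A. f i)"
  by (induction A rule: infinite_finite_induct) (auto simp: leading_form_0 leading_form_add)

lemma leading_form_lower: "leading_form s t M F f \<Longrightarrow> M < N \<Longrightarrow> leading_form s t N F 0"
  unfolding leading_form_def by fastforce

lemma leading_form_mult:
  assumes F: "leading_form s t M F f" and G: "leading_form s t N G g"
  shows "leading_form s t (M + N) (F * G) (f * g)"
  unfolding leading_form_def
proof (intro allI conjI impI)
  fix i j
  have split: "int (s * i + t * j) = int (s * a + t * b) + int (s * (i - a) + t * (j - b))"
    if ab: "a \<le> i" "b \<le> j" for a b
    using ab by (metis add.assoc add.left_commute add_mult_distrib2 le_add_diff_inverse of_nat_add)
  show "coeff (coeff (F * G) j) i = 0" if gt: "int (s * i + t * j) > M + N"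
  proof -
    have "coeff (coeff F b) a * coeff (coeff G (j - b)) (i - a) = 0" if ab: "a \<le> i" "b \<le> j" for a b
    proof (cases "int (s * a + t * b) > M")
      case False
      then have "int (s * (i - a) + t * (j - b)) > N" using split[OF ab] gt by linarith
      then show ?thesis by (simp add: leading_formD(3)[OF G])
    qed (simp add: leading_formD(3)[OF F])
    then show ?thesis unfolding coeff_mult2 by (auto intro!: sum.neutral)
  qed
  show "coeff (coeff (f * g) j) i =
      (if int (s * i + t * j) = M + N then coeff (coeff (F * G) j) i else 0)"
  proof (cases "int (s * i + t * j) = M + N")
    case True
    have "coeff (coeff f b) a * coeff (coeff g (j - b)) (i - a) =
        coeff (coeff F b) a * coeff (coeff G (j - b)) (i - a)" if ab: "a \<le> i" "b \<le> j" for a b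
    proof -
      consider "int (s * a + t * b) = M" "int (s * (i - a) + t * (j - b)) = N"
        | "int (s * a + t * b) > M" | "int (s * (i - a) + t * (j - b)) > N"
        using split[OF ab] True by linarith
      then show ?thesis
        by cases (use leading_formD[OF F] leading_formD[OF G] in \<open>auto simp del: of_nat_add of_nat_mult\<close>)
    qed
    then show ?thesis using True unfolding coeff_mult2 by (auto intro!: sum.cong)
  next
    case False
    have "coeff (coeff f b) a * coeff (coeff g (j - b)) (i - a) = 0" if ab: "a \<le> i" "b \<le> j" for a b
    proof -
      have "int (s * a + t * b) \<noteq> M \<or> int (s * (i - a) + t * (j - b)) \<noteq> N"
        using split[OF ab] False by linarith
      then show ?thesis
        using leading_formD(2)[OF F] leading_formD(2)[OF G] by (metis mult_zero_left mult_zero_right)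
    qed
    then show ?thesis using False unfolding coeff_mult2 by (auto intro!: sum.neutral)
  qed
qed

lemma leading_form_cst: "leading_form s t 0 (cst a) (cst a)"
  by (auto simp: leading_form_def cst_def coeff_pCons split: nat.splits)

lemma leading_form_1: "leading_form s t 0 1 1"
  using leading_form_cst[of s t 1] by (simp add: cst_simps)

lemma leading_form_varx: "leading_form s t (int s) varx varx"
  by (auto simp: leading_form_def varx_def coeff_pCons split: nat.splits)

lemma leading_form_vary: "leading_form s t (int t) vary vary"
  by (auto simp: leading_form_def vary_def coeff_pCons split: nat.splits)

lemma leading_form_power:
  assumes "leading_form s t M F f"
  shows "leading_form s t (int n * M) (F ^ n) (f ^ n)"
proof (induction n)
  case (Suc n)
  then show ?case using leading_form_mult[OF assms Suc] by (simp add: algebra_simps)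
qed (simp add: leading_form_1)

lemma leading_form_monomial:
  "leading_form s t (int (s * i + t * j)) (cst a * varx ^ i * vary ^ j) (cst a * varx ^ i * vary ^ j)"
  using leading_form_mult[OF leading_form_mult[OF leading_form_cst
        leading_form_power[OF leading_form_varx]] leading_form_power[OF leading_form_vary],
      of s t i j a]
  by (simp add: mult.commute[of "int s"] mult.commute[of "int t"])

lemma leading_form_dx:
  fixes F :: "'k::idom poly poly"
  assumes "leading_form s t M F f"
  shows "leading_form s t (M - int s) (dx F) (dx f)"
  unfolding leading_form_def
proof (intro allI)
  fix i j
  show "coeff (coeff (dx f) j) i =
      (if int (s * i + t * j) = M - int s then coeff (coeff (dx F) j) i else 0) \<and>
      (M - int s < int (s * i + t * j) \<longrightarrow> coeff (coeff (dx F) j) i = 0)"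
    using leading_formD[OF assms, of "Suc i" j] by (auto simp: coeff_dx algebra_simps)
qed

lemma leading_form_dy:
  fixes F :: "'k::idom poly poly"
  assumes "leading_form s t M F f"
  shows "leading_form s t (M - int t) (dy F) (dy f)"
  unfolding leading_form_def
proof (intro allI)
  fix i j
  show "coeff (coeff (dy f) j) i =
      (if int (s * i + t * j) = M - int t then coeff (coeff (dy F) j) i else 0) \<and>
      (M - int t < int (s * i + t * j) \<longrightarrow> coeff (coeff (dy F) j) i = 0)"
    using leading_formD[OF assms, of i "Suc j"] by (auto simp: coeff_dy algebra_simps)
qed

text \<open>Each partial derivative lowers the weight by that of its variable, so
  \<open>jac F\<close> shifts weights by at most \<open>M - s - t\<close>. The shift may be
  negative, which is why weights are integers, and the top component may cancel to 0.\<close>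

lemma leading_form_jac:
  fixes F G :: "'k::idom poly poly"
  assumes "leading_form s t M F f" "leading_form s t N G g"
  shows "leading_form s t (N + (M - int s - int t)) (jac F G) (jac f g)"
  unfolding jac_def
  using leading_form_diff[OF leading_form_mult[OF leading_form_dx[OF assms(1)] leading_form_dy[OF assms(2)]]]
    leading_form_mult[OF leading_form_dy[OF assms(1)] leading_form_dx[OF assms(2)]]
  by (simp add: algebra_simps)

text \<open>Nilpotent elements are closed under sums, so monomials suffice; these are their own
  leading forms for every weighting.\<close>

lemma loc_nilI:
  fixes g :: "'k::{idom,ring_char_0} poly poly"
  assumes "\<And>a i j. \<exists>n. (jac g ^^ n) (cst a * varx ^ i * vary ^ j) = 0"
  shows "loc_nil g"
  unfolding loc_nil_def
proof
  fix h :: "'k poly poly"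
  interpret ring_derivation "jac g" by (rule ring_derivation_jac)
  from degree_bound obtain m where m: "\<And>j. degree (coeff h j) \<le> m" by metis
  have "h = (\<Sum>j\<le>degree h. \<Sum>i\<le>m. cst (coeff (coeff h j) i) * varx ^ i * vary ^ j)"
    using subst2_altdef[OF ring_map_cst order_refl m] subst2_id[of h] by metis
  moreover have "\<exists>k. (jac g ^^ k) (\<Sum>j\<le>degree h. \<Sum>i\<le>m. cst (coeff (coeff h j) i) * varx ^ i * vary ^ j) = 0"
    by (intro nilpotent_sum assms)
  ultimately show "\<exists>n. (jac g ^^ n) h = 0" by simp
qed

text \<open>For a monomial \<open>h\<close>, \<open>(jac g ^^ n) h\<close> is the component of
  \<open>(jac F ^^ n) h\<close> in the highest weight available to it, so it vanishes with
  it.\<close>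

lemma loc_nil_leading_form:
  fixes F g :: "'k::{idom,ring_char_0} poly poly"
  assumes F: "loc_nil F" and g: "leading_form s t M F g"
  shows "loc_nil g"
proof (rule loc_nilI)
  fix a :: 'k and i j
  let ?h = "cst a * varx ^ i * vary ^ j"
  have iter: "leading_form s t (int (s * i + t * j) + int n * (M - int s - int t))
      ((jac F ^^ n) ?h) ((jac g ^^ n) ?h)" for n
  proof (induction n)
    case (Suc n)
    then show ?case using leading_form_jac[OF g Suc] by (simp add: algebra_simps)
  qed (use leading_form_monomial in simp)
  from F obtain n where "(jac F ^^ n) ?h = 0" by (auto simp: loc_nil_def)
  then have "(jac g ^^ n) ?h = 0" using iter[of n] by (simp add: leading_form_0)
  then show "\<exists>n. (jac g ^^ n) ?h = 0" ..
qed

text \<open>Substituting elements of weights \<open>s\<close> and \<open>t\<close> keeps the bound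
  \<open>M\<close>, so an edge form can be followed through a coordinate change.\<close>

lemma leading_form_subst2:
  fixes F f :: "'k::comm_ring_1 poly poly"
  assumes F: "leading_form s t M F f"
    and x: "leading_form s' t' (int s) x x0" and y: "leading_form s' t' (int t) y y0"
  shows "leading_form s' t' M (subst2 cst F x y) (subst2 cst f x0 y0)"
proof -
  obtain n m where F_sum: "\<And>x y. subst2 cst F x y = (\<Sum>j\<le>n. \<Sum>i\<le>m. cst (coeff (coeff F j) i) * x ^ i * y ^ j)"
    and bounds: "degree F \<le> n" "\<And>j. degree (coeff F j) \<le> m"
  proof -
    from degree_bound obtain m where m: "\<And>j. degree (coeff F j) \<le> m" by metis
    show ?thesis using that[of m "degree F"] subst2_altdef[OF ring_map_cst _ m, of "degree F"] m by simp
  qed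
  have f: "coeff (coeff f j) i = (if int (s * i + t * j) = M then coeff (coeff F j) i else 0)" for i j
    using F unfolding leading_form_def by blast
  have "degree f \<le> n"
    using bounds(1) by (intro degree_le) (auto simp: poly_eq_iff f coeff_eq_0)
  moreover have "degree (coeff f j) \<le> m" for j
    using bounds(2)[of j] by (intro degree_le) (auto simp: f coeff_eq_0)
  ultimately have f_sum: "subst2 cst f x0 y0 = (\<Sum>j\<le>n. \<Sum>i\<le>m. cst (coeff (coeff f j) i) * x0 ^ i * y0 ^ j)"
    by (intro subst2_altdef ring_map_cst)
  have "leading_form s' t' M (cst (coeff (coeff F j) i) * x ^ i * y ^ j)
      (cst (coeff (coeff f j) i) * x0 ^ i * y0 ^ j)" for i j
  proof -
    have *: "leading_form s' t' (int (s * i + t * j)) (cst c * x ^ i * y ^ j) (cst c * x0 ^ i * y0 ^ j)" for c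
      using leading_form_mult[OF leading_form_mult[OF leading_form_cst
            leading_form_power[OF x]] leading_form_power[OF y], of i j c]
      by (simp add: mult.commute[of "int s"] mult.commute[of "int t"])
    consider "int (s * i + t * j) = M" | "int (s * i + t * j) < M" | "int (s * i + t * j) > M"
      by linarith
    then show ?thesis
    proof cases
      case 1
      with * show ?thesis by (simp add: f)
    next
      case 2
      then have "coeff (coeff f j) i = 0" by (simp add: f del: of_nat_add of_nat_mult)
      then show ?thesis using leading_form_lower[OF * 2] by (simp add: cst_simps)
    next
      case 3
      then have "coeff (coeff f j) i = 0" "coeff (coeff F j) i = 0"
        using leading_formD(3)[OF F 3] by (auto simp: f simp del: of_nat_add of_nat_mult)
      then show ?thesis by (simp add: cst_simps leading_form_0)
    qed
  qed
  then show ?thesis unfolding F_sum f_sum by (intro leading_form_sum)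
qed

lemma coeff_monomial2:
  "coeff (coeff (cst c * varx ^ a * vary ^ b) j) i = (if i = a \<and> j = b then c else 0)"
proof -
  have x: "varx ^ a = ([:monom 1 a:] :: 'a poly poly)"
    by (induction a) (simp_all add: varx_def monom_0 one_pCons monom_Suc)
  have y: "vary ^ b = (monom 1 b :: 'a poly poly)"
    by (induction b) (simp_all add: vary_def monom_0 monom_Suc)
  show ?thesis unfolding x y cst_def by (auto simp: smult_monom)
qed

lemma poly2_of_coeffs:
  obtains g :: "'k::comm_ring_1 poly poly"
  where "\<And>i j. coeff (coeff g j) i = (if j \<le> n \<and> i \<le> m then c i j else 0)"
proof
  fix i j
  have inner: "(\<Sum>a\<le>m. if i = a \<and> j = b then c a b else 0) =
      (if j = b then if i \<le> m then c i b else 0 else 0)" for b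
    by (cases "j = b") auto
  show "coeff (coeff (\<Sum>b\<le>n. \<Sum>a\<le>m. cst (c a b) * varx ^ a * vary ^ b) j) i =
      (if j \<le> n \<and> i \<le> m then c i j else 0)"
    by (simp add: coeff_sum coeff_monomial2 inner)
qed

lemma leading_form_exists:
  fixes F :: "'k::comm_ring_1 poly poly"
  assumes "\<And>i j. int (s * i + t * j) > M \<Longrightarrow> coeff (coeff F j) i = 0"
  obtains g where "leading_form s t M F g"
proof -
  from degree_bound obtain m where m: "\<And>j. degree (coeff F j) \<le> m" by metis
  obtain g where g: "\<And>i j. coeff (coeff g j) i = (if j \<le> degree F \<and> i \<le> m then
       (if int (s * i + t * j) = M then coeff (coeff F j) i else 0) else 0)"
    using poly2_of_coeffs[of "degree F" m "\<lambda>i j. if int (s * i + t * j) = M then coeff (coeff F j) i else 0"]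
    by blast
  have "coeff (coeff F j) i = 0" if "\<not> (j \<le> degree F \<and> i \<le> m)" for i j
    using that m[of j] by (metis coeff_0 coeff_eq_0 not_le order.strict_trans1)
  then have "leading_form s t M F g"
    using assms unfolding leading_form_def by (auto simp: g)
  then show ?thesis by (rule that)
qed

subsection \<open>Weighted homogeneous polynomials with locally nilpotent Jacobian derivation\<close>

lemma (in ring_derivation) ker_power:
  "\<delta> (f ^ n) = 0 \<Longrightarrow> n > 0 \<Longrightarrow> \<delta> f = 0"
  by (cases "f = 0") (auto simp: power)

text \<open>The homogenized \<open>G\<close>: formally \<open>B ^ m * G(A / B)\<close>. The exponent
  \<open>m\<close> is explicit because \<open>G\<close> may have smaller degree, and then powers of
  \<open>B\<close> split off.\<close>

definition binary_form :: "nat \<Rightarrow> 'k::comm_ring_1 poly \<Rightarrow> 'k poly poly \<Rightarrow> 'k poly poly \<Rightarrow> 'k poly poly" where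
  "binary_form m G A B = (\<Sum>k\<le>m. cst (coeff G k) * A ^ k * B ^ (m - k))"

lemma binary_form_diff: "binary_form m (G - H) A B = binary_form m G A B - binary_form m H A B"
  by (simp add: binary_form_def cst_simps algebra_simps sum_subtractf)

lemma binary_form_smult: "binary_form m (smult c G) A B = cst c * binary_form m G A B"
  by (simp add: binary_form_def cst_simps sum_distrib_left mult.assoc)

lemma binary_form_pCons_0: "binary_form (Suc m) (pCons 0 G) A B = A * binary_form m G A B"
  unfolding binary_form_def
  by (subst sum.atMost_Suc_shift) (simp add: cst_simps sum_distrib_left mult_ac)

lemma binary_form_Suc:
  assumes "degree G \<le> m"
  shows "binary_form (Suc m) G A B = B * binary_form m G A B"
proof -
  have "coeff G (Suc m) = 0" using assms by (intro coeff_eq_0) simp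
  then show ?thesis
    by (simp add: binary_form_def cst_simps sum_distrib_left mult_ac Suc_diff_le)
qed

lemma binary_form_linear_mult:
  assumes "degree G \<le> m"
  shows "binary_form (Suc m) ([:-l, 1:] * G) A B = (A - cst l * B) * binary_form m G A B"
proof -
  have "[:-l, 1:] * G = pCons 0 G - smult l G" by simp
  then show ?thesis
    by (simp only: binary_form_diff binary_form_smult binary_form_pCons_0 binary_form_Suc[OF assms])
      (simp add: algebra_simps)
qed

lemma binary_form_linear_power:
  fixes l :: "'k::idom"
  shows "binary_form m ([:-l, 1:] ^ m) A B = (A - cst l * B) ^ m"
proof (induction m)
  case 0
  then show ?case by (simp add: binary_form_def cst_simps)
next
  case (Suc m)
  have "degree ([:-l, 1:] ^ m) \<le> m" by (simp add: degree_power_eq)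
  from binary_form_linear_mult[OF this, of l A B] Suc show ?case by (simp only: power_Suc)
qed

lemma poly_single_root:
  fixes G :: "'k::alg_closed_field poly"
  assumes "\<And>x. poly G x = 0 \<Longrightarrow> x = l"
  shows "G = smult (lead_coeff G) ([:-l, 1:] ^ degree G)"
proof -
  obtain R where R: "size R = degree G" "G = smult (lead_coeff G) (\<Prod>x\<in>#R. [:-x, 1:])"
    using alg_closed_imp_factorization[of G] assms by (cases "G = 0") auto
  have "x = l" if "x \<in># R" for x
  proof (rule assms)
    have "[:-x, 1:] dvd (\<Prod>x\<in>#R. [:-x, 1:])"
      using that by (intro dvd_prod_mset) auto
    then have "[:-x, 1:] dvd G" by (subst R(2)) (rule dvd_smult)
    then show "poly G x = 0" by (simp add: poly_eq_0_iff_dvd)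
  qed
  then have "R = replicate_mset (degree G) l"
    by (metis R(1) set_mset_subset_singletonD singletonI subsetI)
  then show ?thesis using R(2) by simp
qed

text \<open>By coprimality \<open>s * i + t * j = t * n\<close> forces \<open>t dvd i\<close>, so
  \<open>i = t * i'\<close> and \<open>j = n - s * i'\<close>: up to the factor
  \<open>y ^ (n mod s)\<close> only powers of \<open>y ^ s\<close> and \<open>x ^ t\<close>
  occur.\<close>

lemma homogeneous_as_binary_form:
  fixes g :: "'k::comm_ring_1 poly poly"
  assumes hom: "leading_form s t (int (t * n)) g g" and "coprime s t" "s > 0" "t > 0"
  obtains G where "g = vary ^ (n mod s) * binary_form (n div s) G (vary ^ s) (varx ^ t)"
    and "degree G \<le> n div s"
    and "\<And>k. k \<le> n div s \<Longrightarrow> coeff G k = coeff (coeff g (n mod s + s * k)) (t * (n div s - k))"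
proof -
  define m where "m = n div s"
  define r where "r = n mod s"
  have n: "n = s * m + r" by (simp add: m_def r_def)
  define G where "G = (\<Sum>k\<le>m. monom (coeff (coeff g (r + s * k)) (t * (m - k))) k)"
  have coeff_G: "coeff G k = (if k \<le> m then coeff (coeff g (r + s * k)) (t * (m - k)) else 0)" for k
    by (simp add: G_def coeff_sum)
  have "g = vary ^ r * binary_form m G (vary ^ s) (varx ^ t)"
  proof (rule poly2_eqI)
    fix i j
    have "vary ^ r * binary_form m G (vary ^ s) (varx ^ t) =
        (\<Sum>k\<le>m. cst (coeff G k) * varx ^ (t * (m - k)) * vary ^ (r + s * k))"
      by (simp add: binary_form_def sum_distrib_left power_add power_mult[symmetric] mult_ac)
    then have rhs: "coeff (coeff (vary ^ r * binary_form m G (vary ^ s) (varx ^ t)) j) i =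
        (\<Sum>k\<le>m. if i = t * (m - k) \<and> j = r + s * k then coeff G k else 0)"
      by (simp add: coeff_sum coeff_monomial2)
    show "coeff (coeff g j) i = coeff (coeff (vary ^ r * binary_form m G (vary ^ s) (varx ^ t)) j) i"
    proof (cases "\<exists>k\<le>m. i = t * (m - k) \<and> j = r + s * k")
      case True
      then obtain k0 where k0: "k0 \<le> m" "i = t * (m - k0)" "j = r + s * k0" by blast
      then have "(i = t * (m - k) \<and> j = r + s * k) = (k = k0)" for k
        using \<open>s > 0\<close> by auto
      then show ?thesis unfolding rhs using k0 by (simp add: coeff_G)
    next
      case False
      have "coeff (coeff g j) i = 0"
      proof (rule ccontr)
        assume "coeff (coeff g j) i \<noteq> 0"
        then have "int (s * i + t * j) = int (t * n)" using leading_formD(2)[OF hom] by blast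
        then have eq: "s * i + t * j = t * n" by (simp only: of_nat_eq_iff)
        then have "t dvd s * i" by (metis dvd_add_left_iff dvd_triv_left)
        then have "t dvd i" using \<open>coprime s t\<close> by (simp add: coprime_commute coprime_dvd_mult_right_iff)
        then obtain i' where i': "i = t * i'" by blast
        with eq \<open>t > 0\<close> have eq': "s * i' + j = n"
          by (metis add_mult_distrib2 mult.left_commute mult_cancel1 not_gr_zero)
        then have "i' \<le> m" unfolding m_def
          by (metis \<open>0 < s\<close> div_le_mono le_add1 nonzero_mult_div_cancel_left not_gr_zero)
        moreover from this have "j = r + s * (m - i')"
          using eq' n by (simp add: diff_mult_distrib2)
        ultimately show False using False i' by (metis diff_diff_cancel diff_le_self)
      qed
      moreover have "(\<Sum>k\<le>m. if i = t * (m - k) \<and> j = r + s * k then coeff G k else 0) = 0"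
        using False by (intro sum.neutral) auto
      ultimately show ?thesis unfolding rhs by simp
    qed
  qed
  moreover have "degree G \<le> m" by (rule degree_le) (simp add: coeff_G)
  ultimately show ?thesis using that[of G] coeff_G unfolding m_def r_def by simp
qed

lemma jac_varx: "jac g varx = - dy g" and jac_vary: "jac g vary = dx g"
  by (simp_all add: jac_def)

lemma dx_nonzero:
  fixes g :: "'k::{idom,ring_char_0} poly poly"
  assumes "coeff (coeff g j) i \<noteq> 0" "i > 0"
  shows "dx g \<noteq> 0"
proof
  assume "dx g = 0"
  then have "of_nat i * coeff (coeff g j) i = 0"
    using coeff_dx[of g j "i - 1"] assms(2) by simp
  then show False using assms by simp
qed

lemma dy_nonzero:
  fixes g :: "'k::{idom,ring_char_0} poly poly"
  assumes "coeff (coeff g j) i \<noteq> 0" "j > 0"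
  shows "dy g \<noteq> 0"
proof
  assume "dy g = 0"
  then have "of_nat j * coeff (coeff g j) i = 0"
    using coeff_dy[of g "j - 1" i] assms(2) by simp
  then show False using assms by simp
qed

text \<open>
  The irreducible factors of \<open>g\<close> lie in the kernel of \<open>jac g\<close>, and two different ones would
  force a coordinate into it; comparing degrees of \<open>x\<close> and \<open>y\<close> then bounds the exponents.
\<close>

lemma loc_nil_homogeneous:
  fixes g :: "'k::{alg_closed_field,field_char_0} poly poly"
  assumes hom: "leading_form s t (int (t * n)) g g" and st: "coprime s t" "s > 0" "t > 0"
    and nil: "loc_nil g"
    and c: "coeff (coeff g n) 0 = c" "c \<noteq> 0" and "n > 0"
    and ij: "coeff (coeff g j) i \<noteq> 0" "i > 0"
  obtains m l where "n = s * m" "l \<noteq> 0" "g = cst c * (vary ^ s - cst l * varx ^ t) ^ m"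
    "s = 1 \<or> t = 1"
proof -
  interpret ring_derivation "jac g" by (rule ring_derivation_jac)
  have nilp: "\<exists>k. (jac g ^^ k) h = 0" for h using nil by (simp add: loc_nil_def)
  have g0: "g \<noteq> 0" using c by auto
  have x: "jac g varx \<noteq> 0" using dy_nonzero[of g n 0] c \<open>n > 0\<close> by (simp add: jac_varx)
  have y: "jac g vary \<noteq> 0" using dx_nonzero[OF ij] by (simp add: jac_vary)
  define m where "m = n div s"
  obtain G where G: "g = vary ^ (n mod s) * binary_form m G (vary ^ s) (varx ^ t)"
    "degree G \<le> m" "\<And>k. k \<le> m \<Longrightarrow> coeff G k = coeff (coeff g (n mod s + s * k)) (t * (m - k))"
    using homogeneous_as_binary_form[OF hom st] unfolding m_def by blast
  have factor: "jac g f = 0" if "g = f * h" for f h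
    using ker_factor[OF nilp, of f h] that g0 by simp
  \<comment> \<open>A nonzero remainder would make \<open>y\<close> a factor of \<open>g\<close> and
    put it into the kernel.\<close>
  have "n mod s = 0"
  proof (rule ccontr)
    assume r: "n mod s \<noteq> 0"
    have "jac g (vary ^ (n mod s)) = 0" by (rule factor[OF G(1)])
    then show False using y ker_power r by blast
  qed
  then have n: "n = s * m" unfolding m_def by (simp add: mult.commute mod_0_imp_dvd)
  have g: "g = binary_form m G (vary ^ s) (varx ^ t)" using G(1) \<open>n mod s = 0\<close> by simp
  have lead: "coeff G m = c" using G(3)[of m] n c \<open>n mod s = 0\<close> by simp
  then have deg: "degree G = m" "lead_coeff G = c"
    using G(2) c le_degree[of G m] by auto
  have "m > 0" using n \<open>n > 0\<close> by simp
  have root: "jac g (vary ^ s - cst l * varx ^ t) = 0" if "poly G l = 0" for l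
  proof -
    from that obtain H where H: "G = [:-l, 1:] * H" by (auto simp: poly_eq_0_iff_dvd)
    have "H \<noteq> 0" using H deg c by auto
    then have "degree G = Suc (degree H)" unfolding H by (subst degree_mult_eq) auto
    then have "degree H \<le> m - 1" using deg by simp
    from binary_form_linear_mult[OF this, of l] show ?thesis
      using \<open>m > 0\<close> g H factor by simp
  qed
  obtain l where l: "poly G l = 0"
    using alg_closed_imp_poly_has_root[of G] deg \<open>m > 0\<close> by auto
  have uniq: "l' = l" if "poly G l' = 0" for l'
  proof (rule ccontr)
    assume "l' \<noteq> l"
    have "(vary ^ s - cst l * varx ^ t) - (vary ^ s - cst l' * varx ^ t) = cst (l' - l) * varx ^ t"
      by (simp add: cst_simps algebra_simps)
    then have "jac g (cst (l' - l) * varx ^ t) = 0"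
      using root[OF l] root[OF that] diff[of "vary ^ s - cst l * varx ^ t" "vary ^ s - cst l' * varx ^ t"]
      by simp
    then have "jac g (varx ^ t) = 0" using \<open>l' \<noteq> l\<close> by (simp add: mult)
    then show False using x ker_power st by blast
  qed
  have "G = smult c ([:-l, 1:] ^ m)"
    by (rule poly_single_root[of G l, OF uniq, unfolded deg(1) lead])
  then have g_eq: "g = cst c * (vary ^ s - cst l * varx ^ t) ^ m"
    using g by (simp only: binary_form_smult binary_form_linear_power)
  define A where "A = vary ^ s - cst l * varx ^ t"
  have A: "jac g A = 0" "A \<noteq> 0" "g = cst c * A ^ m"
    using root[OF l] g_eq g0 \<open>m > 0\<close> by (auto simp: A_def)
  have l0: "l \<noteq> 0"
  proof
    assume "l = 0"
    then have "jac g (vary ^ s) = 0" using A by (simp add: A_def cst_simps)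
    then show False using y ker_power st by blast
  qed
  have "s = 1 \<or> t = 1"
  proof (rule ccontr)
    assume "\<not> (s = 1 \<or> t = 1)"
    then have st2: "s \<ge> 2" "t \<ge> 2" using st by auto
    \<comment> \<open>Both partial derivatives of \<open>g = c * A ^ m\<close> contain the kernel
      element \<open>u\<close>. Hence \<open>deg x - 1 = (s - 1) * deg y\<close> and
      \<open>deg y - 1 = (t - 1) * deg x\<close>, and for \<open>s, t \<ge> 2\<close> each degree
      would exceed the other.\<close>
    define u where "u = cst c * of_nat m * A ^ (m - 1)"
    interpret dx: ring_derivation "dx :: 'k poly poly \<Rightarrow> _" by (rule ring_derivation_dx)
    interpret dy: ring_derivation "dy :: 'k poly poly \<Rightarrow> _" by (rule ring_derivation_dy)
    have of_nat_cst: "(of_nat k :: 'k poly poly) = cst (of_nat k)" for k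
      by (induction k) (simp_all add: cst_simps)
    have of_nat_ker: "jac g (of_nat k) = 0" for k
      by (simp add: of_nat_cst)
    have u: "jac g u = 0" "u \<noteq> 0"
      using A(2) c \<open>m > 0\<close> by (simp_all add: u_def mult of_nat_ker power A(1))
    have dyA: "dy A = of_nat s * vary ^ (s - 1)"
      by (simp add: A_def dy.diff dy.mult dy.power)
    have dxA: "dx A = - (cst l * of_nat t * varx ^ (t - 1))"
      by (simp add: A_def dx.diff dx.mult dx.power)
    have Dx: "jac g varx = (- (u * of_nat s)) * vary ^ (s - 1)"
      by (simp add: jac_varx A(3) dy.mult dy.power dyA u_def mult_ac)
    have Dy: "jac g vary = (- (u * cst l * of_nat t)) * varx ^ (t - 1)"
      by (simp add: jac_vary A(3) dx.mult dx.power dxA u_def mult_ac)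
    obtain a b where ab: "has_deg varx a" "has_deg vary b"
      using has_deg_ex nilp x y by (metis zero)
    have "a \<noteq> 0" "b \<noteq> 0" using ab x y by (metis has_deg_0_iff)+
    then have a: "has_deg (jac g varx) (a - 1)" and b: "has_deg (jac g vary) (b - 1)"
      using ab has_deg_deriv[of varx "a - 1"] has_deg_deriv[of vary "b - 1"] by auto
    have "has_deg (vary ^ (s - 1)) (a - 1)" "has_deg (varx ^ (t - 1)) (b - 1)"
      by (rule has_deg_ker_cancel[OF a[unfolded Dx]], simp add: uminus mult u of_nat_ker)
        (rule has_deg_ker_cancel[OF b[unfolded Dy]], simp add: uminus mult u of_nat_ker)
    then have "(s - 1) * b = a - 1" "(t - 1) * a = b - 1"
      using has_deg_power ab has_deg_unique by blast+
    moreover have "1 * b \<le> (s - 1) * b" "1 * a \<le> (t - 1) * a"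
      using st2 by (intro mult_le_mono1; simp)+
    ultimately show False using \<open>a \<noteq> 0\<close> \<open>b \<noteq> 0\<close> by simp
  qed
  then show ?thesis using that[OF n l0 g_eq] by blast
qed

text \<open>For the weights 1 and \<rho> the whole leading form is the vertex \<open>(0, n)\<close>
  of the Newton polygon. The edge leaving this vertex maximizes \<open>i / (n - j)\<close>; in
  lowest terms the maximum is \<open>t / s\<close>, and it lies strictly below \<rho>. This strict
  decrease drives the descent in \<open>prime_degree_structure\<close>.\<close>

lemma loc_nil_edge:
  fixes F :: "'k::{alg_closed_field,field_char_0} poly poly"
  assumes nil: "loc_nil F" and lead: "leading_form 1 \<rho> (int (\<rho> * n)) F (cst c * vary ^ n)"
    and c: "c \<noteq> 0" and "n > 0" and ij: "coeff (coeff F j0) i0 \<noteq> 0" "i0 > 0"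
  obtains s t m l where "n = s * m" "l \<noteq> 0" "t > 0" "t < \<rho> * s" "s = 1 \<or> t = 1"
    "leading_form s t (int (t * n)) F (cst c * (vary ^ s - cst l * varx ^ t) ^ m)"
proof -
  have coeff_lead: "coeff (coeff (cst c * vary ^ n) j) i = (if i = 0 \<and> j = n then c else 0)" for i j
    using coeff_monomial2[of c 0 n j i] by simp
  have n_coeff: "coeff (coeff F n) 0 = c"
    using leading_formD(1)[OF lead, of 0 n] coeff_lead[of n 0] by simp
  have below: "i + \<rho> * j < \<rho> * n" if "coeff (coeff F j) i \<noteq> 0" "i > 0" for i j
  proof (rule ccontr)
    assume "\<not> ?thesis"
    then consider "i + \<rho> * j = \<rho> * n" | "i + \<rho> * j > \<rho> * n" by linarith
    then show False
    proof cases
      case 1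
      then have "int (1 * i + \<rho> * j) = int (\<rho> * n)" by (simp only: mult_1)
      then show False using leading_formD(1)[OF lead] coeff_lead[of j i] that by auto
    next
      case 2
      then have "int (1 * i + \<rho> * j) > int (\<rho> * n)" by (simp only: mult_1 of_nat_less_iff)
      then show False using leading_formD(3)[OF lead] that by blast
    qed
  qed
  have j_less: "j < n" if "coeff (coeff F j) i \<noteq> 0" "i > 0" for i j
  proof -
    have "\<rho> * j < \<rho> * n" using below[OF that] by linarith
    then show ?thesis by simp
  qed
  have j_le: "j \<le> n" if "coeff (coeff F j) 0 \<noteq> 0" for j
  proof (rule ccontr)
    assume "\<not> j \<le> n"
    have "\<rho> > 0" using below[OF ij] by (cases "\<rho> = 0") auto
    then have "\<rho> * n < \<rho> * j" using \<open>\<not> j \<le> n\<close> by simp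
    then have "int (1 * 0 + \<rho> * j) > int (\<rho> * n)" by (simp only: mult_0_right add_0 of_nat_less_iff)
    then show False using leading_formD(3)[OF lead] that by blast
  qed
  define S where "S = {(i, j). coeff (coeff F j) i \<noteq> 0 \<and> i > 0}"
  have "S \<subseteq> {..\<rho> * n} \<times> {..<n}"
    using below j_less by (fastforce simp: S_def)
  then have "finite S" by (rule finite_subset) auto
  have "(i0, j0) \<in> S" using ij by (simp add: S_def)
  define slope where "slope = (\<lambda>(i, j). (of_nat i :: rat) / of_nat (n - j))"
  obtain i1 j1 where S1: "(i1, j1) \<in> S" and max: "\<And>p. p \<in> S \<Longrightarrow> slope p \<le> slope (i1, j1)"
  proof -
    have "Max (slope ` S) \<in> slope ` S"
      using \<open>finite S\<close> \<open>(i0, j0) \<in> S\<close> by (intro Max_in) auto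
    then obtain p where "p \<in> S" "slope p = Max (slope ` S)" by auto
    then show ?thesis
      using that[of "fst p" "snd p"] \<open>finite S\<close> by (simp add: Max_ge)
  qed
  have ij1: "coeff (coeff F j1) i1 \<noteq> 0" "i1 > 0" "j1 < n" using S1 j_less by (auto simp: S_def)
  \<comment> \<open>Dividing by the gcd makes the weights coprime. The line through
    \<open>(0, n)\<close> and \<open>(i1, j1)\<close> then bounds all monomials, and the second
    point on it shows that the edge form is not just a power of \<open>y\<close>.\<close>
  define e where "e = gcd i1 (n - j1)"
  define t where "t = i1 div e"
  define s where "s = (n - j1) div e"
  have "e > 0" using ij1 by (simp add: e_def)
  have i1: "i1 = t * e" and j1: "n - j1 = s * e" by (simp_all add: t_def s_def e_def)
  then have pos: "t > 0" "s > 0" using ij1 by (auto intro: Nat.gr0I)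
  have "coprime s t" unfolding s_def t_def e_def
    using ij1 by (subst coprime_commute) (intro div_gcd_coprime, auto)
  have weight: "s * i + t * j \<le> t * n" if "coeff (coeff F j) i \<noteq> 0" for i j
  proof (cases "i = 0")
    case True
    then show ?thesis using j_le that by simp
  next
    case False
    with that have "(i, j) \<in> S" "j < n" using j_less by (auto simp: S_def)
    then have "(of_nat i :: rat) / of_nat (n - j) \<le> of_nat i1 / of_nat (n - j1)"
      using max by (fastforce simp: slope_def)
    also have "\<dots> = of_nat t / of_nat s" using \<open>e > 0\<close> by (simp add: i1 j1)
    finally have "(of_nat i :: rat) * of_nat s \<le> of_nat t * of_nat (n - j)"
      using \<open>j < n\<close> pos by (simp add: divide_simps split: if_splits)
    then have "i * s \<le> t * (n - j)"
      by (metis of_nat_le_iff of_nat_mult)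
    moreover have "t * n = t * (n - j) + t * j"
      using \<open>j < n\<close> by (simp flip: add_mult_distrib2)
    ultimately show ?thesis by (simp add: mult.commute)
  qed
  have edge1: "s * i1 + t * j1 = t * n"
  proof -
    have "s * i1 = t * (n - j1)" unfolding i1 j1 by simp
    then show ?thesis using ij1(3) by (simp add: diff_mult_distrib2)
  qed
  have slope_less: "t < \<rho> * s"
  proof -
    have "i1 < \<rho> * (n - j1)" using below[OF ij1(1,2)] by (simp add: diff_mult_distrib2)
    then have "t * e < \<rho> * s * e" unfolding i1 j1 by (simp add: mult.assoc)
    then show ?thesis by simp
  qed
  obtain g where g: "leading_form s t (int (t * n)) F g"
  proof (rule leading_form_exists[of "int (t * n)" s t F])
    show "coeff (coeff F j) i = 0" if "int (t * n) < int (s * i + t * j)" for i j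
      using weight[of j i] that by (metis not_le of_nat_less_iff)
  qed
  have "leading_form s t (int (t * n)) g g"
    using g unfolding leading_form_def by auto
  moreover have "coeff (coeff g n) 0 = c"
    using leading_formD(1)[OF g, of 0 n] n_coeff by simp
  moreover have "coeff (coeff g j1) i1 \<noteq> 0"
    using leading_formD(1)[OF g, of i1 j1] edge1 ij1 by (simp only: simp_thms)
  ultimately obtain m l where
    "n = s * m" "l \<noteq> 0" "g = cst c * (vary ^ s - cst l * varx ^ t) ^ m" "s = 1 \<or> t = 1"
    using loc_nil_homogeneous[OF _ \<open>coprime s t\<close> pos(2,1) loc_nil_leading_form[OF nil g] _ c \<open>n > 0\<close> _ ij1(2)]
    by metis
  then show ?thesis using that[of s m l t] g pos slope_less by simp
qed

subsection \<open>Plane polynomials with locally nilpotent Jacobian derivation\<close>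

lemma coeff_peval_vary: "coeff (coeff (peval cst G vary) j) i = (if i = 0 then coeff G j else 0)"
proof -
  have "peval cst G vary = map_poly (\<lambda>a. [:a:]) G"
    by (induction G) (simp_all add: peval_0 peval_pCons ring_map_cst map_poly_pCons,
        simp add: cst_def vary_def)
  then show ?thesis by (auto simp: coeff_map_poly coeff_pCons split: nat.splits)
qed

lemma subst2_peval: "subst2 cst (peval cst G r) x y = peval cst G (subst2 cst r x y)"
  by (subst ring_map_peval_commute[OF ring_map_cst ring_map_subst2[OF ring_map_cst]])
    (simp add: ring_map_cst)

lemma only_vary:
  fixes F :: "'k::comm_ring_1 poly poly"
  assumes "\<And>i j. i > 0 \<Longrightarrow> coeff (coeff F j) i = 0"
    and "coeff (coeff F n) 0 \<noteq> 0" and "\<And>j. j > n \<Longrightarrow> coeff (coeff F j) 0 = 0"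
  obtains G where "F = peval cst G vary" "degree G = n"
proof
  let ?G = "map_poly (\<lambda>c. coeff c 0) F"
  show "F = peval cst ?G vary"
    by (rule poly2_eqI) (simp add: coeff_peval_vary coeff_map_poly assms(1))
  show "degree ?G = n"
  proof (rule antisym)
    show "degree ?G \<le> n" using assms(3) by (intro degree_le) (simp add: coeff_map_poly)
    show "n \<le> degree ?G" using assms(2) by (intro le_degree) (simp add: coeff_map_poly)
  qed
qed

text \<open>With weights \<open>n\<close> and 1 and top weight \<open>n\<close>, the variable
  \<open>x\<close> can occur only as the bare monomial \<open>x\<close>, which lies on the edge;
  removing it leaves a polynomial in \<open>y\<close>.\<close>

lemma linear_in_varx:
  fixes F :: "'k::idom poly poly"
  assumes lead: "leading_form n 1 (int n) F (cst c * (vary ^ n - cst l * varx))"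
    and "c \<noteq> 0" "n > 1"
  obtains G e where "F = peval cst G vary + cst e * varx" "degree G = n"
proof -
  let ?g = "cst c * (vary ^ n - cst l * varx)"
  have g: "coeff (coeff ?g j) i =
      (if i = 0 \<and> j = n then c else 0) - (if i = 1 \<and> j = 0 then c * l else 0)" for i j
  proof -
    have "?g = cst c * varx ^ 0 * vary ^ n - cst (c * l) * varx ^ 1 * vary ^ 0"
      by (simp add: cst_simps algebra_simps)
    then show ?thesis by (simp only: coeff_diff coeff_monomial2)
  qed
  define F' where "F' = F + cst (c * l) * varx"
  have F': "coeff (coeff F' j) i = coeff (coeff F j) i + (if i = 1 \<and> j = 0 then c * l else 0)" for i j
    using coeff_monomial2[of "c * l" 1 0 j i] by (simp add: F'_def)
  have big: "coeff (coeff F' j) i = 0" if "n * i + j \<ge> n" "\<not> (i = 0 \<and> j = n)" for i j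
  proof (cases "n * i + j = n")
    case True
    then have "int (n * i + 1 * j) = int n" by simp
    then have "coeff (coeff F j) i = coeff (coeff ?g j) i" using leading_formD(1)[OF lead] by simp
    moreover have "i = 1 \<Longrightarrow> j = 0" using True by simp
    ultimately show ?thesis using that \<open>n > 1\<close> by (auto simp: F' g)
  next
    case False
    then have "n * i + 1 * j > n" using that by simp
    then have "int (n * i + 1 * j) > int n" by (simp only: of_nat_less_iff)
    then have "coeff (coeff F j) i = 0" using leading_formD(3)[OF lead] by blast
    then show ?thesis using False by (auto simp: F')
  qed
  obtain G where "F' = peval cst G vary" "degree G = n"
  proof (rule only_vary[of F' n])
    show "coeff (coeff F' j) i = 0" if "i > 0" for i j
      using that big[of i j] by (cases i) auto
    show "coeff (coeff F' n) 0 \<noteq> 0"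
      using leading_formD(1)[OF lead, of 0 n] g[of n 0] \<open>c \<noteq> 0\<close> by (simp add: F')
    show "coeff (coeff F' j) 0 = 0" if "j > n" for j
      using that big[of 0 j] by simp
  qed
  then have "F = peval cst G vary + cst (- (c * l)) * varx"
    by (simp add: F'_def cst_simps eq_diff_eq[symmetric])
  then show ?thesis using that \<open>degree G = n\<close> by blast
qed

text \<open>Descent on the slope bound. An edge with \<open>s = 1\<close> is removed by replacing
  \<open>y\<close> with \<open>y + l x^t\<close>, and the new bound is \<open>t < \<rho>\<close>. An
  edge with \<open>s > 1\<close> has \<open>t = 1\<close>, and \<open>a = s * m\<close> being prime
  forces \<open>m = 1\<close>: then \<open>x\<close> occurs linearly and the descent stops. The
  polynomial \<open>u\<close> collects the terms \<open>l x^t\<close> of the substitutions.\<close>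

lemma prime_degree_structure:
  fixes F :: "'k::{alg_closed_field,field_char_0} poly poly"
  assumes "loc_nil F" "leading_form 1 \<rho> (int (\<rho> * a)) F (cst c * vary ^ a)" "c \<noteq> 0" "prime a" "\<rho> > 0"
  shows "\<exists>u G e. F = peval cst G (vary - peval cst u varx) + cst e * varx \<and>
    degree G = a \<and> (u = 0 \<or> degree u < \<rho>)"
  using assms
proof (induction \<rho> arbitrary: F rule: less_induct)
  case (less \<rho>)
  have "a > 1" using \<open>prime a\<close> by (rule prime_gt_1_nat)
  show ?case
  proof (cases "\<exists>i j. i > 0 \<and> coeff (coeff F j) i \<noteq> 0")
    case False
    have lead: "coeff (coeff (cst c * vary ^ a) j) 0 = (if j = a then c else 0)" for j
      using coeff_monomial2[of c 0 a j 0] by simp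
    obtain G where "F = peval cst G vary" "degree G = a"
    proof (rule only_vary[of F a])
      show "coeff (coeff F j) i = 0" if "i > 0" for i j using False that by blast
      show "coeff (coeff F a) 0 \<noteq> 0"
        using leading_formD(1)[OF less.prems(2), of 0 a] lead[of a] \<open>c \<noteq> 0\<close> by simp
      show "coeff (coeff F j) 0 = 0" if "j > a" for j
        using leading_formD(3)[OF less.prems(2), of 0 j] that \<open>\<rho> > 0\<close> by simp
    qed
    then have "F = peval cst G (vary - peval cst 0 varx) + cst 0 * varx"
      by (simp add: peval_0 cst_simps)
    then show ?thesis using \<open>degree G = a\<close> by blast
  next
    case True
    then obtain i0 j0 where ij: "coeff (coeff F j0) i0 \<noteq> 0" "i0 > 0" by blast
    obtain s t m l where edge: "a = s * m" "l \<noteq> 0" "t > 0" "t < \<rho> * s" "s = 1 \<or> t = 1"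
      "leading_form s t (int (t * a)) F (cst c * (vary ^ s - cst l * varx ^ t) ^ m)"
      by (rule loc_nil_edge[OF less.prems(1,2) \<open>c \<noteq> 0\<close> _ ij]) (use \<open>a > 1\<close> in auto)
    show ?thesis
    proof (cases "s = 1")
      case True
      let ?y = "vary + cst l * varx ^ t"
      let ?F = "subst2 cst F varx ?y"
      have "leading_form 1 t (int t) (cst l * varx ^ t) (cst l * varx ^ t)"
        using leading_form_monomial[of 1 t t 0 l] by simp
      from leading_form_add[OF leading_form_vary this]
      have "leading_form 1 t (int t) ?y ?y" .
      from leading_form_subst2[OF edge(6)[unfolded True] _ this, of varx varx]
      have "leading_form 1 t (int (t * a)) ?F (cst c * vary ^ a)"
        using leading_form_varx[of 1 t] True edge(1) by (simp add: subst2_simps ring_map_cst)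
      moreover have "loc_nil ?F"
      proof (rule loc_nil_subst2[OF less.prems(1)])
        show "jac varx ?y = cst 1"
        proof -
          interpret ring_derivation "jac (varx :: 'k poly poly)" by (rule ring_derivation_jac)
          show ?thesis by (simp add: add mult power, simp add: jac_def cst_simps)
        qed
        show "subst2 cst varx varx ?y = varx"
          by (simp add: ring_map_cst)
        show "subst2 cst (vary - cst l * varx ^ t) varx ?y = vary"
          by (simp add: subst2_simps ring_map_cst)
      qed
      ultimately obtain u G e where *: "?F = peval cst G (vary - peval cst u varx) + cst e * varx"
        "degree G = a" "u = 0 \<or> degree u < t"
        using less.IH[of t ?F] edge True less.prems by auto
      have "F = subst2 cst ?F varx (vary - cst l * varx ^ t)"
        by (simp add: subst2_subst2 subst2_simps ring_map_cst subst2_id)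
      also have "\<dots> = peval cst G (vary - cst l * varx ^ t - peval cst u varx) + cst e * varx"
        unfolding * by (simp add: subst2_simps ring_map_cst subst2_peval)
      also have "vary - cst l * varx ^ t - peval cst u varx = vary - peval cst (u + monom l t) varx"
      proof -
        have "peval cst (monom l t) varx = cst l * varx ^ t"
          by (simp add: peval_def map_poly_monom cst_simps poly_monom)
        then show ?thesis by (simp add: ring_map_add[OF ring_map_peval[OF ring_map_cst]])
      qed
      finally have "F = peval cst G (vary - peval cst (u + monom l t) varx) + cst e * varx" .
      moreover have "degree (u + monom l t) < \<rho>"
        using *(3) edge(4) True degree_monom_le[of l t]
        by (intro le_less_trans[OF degree_add_le[of _ t]]) auto
      ultimately show ?thesis using *(2) by blast
    next
      case False
      then have "s = a" "m = 1" "t = 1"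
        using edge(1,5) \<open>prime a\<close> prime_product[of s m] by auto
      then obtain G e where "F = peval cst G vary + cst e * varx" "degree G = a"
        using linear_in_varx[of a F c l] edge(6) \<open>c \<noteq> 0\<close> \<open>a > 1\<close> by auto
      then have "F = peval cst G (vary - peval cst 0 varx) + cst e * varx"
        by (simp add: peval_0)
      then show ?thesis using \<open>degree G = a\<close> by blast
    qed
  qed
qed

lemma prime_mult_eq:
  fixes p q :: nat
  assumes "s * m = p * q" "prime p" "prime q" "s \<noteq> 1" "m \<noteq> 1"
  shows "(m, s) = (p, q) \<or> (m, s) = (q, p)"
proof -
  have "p dvd s * m" using assms(1) by simp
  then have "p dvd s \<or> p dvd m" using \<open>prime p\<close> by (simp add: prime_dvd_mult_iff)
  then show ?thesis
  proof
    assume "p dvd s"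
    then obtain k where k: "s = p * k" by blast
    then have "k * m = q" using assms(1,2) by (simp add: mult.assoc)
    then show ?thesis using k \<open>prime q\<close> \<open>m \<noteq> 1\<close> prime_product[of k m] by auto
  next
    assume "p dvd m"
    then obtain k where k: "m = p * k" by blast
    then have "k * s = q" using assms(1,2) by (simp add: mult_ac)
    then show ?thesis using k \<open>prime q\<close> \<open>s \<noteq> 1\<close> prime_product[of k s] by auto
  qed
qed

text \<open>Starting from the weights 1 and 1, the bound \<open>t < s\<close> excludes
  \<open>s = 1\<close>, so the first edge form is \<open>c (y^s - l x)^m\<close> with
  \<open>s * m = p * q\<close>. For \<open>m = 1\<close> this already gives the linear shape;
  otherwise \<open>m\<close> and \<open>s\<close> are the two primes, and \<open>y^s - l x\<close>
  becomes the new second coordinate.\<close>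

lemma pq_degree_structure:
  fixes F :: "'k::{alg_closed_field,field_char_0} poly poly"
  assumes nil: "loc_nil F" and lead: "leading_form 1 1 (int (p * q)) F (cst c * vary ^ (p * q))"
    and c: "c \<noteq> 0" and pq: "prime p" "prime q"
  shows "(\<exists>G e. F = peval cst G vary + cst e * varx \<and> degree G = p * q) \<or>
    (\<exists>a b G H l e. ((a, b) = (p, q) \<or> (a, b) = (q, p)) \<and>
       F = peval cst G (peval cst H vary - cst l * varx) + cst e * vary \<and>
       degree G = a \<and> degree H = b \<and> lead_coeff H = 1 \<and> l \<noteq> 0)"
proof -
  have N: "p * q > 1" using pq by (metis prime_gt_1_nat less_1_mult)
  show ?thesis
  proof (cases "\<exists>i j. i > 0 \<and> coeff (coeff F j) i \<noteq> 0")
    case False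
    have lead_coeff: "coeff (coeff (cst c * vary ^ (p * q)) j) 0 = (if j = p * q then c else 0)" for j
      using coeff_monomial2[of c 0 "p * q" j 0] by simp
    obtain G where "F = peval cst G vary" "degree G = p * q"
    proof (rule only_vary[of F "p * q"])
      show "coeff (coeff F j) i = 0" if "i > 0" for i j using False that by blast
      show "coeff (coeff F (p * q)) 0 \<noteq> 0"
        using leading_formD(1)[OF lead, of 0 "p * q"] lead_coeff[of "p * q"] c by simp
      show "coeff (coeff F j) 0 = 0" if "j > p * q" for j
        using leading_formD(3)[OF lead, of 0 j] that by (simp flip: of_nat_mult)
    qed
    then have "F = peval cst G vary + cst 0 * varx" by (simp add: cst_simps)
    then show ?thesis using \<open>degree G = p * q\<close> by blast
  next
    case True
    then obtain i0 j0 where ij: "coeff (coeff F j0) i0 \<noteq> 0" "i0 > 0" by blast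
    have lead': "leading_form 1 1 (int (1 * (p * q))) F (cst c * vary ^ (p * q))" using lead by simp
    obtain s t m l where edge: "p * q = s * m" "l \<noteq> 0" "t > 0" "t < 1 * s" "s = 1 \<or> t = 1"
      "leading_form s t (int (t * (p * q))) F (cst c * (vary ^ s - cst l * varx ^ t) ^ m)"
      by (rule loc_nil_edge[OF nil lead' c _ ij]) (use pq in \<open>auto simp: prime_gt_0_nat\<close>)
    then have t: "t = 1" and s: "s > 1" by auto
    show ?thesis
    proof (cases "m = 1")
      case True
      then obtain G e where "F = peval cst G vary + cst e * varx" "degree G = p * q"
        using linear_in_varx[of "p * q" F c l] edge t c N by auto
      then show ?thesis by blast
    next
      case False
      then have ms: "(m, s) = (p, q) \<or> (m, s) = (q, p)"
        using prime_mult_eq[of s m p q] edge(1) s pq by simp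
      \<comment> \<open>Chosen to solve \<open>x^s - l * x1 = y\<close>: under
        \<open>x \<mapsto> x1\<close>, \<open>y \<mapsto> x\<close> the edge form turns into
        \<open>c y^m\<close>. The inverse map is \<open>x \<mapsto> y\<close>,
        \<open>y \<mapsto> y^s - l x\<close>. For the weights 1 and \<open>s\<close> of
        \<open>x\<close> and \<open>y\<close>, both terms of \<open>x1\<close> have weight
        \<open>s\<close>.\<close>
      define x1 :: "'k poly poly" where "x1 = cst (1 / l) * (varx ^ s - vary)"
      let ?y = "vary ^ s - cst l * varx"
      let ?F = "subst2 cst F x1 varx"
      have l: "cst l * cst (1 / l) = 1" "cst l * (cst (1 / l) * h) = h"
        "cst (1 / l) * (cst l * h) = h" for h
        using \<open>l \<noteq> 0\<close> by (simp_all add: cst_simps(4)[symmetric] mult.assoc[symmetric] cst_simps)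
      have x1: "leading_form 1 s (int s) x1 x1"
      proof -
        have "leading_form 1 s (int s) (varx ^ s) (varx ^ s :: 'k poly poly)"
          using leading_form_monomial[of 1 s s 0 1] by (simp add: cst_simps)
        from leading_form_diff[OF this leading_form_vary]
        have "leading_form 1 s (int s) (varx ^ s - vary) (varx ^ s - vary :: 'k poly poly)" .
        from leading_form_mult[OF leading_form_cst this] show ?thesis by (simp add: x1_def)
      qed
      have "leading_form 1 s (int (s * m)) ?F (subst2 cst (cst c * ?y ^ m) x1 varx)"
        using leading_form_subst2[OF edge(6)[unfolded t] x1, of varx varx] leading_form_varx[of 1 s] edge(1)
        by simp
      moreover have "subst2 cst (cst c * ?y ^ m) x1 varx = cst c * vary ^ m"
        by (simp add: subst2_simps ring_map_cst x1_def l)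
      ultimately have F_lead: "leading_form 1 s (int (s * m)) ?F (cst c * vary ^ m)" by simp
      have "loc_nil ?F"
      proof (rule loc_nil_subst2[OF nil])
        interpret dy: ring_derivation "dy :: 'k poly poly \<Rightarrow> _" by (rule ring_derivation_dy)
        show "jac x1 varx = cst (1 / l)"
          by (simp add: jac_varx x1_def dy.mult dy.diff dy.power)
        show "subst2 cst vary x1 varx = varx" by (simp add: ring_map_cst)
        show "subst2 cst ?y x1 varx = vary" by (simp add: subst2_simps ring_map_cst x1_def l)
      qed
      from prime_degree_structure[OF this F_lead c]
      obtain u G e where *: "?F = peval cst G (vary - peval cst u varx) + cst e * varx"
        "degree G = m" "u = 0 \<or> degree u < s"
        using ms pq s by auto
      have "F = subst2 cst ?F vary ?y"
        by (simp add: subst2_subst2 subst2_simps ring_map_cst subst2_id x1_def l)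
      also have "\<dots> = peval cst G (?y - peval cst u vary) + cst e * vary"
        unfolding * by (simp add: subst2_simps ring_map_cst subst2_peval)
      also have "?y - peval cst u vary = peval cst (monom 1 s - u) vary - cst l * varx"
      proof -
        have "peval cst (monom 1 s) vary = (vary ^ s :: 'k poly poly)"
          by (simp add: peval_def map_poly_monom cst_simps poly_monom)
        then show ?thesis by (simp add: ring_map_diff[OF ring_map_peval[OF ring_map_cst]])
      qed
      finally have F: "F = peval cst G (peval cst (monom 1 s - u) vary - cst l * varx) + cst e * vary" .
      \<comment> \<open>The degree bound on \<open>u\<close> is what makes \<open>y^s - u(y)\<close>
        monic of degree \<open>s\<close>.\<close>
      have "coeff u s = 0" using *(3) by (auto intro: coeff_eq_0)
      moreover have "degree (monom 1 s - u) = s"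
        using *(3) s degree_add_eq_left[of "- u" "monom 1 s"]
        by (auto simp: degree_monom_eq)
      ultimately have "degree (monom 1 s - u) = s" "lead_coeff (monom 1 s - u) = 1" by simp_all
      then show ?thesis using ms F *(2) \<open>l \<noteq> 0\<close> by blast
    qed
  qed
qed

text \<open>If \<open>y^n\<close> occurs, the equal-weight case of
  \<open>loc_nil_homogeneous\<close> gives a power of a linear form. Otherwise \<open>x\<close>
  divides \<open>g\<close> and so lies in the kernel, which says that
  \<open>dy g = 0\<close>.\<close>

lemma loc_nil_top_form:
  fixes g :: "'k::{alg_closed_field,field_char_0} poly poly"
  assumes hom: "leading_form 1 1 (int n) g g" and nil: "loc_nil g" and "g \<noteq> 0" "n > 0"
  obtains c l where "c \<noteq> 0" "g = cst c * (vary - cst l * varx) ^ n"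
    | c where "c \<noteq> 0" "g = cst c * varx ^ n"
proof (cases "coeff (coeff g n) 0 = 0")
  case False
  define c where "c = coeff (coeff g n) 0"
  have hom': "leading_form 1 1 (int (1 * n)) g g" using hom by simp
  show ?thesis
  proof (cases "\<exists>i j. i > 0 \<and> coeff (coeff g j) i \<noteq> 0")
    case True
    then obtain i j where ij: "coeff (coeff g j) i \<noteq> 0" "i > 0" by blast
    have "c \<noteq> 0" using False by (simp add: c_def)
    obtain m l where "n = 1 * m" "g = cst c * (vary ^ 1 - cst l * varx ^ 1) ^ m"
      using loc_nil_homogeneous[OF hom' coprime_1_left zero_less_one zero_less_one nil
          c_def[symmetric] \<open>c \<noteq> 0\<close> \<open>n > 0\<close> ij] by blast
    then show ?thesis using that(1)[OF \<open>c \<noteq> 0\<close>, of l] by simp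
  next
    case no_x: False
    have "g = cst c * vary ^ n"
    proof (rule poly2_eqI)
      fix i j
      have "coeff (coeff g j) i = 0" if "\<not> (i = 0 \<and> j = n)"
      proof (cases "i = 0")
        case True
        then show ?thesis using leading_formD(2)[OF hom, of i j] that by auto
      qed (use no_x in blast)
      then show "coeff (coeff g j) i = coeff (coeff (cst c * vary ^ n) j) i"
        using coeff_monomial2[of c 0 n j i] by (auto simp: c_def)
    qed
    moreover have "c \<noteq> 0" using False by (simp add: c_def)
    ultimately show ?thesis using that(1)[OF \<open>c \<noteq> 0\<close>, of 0] by (simp add: cst_simps)
  qed
next
  case True
  interpret ring_derivation "jac g" by (rule ring_derivation_jac)
  have hom': "leading_form 1 1 (int (1 * n)) g g" using hom by simp
  obtain G where G0: "g = vary ^ (n mod 1) * binary_form (n div 1) G (vary ^ 1) (varx ^ 1)"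
    "degree G \<le> n div 1"
    "\<And>k. k \<le> n div 1 \<Longrightarrow> coeff G k = coeff (coeff g (n mod 1 + 1 * k)) (1 * (n div 1 - k))"
    using homogeneous_as_binary_form[OF hom' coprime_1_left zero_less_one zero_less_one] by blast
  have G: "g = binary_form n G vary varx" "degree G \<le> n" "coeff G n = 0"
    using G0(1) G0(2) G0(3)[of n] True by simp_all
  obtain n' where n': "n = Suc n'" using \<open>n > 0\<close> by (cases n) auto
  have "degree G \<le> n'"
    by (rule degree_le) (use G(2,3) n' in \<open>metis coeff_eq_0 le_less_trans less_antisym not_less_eq\<close>)
  then have "g = varx * binary_form n' G vary varx" using G(1) n' binary_form_Suc by metis
  moreover have "\<exists>k. (jac g ^^ k) h = 0" for h using nil by (simp add: loc_nil_def)
  ultimately have "jac g varx = 0" using ker_factor[of varx] \<open>g \<noteq> 0\<close> by (metis jac_self)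
  then have dy0: "dy g = 0" by (simp add: jac_varx)
  define c where "c = coeff (coeff g 0) n"
  have g: "g = cst c * varx ^ n"
  proof (rule poly2_eqI)
    fix i j
    have "coeff (coeff g j) i = 0" if "\<not> (i = n \<and> j = 0)"
    proof (cases "j = 0")
      case True
      then show ?thesis using leading_formD(2)[OF hom, of i j] that by auto
    next
      case False
      then show ?thesis using dy_nonzero[of g j i] dy0 by blast
    qed
    then show "coeff (coeff g j) i = coeff (coeff (cst c * varx ^ n) j) i"
      using coeff_monomial2[of c n 0 j i] by (auto simp: c_def)
  qed
  moreover have "c \<noteq> 0" using g \<open>g \<noteq> 0\<close> by (auto simp: cst_simps)
  ultimately show ?thesis using that(2) by blast
qed

text \<open>The top form is a power of a linear form, and a linear coordinate change turns that form
  into \<open>y\<close>: a swap for \<open>x\<close>, a shear for the others. \<open>x0\<close> and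
  \<open>y0\<close> are the new coordinates in terms of the old ones.\<close>

lemma plane_structure:
  fixes f :: "'k::{alg_closed_field,field_char_0} poly poly"
  assumes nil: "loc_nil f" and lead: "leading_form 1 1 (int (p * q)) f g" "g \<noteq> 0"
    and pq: "prime p" "prime q"
  obtains x0 y0 where "(x0, y0) = (vary, varx) \<or> (\<exists>l. (x0, y0) = (varx, vary - cst l * varx))"
    and "(\<exists>G e. f = peval cst G y0 + cst e * x0 \<and> degree G = p * q) \<or>
      (\<exists>a b G H l e. ((a, b) = (p, q) \<or> (a, b) = (q, p)) \<and>
         f = peval cst G (peval cst H y0 - cst l * x0) + cst e * y0 \<and>
         degree G = a \<and> degree H = b \<and> lead_coeff H = 1 \<and> l \<noteq> 0)"
proof -
  let ?concl = "\<lambda>F x0 y0. (\<exists>G e. F = peval cst G y0 + cst e * x0 \<and> degree G = p * q) \<or>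
      (\<exists>a b G H l e. ((a, b) = (p, q) \<or> (a, b) = (q, p)) \<and>
         F = peval cst G (peval cst H y0 - cst l * x0) + cst e * y0 \<and>
         degree G = a \<and> degree H = b \<and> lead_coeff H = 1 \<and> l \<noteq> 0)"
  have concl_subst: "?concl (subst2 cst F x0 y0) x0 y0" if "?concl F varx vary" for F x0 y0
    using that
  proof (rule disjE)
    assume "\<exists>G e. F = peval cst G vary + cst e * varx \<and> degree G = p * q"
    then obtain G e where F: "F = peval cst G vary + cst e * varx" and "degree G = p * q" by blast
    have "subst2 cst F x0 y0 = peval cst G y0 + cst e * x0"
      unfolding F by (simp add: subst2_simps ring_map_cst subst2_peval)
    then show ?thesis using \<open>degree G = p * q\<close> by blast
  next
    assume "\<exists>a b G H l e. ((a, b) = (p, q) \<or> (a, b) = (q, p)) \<and>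
         F = peval cst G (peval cst H vary - cst l * varx) + cst e * vary \<and>
         degree G = a \<and> degree H = b \<and> lead_coeff H = 1 \<and> l \<noteq> 0"
    then obtain a b G H l e where ab: "(a, b) = (p, q) \<or> (a, b) = (q, p)"
      and F: "F = peval cst G (peval cst H vary - cst l * varx) + cst e * vary"
      and deg: "degree G = a" "degree H = b" "lead_coeff H = 1" "l \<noteq> 0" by blast
    have "subst2 cst F x0 y0 = peval cst G (peval cst H y0 - cst l * x0) + cst e * y0"
      unfolding F by (simp add: subst2_simps ring_map_cst subst2_peval)
    then show ?thesis using ab deg by blast
  qed
  have hom: "leading_form 1 1 (int (p * q)) g g"
    using lead(1) unfolding leading_form_def by auto
  have "p * q > 0" using pq prime_gt_0_nat by simp
  from loc_nil_top_form[OF hom loc_nil_leading_form[OF nil lead(1)] lead(2) this]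
  consider c l where "c \<noteq> 0" "g = cst c * (vary - cst l * varx) ^ (p * q)"
    | c where "c \<noteq> 0" "g = cst c * varx ^ (p * q)" by metis
  then show ?thesis
  proof cases
    case 1
    let ?y = "vary + cst l * varx"
    let ?F = "subst2 cst f varx ?y"
    have "leading_form 1 1 (int 1) (cst l * varx) (cst l * varx)"
      using leading_form_monomial[of 1 1 1 0 l] by simp
    from leading_form_add[OF leading_form_vary this]
    have "leading_form 1 1 (int 1) ?y ?y" .
    from leading_form_subst2[OF lead(1) leading_form_varx this]
    have "leading_form 1 1 (int (p * q)) ?F (cst c * vary ^ (p * q))"
      unfolding 1 by (simp add: subst2_simps ring_map_cst)
    moreover have "loc_nil ?F"
    proof (rule loc_nil_subst2[OF nil])
      interpret ring_derivation "jac (varx :: 'k poly poly)" by (rule ring_derivation_jac)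
      show "jac varx ?y = cst 1" by (simp add: add mult, simp add: jac_def cst_simps)
      show "subst2 cst varx varx ?y = varx" by (simp add: ring_map_cst)
      show "subst2 cst (vary - cst l * varx) varx ?y = vary"
        by (simp add: subst2_simps ring_map_cst)
    qed
    ultimately have "?concl ?F varx vary"
      using pq_degree_structure[of ?F p q c] 1 pq by blast
    from concl_subst[OF this, of varx "vary - cst l * varx"]
    have "?concl f varx (vary - cst l * varx)"
      by (simp add: subst2_subst2 subst2_simps ring_map_cst subst2_id)
    then show ?thesis by (intro that[of varx "vary - cst l * varx"]) auto
  next
    case 2
    let ?F = "subst2 cst f vary varx"
    from leading_form_subst2[OF lead(1) leading_form_vary leading_form_varx]
    have "leading_form 1 1 (int (p * q)) ?F (cst c * vary ^ (p * q))"
      unfolding 2 by (simp add: subst2_simps ring_map_cst)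
    moreover have "loc_nil ?F"
      by (rule loc_nil_subst2[OF nil, of _ _ "-1" vary varx])
        (simp_all add: jac_varx ring_map_cst cst_simps)
    ultimately have "?concl ?F varx vary"
      using pq_degree_structure[of ?F p q c] 2 pq by blast
    from concl_subst[OF this, of vary varx]
    have "?concl f vary varx"
      by (simp add: subst2_subst2 ring_map_cst subst2_id)
    then show ?thesis by (intro that[of vary varx]) auto
  qed
qed

subsection \<open>Derivations and gradings of the polynomial ring in three variables\<close>

lemma ring_map_scal: "ring_map scal"
  by (auto simp: ring_map_def scal_def one_pCons)

lemmas scal_simps = ring_map_simps[OF ring_map_scal]

lemma scal_eq_0_iff [simp]: "scal c = 0 \<longleftrightarrow> c = 0"
  by (simp add: scal_def)

lemma ring_derivation_dU: "ring_derivation (dU :: 'k::field_char_0 poly3 \<Rightarrow> _)"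
  unfolding dU_def by (intro ring_derivation_map_pderiv ring_derivation_pderiv)

lemma ring_derivation_dV: "ring_derivation (dV :: 'k::field_char_0 poly3 \<Rightarrow> _)"
  unfolding dV_def by (intro ring_derivation_map_pderiv ring_derivation_pderiv)

lemma ring_derivation_dW: "ring_derivation (dW :: 'k::field_char_0 poly3 \<Rightarrow> _)"
  unfolding dW_def by (intro ring_derivation_pderiv)

lemma dU_simps [simp]: "dU (scal c) = 0" "dU varU = 1" "dU varV = 0" "dU varW = 0"
  and dV_simps [simp]: "dV (scal c) = 0" "dV varU = 0" "dV varV = 1" "dV varW = 0"
  and dW_simps [simp]: "dW (scal c) = 0" "dW varU = 0" "dW varV = 0" "dW varW = 1"
  by (simp_all add: dU_def dV_def dW_def scal_def varU_def varV_def varW_def map_poly_pCons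
      pderiv_pCons one_pCons)

lemma jacobian_deriv_eq:
  "jacobian_deriv A B C =
     dU A * (dV B * dW C - dW B * dV C) - dV A * (dU B * dW C - dW B * dU C)
     + dW A * (dU B * dV C - dV B * dU C)"
  by (simp add: jacobian_deriv_def det_3 vector_3 algebra_simps)

lemma jacobian_deriv_alternating [simp]:
  "jacobian_deriv A B A = 0" "jacobian_deriv A B B = 0" "jacobian_deriv A A C = 0"
  by (simp_all add: jacobian_deriv_eq algebra_simps)

lemma jacobian_deriv_scal [simp]: "jacobian_deriv A B (scal c) = 0" "jacobian_deriv A (scal c) C = 0"
  by (simp_all add: jacobian_deriv_eq)

lemma ring_derivation_jacobian3:
  "ring_derivation (jacobian_deriv A (B :: 'k::field_char_0 poly3))"
proof -
  interpret U: ring_derivation "dU :: 'k poly3 \<Rightarrow> _" by (rule ring_derivation_dU)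
  interpret V: ring_derivation "dV :: 'k poly3 \<Rightarrow> _" by (rule ring_derivation_dV)
  interpret W: ring_derivation "dW :: 'k poly3 \<Rightarrow> _" by (rule ring_derivation_dW)
  show ?thesis
    by standard (simp_all add: jacobian_deriv_eq U.add V.add W.add U.mult V.mult W.mult algebra_simps)
qed

text \<open>As a derivation in its second argument, the Jacobian can be applied to an explicit
  expansion of \<open>P\<close> summand by summand.\<close>

lemma ring_derivation_jacobian2:
  "ring_derivation (\<lambda>B :: 'k::field_char_0 poly3. jacobian_deriv A B C)"
proof -
  interpret U: ring_derivation "dU :: 'k poly3 \<Rightarrow> _" by (rule ring_derivation_dU)
  interpret V: ring_derivation "dV :: 'k poly3 \<Rightarrow> _" by (rule ring_derivation_dV)
  interpret W: ring_derivation "dW :: 'k poly3 \<Rightarrow> _" by (rule ring_derivation_dW)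
  show ?thesis
    by standard (simp_all add: jacobian_deriv_eq U.add V.add W.add U.mult V.mult W.mult algebra_simps)
qed

lemma jacobian_deriv_varU: "jacobian_deriv varU B C = dV B * dW C - dW B * dV C"
  by (simp add: jacobian_deriv_eq)

lemma k_derivation_ring_derivation:
  "k_derivation (D :: 'k::field_char_0 poly3 \<Rightarrow> _) \<Longrightarrow> ring_derivation D"
  by (simp add: k_derivation_def ring_derivation_def)

lemma k_derivation_scal: "k_derivation (D :: 'k::field_char_0 poly3 \<Rightarrow> _) \<Longrightarrow> D (scal c) = 0"
  using ring_derivation.one[OF k_derivation_ring_derivation, of D]
  unfolding k_derivation_def by (metis mult.right_neutral mult_zero_right)

section \<open>The standard grading\<close>

lemma graded_pieceD:
  "f \<in> graded_piece n \<Longrightarrow> int i + int j + int l \<noteq> n \<Longrightarrow> coeff (coeff (coeff f l) j) i = 0"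
  unfolding graded_piece_def by blast

lemma graded_piece_0: "0 \<in> graded_piece n"
  by (simp add: graded_piece_def)

lemma graded_piece_add: "f \<in> graded_piece n \<Longrightarrow> g \<in> graded_piece n \<Longrightarrow> f + g \<in> graded_piece n"
  unfolding graded_piece_def mem_Collect_eq by (metis add.right_neutral coeff_add)

lemma graded_piece_uminus: "f \<in> graded_piece n \<Longrightarrow> - f \<in> graded_piece n"
  unfolding graded_piece_def by simp

lemma graded_piece_diff: "f \<in> graded_piece n \<Longrightarrow> g \<in> graded_piece n \<Longrightarrow> f - g \<in> graded_piece n"
  using graded_piece_add[OF _ graded_piece_uminus] by fastforce

lemma graded_piece_sum: "(\<And>i. i \<in> A \<Longrightarrow> f i \<in> graded_piece n) \<Longrightarrow> sum f A \<in> graded_piece n"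
  by (induction A rule: infinite_finite_induct) (auto simp: graded_piece_0 graded_piece_add)

lemma graded_piece_mult:
  assumes f: "f \<in> graded_piece m" and g: "g \<in> graded_piece n"
  shows "f * g \<in> graded_piece (m + n)"
proof -
  have "coeff (coeff (coeff (f * g) l) j) i = 0" if ne: "int i + int j + int l \<noteq> m + n" for i j l
  proof -
    have "coeff (coeff (coeff f c) b) a * coeff (coeff (coeff g (l - c)) (j - b)) (i - a) = 0"
      if "a \<le> i" "b \<le> j" "c \<le> l" for a b c
    proof (cases "int a + int b + int c = m")
      case True
      with ne that have "int (i - a) + int (j - b) + int (l - c) \<noteq> n" by simp
      then show ?thesis using graded_pieceD[OF g] by simp
    qed (use graded_pieceD[OF f] in simp)
    then show ?thesis unfolding coeff_mult coeff_sum by (auto intro!: sum.neutral)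
  qed
  then show ?thesis unfolding graded_piece_def by blast
qed

lemma graded_piece_scal: "scal c \<in> graded_piece 0"
  by (auto simp: graded_piece_def scal_def coeff_pCons split: nat.splits)

lemma graded_piece_varU: "varU \<in> graded_piece 1"
  and graded_piece_varV: "varV \<in> graded_piece 1"
  and graded_piece_varW: "varW \<in> graded_piece 1"
  by (auto simp: graded_piece_def varU_def varV_def varW_def coeff_pCons split: nat.splits)

lemma graded_piece_1: "1 \<in> graded_piece 0"
  using graded_piece_scal[of 1] by (simp add: scal_simps)

lemma graded_piece_power: "f \<in> graded_piece n \<Longrightarrow> f ^ k \<in> graded_piece (int k * n)"
proof (induction k)
  case (Suc k)
  then show ?case using graded_piece_mult[of f n "f ^ k" "int k * n"] by (simp add: algebra_simps)
qed (simp add: graded_piece_1)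

lemma graded_piece_smult: "f \<in> graded_piece n \<Longrightarrow> scal c * f \<in> graded_piece n"
  using graded_piece_mult[OF graded_piece_scal] by fastforce

lemma poly3_eqI:
  "(\<And>i j l. coeff (coeff (coeff f l) j) i = coeff (coeff (coeff g l) j) i) \<Longrightarrow> f = g"
  by (simp add: poly_eq_iff)

section \<open>Dehomogenization at \<open>U = 1\<close>\<close>

definition dehom :: "'k::field poly3 \<Rightarrow> 'k poly poly" where
  "dehom = map_poly (map_poly (\<lambda>u. poly u 1))"

lemma ring_map_dehom: "ring_map dehom"
  unfolding dehom_def by (intro ring_map_map_poly ring_map_poly)

lemmas dehom_simps = ring_map_simps[OF ring_map_dehom]

lemma dehom_gens [simp]: "dehom (scal c) = cst c" "dehom varU = 1" "dehom varV = varx" "dehom varW = vary"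
  by (simp_all add: dehom_def scal_def cst_def varU_def varV_def varW_def varx_def vary_def
      map_poly_pCons one_pCons)

lemma coeff_dehom: "coeff (coeff (dehom f) l) j = poly (coeff (coeff f l) j) 1"
  by (simp add: dehom_def coeff_map_poly)

lemma dehom_dW: "dehom (dW f) = dy (dehom f)"
proof (induction f)
  case (pCons a f)
  have "dehom (pCons a f) = pCons (map_poly (\<lambda>u. poly u 1) a) (dehom f)" for a and f :: "'a poly3"
    by (simp add: dehom_def map_poly_pCons)
  then show ?case using pCons(2)
    by (simp add: dW_def dy_def pderiv_pCons dehom_simps map_poly_pCons)
qed (simp add: dW_def dy_def dehom_def)

lemma dehom_dV: "dehom (dV f) = dx (dehom f)"
proof -
  have "map_poly (\<lambda>u. poly u 1) (pderiv c) = pderiv (map_poly (\<lambda>u. poly u 1) c)"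
    for c :: "'a poly poly"
    by (induction c)
      (simp_all add: pderiv_pCons map_poly_pCons ring_map_simps[OF ring_map_map_poly[OF ring_map_poly]])
  then show ?thesis
    by (intro poly_eqI) (simp add: dehom_def dV_def dx_def coeff_map_poly)
qed

text \<open>With \<open>U\<close> as first argument only the derivatives in \<open>V\<close> and
  \<open>W\<close> remain, and these commute with setting \<open>U = 1\<close>.\<close>

lemma dehom_jacobian: "dehom (jacobian_deriv varU P h) = jac (dehom P) (dehom h)"
  by (simp add: jacobian_deriv_varU dehom_simps dehom_dV dehom_dW jac_def)

text \<open>On a graded piece the exponents of \<open>V\<close> and \<open>W\<close> determine that
  of \<open>U\<close>, so setting \<open>U = 1\<close> merges no monomials. This makes
  \<open>dehom\<close> injective on each graded piece.\<close>

lemma coeff_dehom_graded: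
  assumes f: "f \<in> graded_piece n"
  shows "coeff (coeff (dehom f) l) j =
    (if int j + int l \<le> n then coeff (coeff (coeff f l) j) (nat (n - int j - int l)) else 0)"
proof -
  let ?u = "coeff (coeff f l) j" and ?i = "nat (n - int j - int l)"
  have zero: "coeff ?u i = 0" if "int i + int j + int l \<noteq> n" for i
    using graded_pieceD[OF f that] .
  show ?thesis
  proof (cases "int j + int l \<le> n")
    case True
    have "?u = monom (coeff ?u ?i) ?i"
    proof (rule poly_eqI)
      fix i
      have "i \<noteq> ?i \<Longrightarrow> int i + int j + int l \<noteq> n" using True by linarith
      then show "coeff ?u i = coeff (monom (coeff ?u ?i) ?i) i" using zero by auto
    qed
    then have "poly ?u 1 = coeff ?u ?i" by (metis mult.right_neutral poly_monom power_one)
    then show ?thesis using True by (simp add: coeff_dehom)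
  next
    case False
    then have "?u = 0" by (intro poly_eqI) (use zero in simp)
    then show ?thesis using False by (simp add: coeff_dehom)
  qed
qed

lemma dehom_inj:
  assumes "f \<in> graded_piece n" "g \<in> graded_piece n" "dehom f = dehom g"
  shows "f = g"
proof (rule poly3_eqI)
  fix i j l
  show "coeff (coeff (coeff f l) j) i = coeff (coeff (coeff g l) j) i"
  proof (cases "int i + int j + int l = n")
    case True
    then have "int j + int l \<le> n" "nat (n - int j - int l) = i" by auto
    then show ?thesis
      using coeff_dehom_graded[OF assms(1), of l j] coeff_dehom_graded[OF assms(2), of l j] assms(3)
      by simp
  next
    case False
    then show ?thesis using graded_pieceD assms(1,2) by metis
  qed
qed

lemma homogenization:
  fixes r :: "'k::field poly poly"
  assumes "\<And>i j. coeff (coeff r j) i \<noteq> 0 \<Longrightarrow> i + j \<le> n"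
  obtains F where "F \<in> graded_piece (int n)" "dehom F = r"
proof
  let ?F = "\<Sum>j\<le>n. \<Sum>i\<le>n. scal (coeff (coeff r j) i) * varU ^ (n - i - j) * varV ^ i * varW ^ j"
  show "?F \<in> graded_piece (int n)"
  proof (intro graded_piece_sum)
    fix i j
    show "scal (coeff (coeff r j) i) * varU ^ (n - i - j) * varV ^ i * varW ^ j \<in> graded_piece (int n)"
    proof (cases "coeff (coeff r j) i = 0")
      case False
      then have "int n = 0 + int (n - i - j) * 1 + int i * 1 + int j * 1" using assms by fastforce
      then show ?thesis
        by (simp only:) (intro graded_piece_mult graded_piece_power graded_piece_scal
            graded_piece_varU graded_piece_varV graded_piece_varW)
    qed (simp add: scal_simps graded_piece_0)
  qed
  have "degree r \<le> n"
    by (intro degree_le allI impI poly_eqI) (metis assms coeff_0 le_add2 le_trans not_less)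
  moreover have "degree (coeff r j) \<le> n" for j
    by (intro degree_le allI impI) (metis assms le_add1 le_trans not_less)
  ultimately have "subst2 cst r varx vary = (\<Sum>j\<le>n. \<Sum>i\<le>n. cst (coeff (coeff r j) i) * varx ^ i * vary ^ j)"
    by (rule subst2_altdef[OF ring_map_cst])
  then show "dehom ?F = r" by (simp add: dehom_simps subst2_id)
qed

lemma homogenization_exists:
  fixes r :: "'k::field poly poly"
  obtains F n where "F \<in> graded_piece (int n)" "dehom F = r"
proof -
  from degree_bound obtain m where m: "\<And>j. degree (coeff r j) \<le> m" by metis
  have "i + j \<le> m + degree r" if "coeff (coeff r j) i \<noteq> 0" for i j
    using that le_degree[of "coeff r j" i] le_degree[of r j] m[of j] by fastforce
  from homogenization[OF this] that show ?thesis by metis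
qed

section \<open>Generated subalgebras and binary forms in \<open>B\<close>\<close>

lemma subalg_gen_in_kernel:
  assumes "k_derivation (D :: 'k::field_char_0 poly3 \<Rightarrow> _)" "\<And>s. s \<in> S \<Longrightarrow> D s = 0" "f \<in> subalg_gen S"
  shows "D f = 0"
proof -
  interpret ring_derivation D by (rule k_derivation_ring_derivation) fact
  show ?thesis
    using assms(3) by induction (auto simp: assms k_derivation_scal add mult)
qed

lemma subalg_gen_power: "f \<in> subalg_gen S \<Longrightarrow> f ^ n \<in> subalg_gen S"
  by (induction n) (auto intro: subalg_gen.mult simp flip: ring_map_1[OF ring_map_scal]
      intro: subalg_gen.const)

lemma subalg_gen_sum: "(\<And>i. i \<in> A \<Longrightarrow> f i \<in> subalg_gen S) \<Longrightarrow> sum f A \<in> subalg_gen S"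
  by (induction A rule: infinite_finite_induct)
    (auto intro: subalg_gen.add simp: subalg_gen.const[of 0, simplified scal_simps])

lemma subalg_gen_UNIV:
  assumes "varU \<in> subalg_gen S" "varV \<in> subalg_gen S" "varW \<in> subalg_gen S"
  shows "subalg_gen S = (UNIV :: 'k::field poly3 set)"
proof -
  have 1: "[:[:c:]:] \<in> subalg_gen S" for c
  proof (induction c)
    case 0
    show ?case using subalg_gen.const[of 0] by (simp add: scal_def)
  next
    case (pCons a c)
    have "[:[:pCons a c:]:] = scal a + varU * [:[:c:]:]" by (simp add: scal_def varU_def)
    then show ?case using pCons assms by (metis subalg_gen.add subalg_gen.mult subalg_gen.const)
  qed
  have 2: "[:c:] \<in> subalg_gen S" for c
  proof (induction c)
    case 0
    show ?case using subalg_gen.const[of 0] by (simp add: scal_def)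
  next
    case (pCons a c)
    have "[:pCons a c:] = [:[:a:]:] + varV * [:c:]" by (simp add: varV_def)
    then show ?case using pCons assms 1 by (metis subalg_gen.add subalg_gen.mult)
  qed
  have "f \<in> subalg_gen S" for f
  proof (induction f)
    case 0
    show ?case using subalg_gen.const[of 0] by (simp add: scal_def)
  next
    case (pCons a f)
    have "pCons a f = [:a:] + varW * f" by (simp add: varW_def)
    then show ?case using pCons assms 2 by (metis subalg_gen.add subalg_gen.mult)
  qed
  then show ?thesis by blast
qed

lemma eval2_eq_subst2: "eval2 h X Y = subst2 scal h X Y"
  by (simp add: eval2_def subst2_def peval_def)

lemma homogeneous2_degree:
  assumes "homogeneous2 b h"
  shows "degree h \<le> b" "degree (coeff h j) \<le> b"
proof -
  have zero: "coeff (coeff h j) i = 0" if "i + j \<noteq> b" for i j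
    using assms that unfolding homogeneous2_def by blast
  show "degree h \<le> b" by (intro degree_le allI impI poly_eqI) (simp add: zero)
  show "degree (coeff h j) \<le> b" by (intro degree_le allI impI) (simp add: zero)
qed

lemma eval2_homogeneous:
  assumes h: "homogeneous2 b h"
  shows "eval2 h X Y = (\<Sum>j\<le>b. scal (coeff (coeff h j) (b - j)) * X ^ (b - j) * Y ^ j)"
proof -
  have "eval2 h X Y = (\<Sum>j\<le>b. \<Sum>i\<le>b. scal (coeff (coeff h j) i) * X ^ i * Y ^ j)"
    unfolding eval2_eq_subst2 using homogeneous2_degree[OF h]
    by (intro subst2_altdef ring_map_scal)
  also have "\<dots> = (\<Sum>j\<le>b. scal (coeff (coeff h j) (b - j)) * X ^ (b - j) * Y ^ j)"
  proof (rule sum.cong[OF refl])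
    fix j assume "j \<in> {..b}"
    have "(\<Sum>i\<le>b. scal (coeff (coeff h j) i) * X ^ i * Y ^ j) =
        (\<Sum>i\<in>{b - j}. scal (coeff (coeff h j) i) * X ^ i * Y ^ j)"
    proof (rule sum.mono_neutral_right)
      show "\<forall>i\<in>{..b} - {b - j}. scal (coeff (coeff h j) i) * X ^ i * Y ^ j = 0"
      proof
        fix i assume "i \<in> {..b} - {b - j}"
        then have "coeff (coeff h j) i = 0" using h \<open>j \<in> {..b}\<close> unfolding homogeneous2_def by fastforce
        then show "scal (coeff (coeff h j) i) * X ^ i * Y ^ j = 0" by (simp add: scal_simps)
      qed
    qed auto
    then show "(\<Sum>i\<le>b. scal (coeff (coeff h j) i) * X ^ i * Y ^ j) =
        scal (coeff (coeff h j) (b - j)) * X ^ (b - j) * Y ^ j" by simp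
  qed
  finally show ?thesis .
qed

subsection \<open>Degrees of the variables in a normal form\<close>

lemma (in ring_derivation) funpow_above_deg: "has_deg f m \<Longrightarrow> m < n \<Longrightarrow> (\<delta> ^^ n) f = 0"
  using funpow_mono[of "Suc m" f n] unfolding has_deg_def by simp

lemma (in ring_derivation) has_deg_uminus: "has_deg (- f) m \<longleftrightarrow> has_deg f m"
proof -
  have "(\<delta> ^^ n) (- f) = - (\<delta> ^^ n) f" for n
    by (induction n) (auto simp: uminus)
  then show ?thesis unfolding has_deg_def by (simp del: funpow.simps)
qed

lemma deg_deriv_has_deg:
  assumes "k_derivation (D :: 'k::field_char_0 poly3 \<Rightarrow> _)" "ring_derivation.has_deg D b n"
  shows "deg_deriv D b = Fin n"
proof -
  interpret ring_derivation D by (rule k_derivation_ring_derivation) fact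
  have "b \<noteq> 0" using assms(2) by (rule has_deg_nonzero)
  moreover have "Max {n. (D ^^ n) b \<noteq> 0} = n"
    unfolding has_deg_set[OF assms(2)] by (rule Max_eqI) auto
  ultimately show ?thesis by (simp add: deg_deriv_def)
qed

lemma dU_graded: "f \<in> graded_piece n \<Longrightarrow> dU f \<in> graded_piece (n - 1)"
proof -
  assume f: "f \<in> graded_piece n"
  have "coeff (coeff (coeff (dU f) l) j) i = of_nat (Suc i) * coeff (coeff (coeff f l) j) (Suc i)" for i j l
    by (simp add: dU_def coeff_map_poly coeff_pderiv)
  note coeff_eq = this
  show ?thesis
    unfolding graded_piece_def mem_Collect_eq
  proof (intro allI impI)
    fix i j l
    assume "coeff (coeff (coeff (dU f) l) j) i \<noteq> 0"
    then have "coeff (coeff (coeff f l) j) (Suc i) \<noteq> 0" unfolding coeff_eq by auto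
    then have "int (Suc i) + int j + int l = n" using graded_pieceD[OF f] by blast
    then show "int i + int j + int l = n - 1" by simp
  qed
qed

lemma dV_graded: "f \<in> graded_piece n \<Longrightarrow> dV f \<in> graded_piece (n - 1)"
proof -
  assume f: "f \<in> graded_piece n"
  have "coeff (coeff (coeff (dV f) l) j) i = of_nat (Suc j) * coeff (coeff (coeff f l) (Suc j)) i" for i j l
    using coeff_dy[of "coeff f l" j i] by (simp add: dV_def dy_def coeff_map_poly)
  note coeff_eq = this
  show ?thesis
    unfolding graded_piece_def mem_Collect_eq
  proof (intro allI impI)
    fix i j l
    assume "coeff (coeff (coeff (dV f) l) j) i \<noteq> 0"
    then have "coeff (coeff (coeff f l) (Suc j)) i \<noteq> 0" unfolding coeff_eq by auto
    then have "int i + int (Suc j) + int l = n" using graded_pieceD[OF f] by blast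
    then show "int i + int j + int l = n - 1" by simp
  qed
qed

lemma dW_graded: "f \<in> graded_piece n \<Longrightarrow> dW f \<in> graded_piece (n - 1)"
proof -
  assume f: "f \<in> graded_piece n"
  have "coeff (coeff (coeff (dW f) l) j) i = of_nat (Suc l) * coeff (coeff (coeff f (Suc l)) j) i" for i j l
    by (simp add: dW_def coeff_pderiv coeff_of_nat_mult del: of_nat_Suc)
  note coeff_eq = this
  show ?thesis
    unfolding graded_piece_def mem_Collect_eq
  proof (intro allI impI)
    fix i j l
    assume "coeff (coeff (coeff (dW f) l) j) i \<noteq> 0"
    then have "coeff (coeff (coeff f (Suc l)) j) i \<noteq> 0" unfolding coeff_eq by auto
    then have "int i + int j + int (Suc l) = n" using graded_pieceD[OF f] by blast
    then show "int i + int j + int l = n - 1" by simp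
  qed
qed

lemma graded_piece_0_scal:
  assumes "f \<in> graded_piece 0"
  obtains c where "f = scal c"
proof
  show "f = scal (coeff (coeff (coeff f 0) 0) 0)"
  proof (rule poly3_eqI)
    fix i j l
    show "coeff (coeff (coeff f l) j) i = coeff (coeff (coeff (scal (coeff (coeff (coeff f 0) 0) 0)) l) j) i"
      using graded_pieceD[OF assms, of i j l] by (auto simp: scal_def coeff_pCons split: nat.splits)
  qed
qed

lemma jacobian_linear_forms:
  assumes "X \<in> graded_piece 1" "Y \<in> graded_piece 1" "Z \<in> graded_piece 1"
  obtains c where "jacobian_deriv X Y Z = scal c"
proof -
  have d: "dU f \<in> graded_piece 0" "dV f \<in> graded_piece 0" "dW f \<in> graded_piece 0"
    if "f \<in> graded_piece 1" for f :: "'a poly3"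
    using dU_graded[OF that] dV_graded[OF that] dW_graded[OF that] by simp_all
  have m: "f * g \<in> graded_piece 0" if "f \<in> graded_piece 0" "g \<in> graded_piece 0" for f g :: "'a poly3"
    using graded_piece_mult[OF that] by simp
  have "jacobian_deriv X Y Z \<in> graded_piece 0"
    unfolding jacobian_deriv_eq using assms
    by (intro graded_piece_add graded_piece_diff m d) assumption+
  then show ?thesis using graded_piece_0_scal that by blast
qed

text \<open>In the Jacobian of \<open>X\<close>, \<open>P\<close>, \<open>T\<close> only the last
  summand of \<open>P\<close> contributes, so \<open>D T\<close> is a constant times a power of
  \<open>X\<close>. If \<open>D T = 0\<close>, then \<open>D P = 0\<close> would kill
  \<open>Y\<close>, then \<open>Z\<close>, and finally all of \<open>D\<close>; \<open>g0\<close>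
  excludes this, so \<open>T\<close> has degree 1. Since \<open>D P = 0\<close>, the term of
  \<open>P\<close> in \<open>Y\<close> must balance \<open>T ^ a\<close> and has degree
  \<open>a\<close>; likewise \<open>X ^ (b - 1) * Z = T - h(X, Y)\<close> has the degree
  \<open>a * b\<close> of \<open>Y ^ b\<close>.\<close>

lemma normal_form_degrees:
  fixes D :: "'k::field_char_0 poly3 \<Rightarrow> 'k poly3"
  assumes D: "k_derivation D" "D g0 \<noteq> 0" and nf: "normal_form D P a b X Y Z h \<gamma> c"
    and ab: "a \<ge> 2" "b \<ge> 2"
  shows "D X = 0" "local_slice D (slice_form b h X Y Z)"
    and "ring_derivation.has_deg D Y a" "ring_derivation.has_deg D Z (a * b)"
proof -
  interpret ring_derivation D by (rule k_derivation_ring_derivation) fact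
  note scal_ker = k_derivation_scal[OF D(1)]
  define T where "T = slice_form b h X Y Z"
  from nf have lin: "linear_system_of_variables X Y Z" and h: "homogeneous2 b h" "lead_coeff h = 1"
    and ne: "\<gamma> \<noteq> 0" "c a \<noteq> 0" and D_eq: "D = (\<lambda>g. scal \<gamma> * jacobian_deriv X P g)"
    and P: "P = T ^ a + (\<Sum>i=1..a-1. scal (c i) * X ^ (i * b) * T ^ (a - i))
            + scal (c a) * X ^ (a * b - 1) * Y"
    unfolding normal_form_def T_def Let_def by blast+
  from lin have gen: "subalg_gen {X, Y, Z} = UNIV"
    and gr: "X \<in> graded_piece 1" "Y \<in> graded_piece 1" "Z \<in> graded_piece 1"
    by (auto simp: linear_system_of_variables_def coordinate_system_def)
  have T: "T = eval2 h X Y + X ^ (b - 1) * Z" by (simp add: T_def slice_form_def)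
  show DX: "D X = 0" by (simp add: D_eq)
  have DP: "D P = 0" by (simp add: D_eq)
  have "X \<noteq> 0"
  proof
    assume "X = 0"
    then have "X = scal 0" by (simp add: scal_simps)
    then have "jacobian_deriv X P g0 = 0"
      by (simp only: jacobian_deriv_eq dU_simps dV_simps dW_simps) simp
    then show False using D(2) by (simp add: D_eq)
  qed
  \<comment> \<open>A leading coefficient 1 has a nonzero constant term, so homogeneity forces the
    exponent of its pure power of \<open>Y\<close> to be \<open>b\<close>.\<close>
  have "coeff (lead_coeff h) 0 \<noteq> 0" using h(2) by simp
  then have deg_h: "degree h = b" using h(1) unfolding homogeneous2_def by fastforce

  obtain e where e: "jacobian_deriv X Y Z = scal e" using jacobian_linear_forms[OF gr] .
  have JYT: "jacobian_deriv X Y T = X ^ (b - 1) * scal e"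
  proof -
    interpret J: ring_derivation "jacobian_deriv X Y" by (rule ring_derivation_jacobian3)
    have "jacobian_deriv X Y (eval2 h X Y) = 0"
      unfolding eval2_eq_subst2
      by (subst deriv_subst2[OF ring_map_scal ring_derivation_jacobian3]) simp_all
    then show ?thesis unfolding T by (simp add: J.add J.mult J.power e)
  qed
  have JPT: "jacobian_deriv X P T = scal (c a) * X ^ (a * b - 1) * (X ^ (b - 1) * scal e)"
  proof -
    interpret J: ring_derivation "\<lambda>B. jacobian_deriv X B T" by (rule ring_derivation_jacobian2)
    show ?thesis unfolding P by (simp add: J.add J.mult J.power J.sum JYT)
  qed
  have DT_ker: "D (D T) = 0"
  proof -
    have "D T = scal \<gamma> * (scal (c a) * X ^ (a * b - 1) * (X ^ (b - 1) * scal e))"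
      using JPT by (simp add: D_eq)
    then show ?thesis by (simp only: mult power DX scal_ker) simp
  qed
  have DT: "D T \<noteq> 0"
  proof
    assume DT: "D T = 0"
    have "D P = scal (c a) * X ^ (a * b - 1) * D Y"
      unfolding P by (simp add: add mult power sum DT DX scal_ker)
    then have DY: "D Y = 0" using DP ne \<open>X \<noteq> 0\<close> by simp
    have "D (eval2 h X Y) = 0"
      unfolding eval2_eq_subst2
      by (subst deriv_subst2[OF ring_map_scal ring_derivation_axioms]) (simp_all add: DX DY scal_ker)
    then have "X ^ (b - 1) * D Z = 0" using DT unfolding T by (simp add: add mult power DX)
    then have "D Z = 0" using \<open>X \<noteq> 0\<close> by simp
    then have "D g0 = 0" using subalg_gen_in_kernel[OF D(1), of "{X, Y, Z}" g0] DX DY gen by auto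
    then show False using D(2) by simp
  qed
  from DT DT_ker show "local_slice D (slice_form b h X Y Z)"
    by (simp add: local_slice_def deriv_ker_def T_def)
  have deg_T: "has_deg T 1" using DT DT_ker by (simp add: has_deg_def)
  have deg_T_power: "has_deg (T ^ k) k" for k using has_deg_power[OF deg_T, of k] by simp

  \<comment> \<open>Constants and powers of \<open>X\<close> lie in the kernel, so the lower terms
    disappear as soon as their remaining factors do.\<close>
  have low: "(D ^^ n) (\<Sum>i\<in>A. scal (u i) * X ^ r i * t i) = 0"
    if "\<And>i. i \<in> A \<Longrightarrow> (D ^^ n) (t i) = 0" for A :: "nat set" and u r t n
    using that
  proof (induction A rule: infinite_finite_induct)
    case (insert x F)
    have "D (scal (u x) * X ^ r x) = 0" by (simp add: mult power DX scal_ker)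
    then show ?case using insert by (simp add: funpow_add funpow_ker_mult)
  qed auto
  have scal_X_ker: "D (scal u * X ^ r) = 0" for u r by (simp add: mult power DX scal_ker)
  show deg_Y: "has_deg Y a"
  proof -
    let ?S = "\<Sum>i=1..a-1. scal (c i) * X ^ (i * b) * T ^ (a - i)"
    have "(D ^^ a) ?S = 0"
      by (rule low) (use funpow_above_deg[OF deg_T_power] ab in auto)
    moreover have "(D ^^ a) (- P) = 0"
      using funpow_mono[of 1 "- P" a] DP ab by (simp add: uminus)
    ultimately have "has_deg (T ^ a + (?S + - P)) a"
      using deg_T_power[of a] by (intro has_deg_add) (simp_all only: funpow_add, simp)
    also have "T ^ a + (?S + - P) = - (scal (c a) * X ^ (a * b - 1) * Y)"
      unfolding P by simp
    finally have "has_deg (scal (c a) * X ^ (a * b - 1) * Y) a" by (simp add: has_deg_uminus)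
    then show ?thesis using scal_X_ker by (rule has_deg_ker_cancel)
  qed
  show "has_deg Z (a * b)"
  proof -
    have deg_Y_power: "has_deg (Y ^ k) (k * a)" for k using has_deg_power[OF deg_Y] .
    let ?S = "\<Sum>j<b. scal (coeff (coeff h j) (b - j)) * X ^ (b - j) * Y ^ j"
    have "{..b} = insert b {..<b}" by auto
    then have hXY: "eval2 h X Y = Y ^ b + ?S"
      using h deg_h by (simp add: eval2_homogeneous[OF h(1)] scal_simps)
    have "(D ^^ (b * a)) ?S = 0"
      by (rule low) (use funpow_above_deg[OF deg_Y_power] ab in auto)
    moreover have "(D ^^ (b * a)) (- T) = 0"
    proof -
      have "1 < b * a" using ab by (metis less_1_mult Suc_1 Suc_le_eq)
      then show ?thesis using funpow_above_deg[of "- T" 1] deg_T by (simp add: has_deg_uminus)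
    qed
    ultimately have "has_deg (Y ^ b + (?S + - T)) (b * a)"
      using deg_Y_power[of b] by (intro has_deg_add) (simp_all only: funpow_add, simp)
    also have "Y ^ b + (?S + - T) = - (scal 1 * X ^ (b - 1) * Z)"
      unfolding T hXY by (simp add: scal_simps)
    finally have "has_deg (scal 1 * X ^ (b - 1) * Z) (b * a)" by (simp add: has_deg_uminus)
    then have "has_deg Z (b * a)" using scal_X_ker by (rule has_deg_ker_cancel)
    then show ?thesis by (simp add: mult.commute)
  qed
qed

subsection \<open>Normal forms are not triangularizable\<close>

text \<open>Triangular coordinates need not be homogeneous; this filtration by lowest degree
  isolates their linear parts.\<close>

definition order_ge :: "int \<Rightarrow> 'k::field poly3 set" where
  "order_ge n = {f. \<forall>i j l. coeff (coeff (coeff f l) j) i \<noteq> 0 \<longrightarrow> n \<le> int i + int j + int l}"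

lemma order_ge_0: "0 \<in> order_ge n"
  by (simp add: order_ge_def)

lemma order_ge_add: "f \<in> order_ge n \<Longrightarrow> g \<in> order_ge n \<Longrightarrow> f + g \<in> order_ge n"
  unfolding order_ge_def mem_Collect_eq by (metis add.right_neutral coeff_add)

lemma order_ge_sum: "(\<And>i. i \<in> A \<Longrightarrow> f i \<in> order_ge n) \<Longrightarrow> sum f A \<in> order_ge n"
  by (induction A rule: infinite_finite_induct) (auto simp: order_ge_0 order_ge_add)

lemma graded_piece_order_ge: "f \<in> graded_piece m \<Longrightarrow> n \<le> m \<Longrightarrow> f \<in> order_ge n"
  unfolding graded_piece_def order_ge_def by auto

lemma order_ge_graded_eq_0: "f \<in> graded_piece m \<Longrightarrow> f \<in> order_ge n \<Longrightarrow> m < n \<Longrightarrow> f = 0"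
  unfolding graded_piece_def order_ge_def mem_Collect_eq
  by (intro poly3_eqI) (metis coeff_0 not_le)

lemma homogeneous_deriv_order_ge:
  fixes D :: "'k::field_char_0 poly3 \<Rightarrow> 'k poly3"
  assumes D: "k_derivation D" "homogeneous_deriv D d" and f: "f \<in> order_ge n"
  shows "D f \<in> order_ge (n + d)"
proof -
  interpret ring_derivation D by (rule k_derivation_ring_derivation) fact
  let ?mon = "\<lambda>i j l. monom (monom (monom (coeff (coeff (coeff f l) j) i) i) j) l"
  have mon: "D (?mon i j l) \<in> order_ge (n + d)" for i j l
  proof (cases "coeff (coeff (coeff f l) j) i = 0")
    case False
    then have n: "n \<le> int i + int j + int l" using f by (auto simp: order_ge_def)
    have "?mon i j l \<in> graded_piece (int i + int j + int l)"
      by (auto simp: graded_piece_def split: if_splits)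
    then have "D (?mon i j l) \<in> graded_piece (int i + int j + int l + d)"
      using D(2) unfolding homogeneous_deriv_def by blast
    then show ?thesis using n by (auto intro: graded_piece_order_ge)
  qed (simp add: order_ge_0)
  have sum2: "monom (\<Sum>i\<in>A. g i) k = (\<Sum>i\<in>A. monom (g i) k)" for A :: "nat set" and g :: "nat \<Rightarrow> 'b::comm_monoid_add" and k
    by (induction A rule: infinite_finite_induct) (auto simp: add_monom[symmetric])
  have "f = (\<Sum>l\<le>degree f. monom (\<Sum>j\<le>degree (coeff f l).
      monom (\<Sum>i\<le>degree (coeff (coeff f l) j). monom (coeff (coeff (coeff f l) j) i) i) j) l)"
    by (simp add: poly_as_sum_of_monoms)
  then have "f = (\<Sum>l\<le>degree f. \<Sum>j\<le>degree (coeff f l). \<Sum>i\<le>degree (coeff (coeff f l) j). ?mon i j l)"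
    by (simp only: sum2)
  then have "D f = (\<Sum>l\<le>degree f. \<Sum>j\<le>degree (coeff f l). \<Sum>i\<le>degree (coeff (coeff f l) j). D (?mon i j l))"
    by (metis (no_types, lifting) sum sum.cong)
  then show ?thesis using mon by (simp add: order_ge_sum)
qed

section \<open>Linear parts at the origin\<close>

definition coeffU :: "'k::field poly3 \<Rightarrow> 'k" where "coeffU f = coeff (coeff (coeff f 0) 0) 1"
definition coeffV :: "'k::field poly3 \<Rightarrow> 'k" where "coeffV f = coeff (coeff (coeff f 0) 1) 0"
definition coeffW :: "'k::field poly3 \<Rightarrow> 'k" where "coeffW f = coeff (coeff (coeff f 1) 0) 0"
definition coeff1 :: "'k::field poly3 \<Rightarrow> 'k" where "coeff1 f = coeff (coeff (coeff f 0) 0) 0"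

lemma linear_coeffs_add:
  "coeffU (f + g) = coeffU f + coeffU g" "coeffV (f + g) = coeffV f + coeffV g"
  "coeffW (f + g) = coeffW f + coeffW g" "coeff1 (f + g) = coeff1 f + coeff1 g"
  by (simp_all add: coeffU_def coeffV_def coeffW_def coeff1_def)

lemma linear_coeffs_mult:
  "coeffU (f * g) = coeffU f * coeff1 g + coeff1 f * coeffU g"
  "coeffV (f * g) = coeffV f * coeff1 g + coeff1 f * coeffV g"
  "coeffW (f * g) = coeffW f * coeff1 g + coeff1 f * coeffW g"
  by (simp_all add: coeffU_def coeffV_def coeffW_def coeff1_def coeff_mult add.commute)

lemma linear_coeffs_scal [simp]: "coeffU (scal c) = 0" "coeffV (scal c) = 0" "coeffW (scal c) = 0"
  "coeff1 (scal c) = c"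
  by (simp_all add: coeffU_def coeffV_def coeffW_def coeff1_def scal_def)

lemma linear_coeffs_gens [simp]:
  "coeffU varU = 1" "coeffU varV = 0" "coeffU varW = 0"
  "coeffV varU = 0" "coeffV varV = 1" "coeffV varW = 0"
  "coeffW varU = 0" "coeffW varV = 0" "coeffW varW = 1"
  by (simp_all add: coeffU_def coeffV_def coeffW_def varU_def varV_def varW_def)

lemma linear_coeffs_graded:
  "f \<in> graded_piece n \<Longrightarrow> n \<noteq> 1 \<Longrightarrow> coeffU f = 0 \<and> coeffV f = 0 \<and> coeffW f = 0"
  using graded_pieceD[of f n] by (simp add: coeffU_def coeffV_def coeffW_def)

definition linear_part :: "'k::field poly3 \<Rightarrow> 'k poly3" where
  "linear_part f = scal (coeffU f) * varU + scal (coeffV f) * varV + scal (coeffW f) * varW"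

lemma linear_part_graded: "linear_part f \<in> graded_piece 1"
  unfolding linear_part_def
  by (intro graded_piece_add graded_piece_smult graded_piece_varU graded_piece_varV graded_piece_varW)

lemma coeff_linear_part:
  "coeff (coeff (coeff (linear_part f) l) j) i =
    (if i + j + l = 1 then coeff (coeff (coeff f l) j) i else 0)"
proof -
  have "linear_part f = [:[:[:0, coeffU f:], [:coeffV f:]:], [:[:coeffW f:]:]:]"
    by (simp add: linear_part_def scal_def varU_def varV_def varW_def)
  then show ?thesis
    by (auto simp: coeffU_def coeffV_def coeffW_def coeff_pCons split: nat.splits)
qed

lemma linear_part_id: "f \<in> graded_piece 1 \<Longrightarrow> linear_part f = f"
  by (intro poly3_eqI) (use graded_pieceD[of f 1] in \<open>auto simp: coeff_linear_part\<close>)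

lemma linear_part_linear_part_coeffs:
  "coeffU (linear_part f) = coeffU f" "coeffV (linear_part f) = coeffV f" "coeffW (linear_part f) = coeffW f"
  by (simp_all add: coeffU_def coeffV_def coeffW_def coeff_linear_part)

text \<open>The linear coefficients form the differential at the origin and obey the product rule,
  so those of a polynomial in \<open>X\<close>, \<open>Y\<close>, \<open>Z\<close> are one common
  combination of theirs. Constant terms of \<open>X\<close>, \<open>Y\<close>, \<open>Z\<close> only
  enter the multipliers.\<close>

lemma linear_part_generated:
  assumes "f \<in> subalg_gen {X, Y, Z}"
  shows "\<exists>\<alpha> \<beta> \<gamma>. coeffU f = \<alpha> * coeffU X + \<beta> * coeffU Y + \<gamma> * coeffU Z \<and>
    coeffV f = \<alpha> * coeffV X + \<beta> * coeffV Y + \<gamma> * coeffV Z \<and>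
    coeffW f = \<alpha> * coeffW X + \<beta> * coeffW Y + \<gamma> * coeffW Z"
  using assms
proof induction
  case (const c)
  show ?case by (intro exI[of _ 0]) simp
next
  case (gen s)
  then consider "s = X" | "s = Y" | "s = Z" by blast
  then show ?case
  proof cases
    case 1
    then show ?thesis by (intro exI[of _ 1] exI[of _ 0]) simp
  next
    case 2
    have "\<exists>\<beta> \<gamma>. coeffU s = 0 * coeffU X + \<beta> * coeffU Y + \<gamma> * coeffU Z \<and>
        coeffV s = 0 * coeffV X + \<beta> * coeffV Y + \<gamma> * coeffV Z \<and>
        coeffW s = 0 * coeffW X + \<beta> * coeffW Y + \<gamma> * coeffW Z"
      unfolding 2 by (intro exI[of _ 1] exI[of _ 0]) simp
    then show ?thesis by blast
  next
    case 3
    have "\<exists>\<gamma>. coeffU s = 0 * coeffU X + 0 * coeffU Y + \<gamma> * coeffU Z \<and>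
        coeffV s = 0 * coeffV X + 0 * coeffV Y + \<gamma> * coeffV Z \<and>
        coeffW s = 0 * coeffW X + 0 * coeffW Y + \<gamma> * coeffW Z"
      unfolding 3 by (intro exI[of _ 1]) simp
    then show ?thesis by blast
  qed
next
  case (add f g)
  then obtain \<alpha> \<beta> \<gamma> \<alpha>' \<beta>' \<gamma>' where
    "coeffU f = \<alpha> * coeffU X + \<beta> * coeffU Y + \<gamma> * coeffU Z"
    "coeffV f = \<alpha> * coeffV X + \<beta> * coeffV Y + \<gamma> * coeffV Z"
    "coeffW f = \<alpha> * coeffW X + \<beta> * coeffW Y + \<gamma> * coeffW Z"
    "coeffU g = \<alpha>' * coeffU X + \<beta>' * coeffU Y + \<gamma>' * coeffU Z"
    "coeffV g = \<alpha>' * coeffV X + \<beta>' * coeffV Y + \<gamma>' * coeffV Z"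
    "coeffW g = \<alpha>' * coeffW X + \<beta>' * coeffW Y + \<gamma>' * coeffW Z" by blast
  then show ?case
    by (intro exI[of _ "\<alpha> + \<alpha>'"] exI[of _ "\<beta> + \<beta>'"] exI[of _ "\<gamma> + \<gamma>'"])
      (simp add: linear_coeffs_add algebra_simps)
next
  case (mult f g)
  then obtain \<alpha> \<beta> \<gamma> \<alpha>' \<beta>' \<gamma>' where
    "coeffU f = \<alpha> * coeffU X + \<beta> * coeffU Y + \<gamma> * coeffU Z"
    "coeffV f = \<alpha> * coeffV X + \<beta> * coeffV Y + \<gamma> * coeffV Z"
    "coeffW f = \<alpha> * coeffW X + \<beta> * coeffW Y + \<gamma> * coeffW Z"
    "coeffU g = \<alpha>' * coeffU X + \<beta>' * coeffU Y + \<gamma>' * coeffU Z"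
    "coeffV g = \<alpha>' * coeffV X + \<beta>' * coeffV Y + \<gamma>' * coeffV Z"
    "coeffW g = \<alpha>' * coeffW X + \<beta>' * coeffW Y + \<gamma>' * coeffW Z" by blast
  then show ?case
    by (intro exI[of _ "\<alpha> * coeff1 g + coeff1 f * \<alpha>'"] exI[of _ "\<beta> * coeff1 g + coeff1 f * \<beta>'"]
        exI[of _ "\<gamma> * coeff1 g + coeff1 f * \<gamma>'"])
      (simp add: linear_coeffs_mult algebra_simps)
qed

text \<open>\<open>P\<close> has no linear part, so the linear part of a kernel element is a
  multiple of \<open>U\<close>.\<close>

lemma linear_coeffs_kernel:
  assumes "f \<in> subalg_gen {varU, P}" "P \<in> graded_piece n" "n \<noteq> 1"
  shows "coeffV f = 0" "coeffW f = 0"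
  using linear_part_generated[of f varU P P] linear_coeffs_graded[OF assms(2,3)] assms(1)
  by (auto simp: insert_commute)

text \<open>\<open>D X1\<close> is a constant of order at least \<open>d > 0\<close>, hence 0, and
  so \<open>D (D X2) = 0\<close>. The form \<open>L\<close> is the linear part of \<open>X2\<close>:
  the component of \<open>D (D X2)\<close> in degree \<open>1 + 2d\<close> is
  \<open>D (D L)\<close>, which therefore vanishes. If \<open>D L = 0\<close>, the linear parts of
  both \<open>X1\<close> and \<open>X2\<close> would be multiples of \<open>U\<close>, and those of
  three generators could not span all linear forms.\<close>

lemma triangularizable_linear_form:
  fixes D :: "'k::field_char_0 poly3 \<Rightarrow> 'k poly3"
  assumes D: "k_derivation D" "homogeneous_deriv D d" "d > 0"
    and ker: "deriv_ker D = subalg_gen {varU, P}" "P \<in> graded_piece n" "n \<noteq> 1"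
    and tri: "triangularizable D"
  obtains L where "L \<in> graded_piece 1" "D (D L) = 0" "D L \<noteq> 0"
proof -
  interpret ring_derivation D by (rule k_derivation_ring_derivation) fact
  from tri obtain X1 X2 X3 where gen: "subalg_gen {X1, X2, X3} = UNIV"
    and DX1: "D X1 \<in> range scal" and DX2: "D X2 \<in> subalg_gen {X1}"
    unfolding triangularizable_def coordinate_system_def by blast
  have kerD: "coeffV f = 0" "coeffW f = 0" if "D f = 0" for f
    using linear_coeffs_kernel[OF _ ker(2,3), of f] that ker(1) by (auto simp: deriv_ker_def)
  obtain e where e: "D X1 = scal e" using DX1 by blast
  have "X1 \<in> order_ge 0" by (simp add: order_ge_def)
  from homogeneous_deriv_order_ge[OF D(1,2) this] have "scal e \<in> order_ge d" by (simp add: e)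
  then have "e = 0"
    using \<open>d > 0\<close> order_ge_graded_eq_0[OF graded_piece_scal, of e d] by simp
  then have X1: "D X1 = 0" using e by (simp add: scal_simps)
  have "D (D X2) = 0" using subalg_gen_in_kernel[OF D(1) _ DX2] X1 by auto
  define L where "L = linear_part X2"
  define R where "R = X2 - scal (coeff1 X2) - L"
  have X2: "X2 = scal (coeff1 X2) + L + R" by (simp add: R_def)
  have "R \<in> order_ge 2"
  proof -
    have "coeff (coeff (coeff R l) j) i = 0" if "i + j + l < 2" for i j l
      using that by (auto simp: R_def L_def coeff_linear_part coeff1_def scal_def coeff_pCons
          split: nat.splits)
    then show ?thesis unfolding order_ge_def by (auto, force)
  qed
  then have DDR: "D (D R) \<in> order_ge (2 + d + d)"
    using homogeneous_deriv_order_ge[OF D(1,2)] by blast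
  have graded: "L \<in> graded_piece 1" by (simp add: L_def linear_part_graded)
  then have DDL: "D (D L) \<in> graded_piece (1 + d + d)"
    using D(2) unfolding homogeneous_deriv_def by blast
  have "D (D X2) = D (D L) + D (D R)"
    by (subst X2) (simp add: add k_derivation_scal[OF D(1)])
  then have "D (D R) = - D (D L)" using \<open>D (D X2) = 0\<close> by (simp add: eq_neg_iff_add_eq_0 add.commute)
  then have "D (D R) \<in> graded_piece (1 + d + d)" using DDL by (simp add: graded_piece_uminus)
  then have "D (D R) = 0" using order_ge_graded_eq_0[OF _ DDR] by simp
  then have DDL0: "D (D L) = 0" using \<open>D (D R) = - D (D L)\<close> by simp
  have "D L \<noteq> 0"
  proof
    assume "D L = 0"
    then have X2_zero: "coeffV X2 = 0" "coeffW X2 = 0"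
      using kerD[of L] by (simp_all add: L_def linear_part_linear_part_coeffs)
    obtain x where x: "1 = x * coeffV X3" "0 = x * coeffW X3"
      using linear_part_generated[of varV X1 X2 X3] gen kerD[OF X1] X2_zero by auto
    obtain y where y: "0 = y * coeffV X3" "1 = y * coeffW X3"
      using linear_part_generated[of varW X1 X2 X3] gen kerD[OF X1] X2_zero by auto
    from x y show False by auto
  qed
  then show ?thesis using that[OF graded DDL0] by blast
qed

text \<open>A linear form is a combination of \<open>X\<close>, \<open>Y\<close>, \<open>Z\<close>,
  whose degrees are 0, \<open>a\<close> and \<open>a * b\<close>. These are distinct, so the highest
  one with nonzero coefficient is the degree of the form, and it is never 1 because
  \<open>a \<ge> 2\<close>.\<close>

lemma normal_form_not_triangularizable:
  fixes D :: "'k::field_char_0 poly3 \<Rightarrow> 'k poly3"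
  assumes D: "k_derivation D" "homogeneous_deriv D d" "d > 0"
    and ker: "deriv_ker D = subalg_gen {varU, P}" "P \<in> graded_piece n" "n \<noteq> 1"
    and nf: "normal_form D P a b X Y Z h \<gamma> c" and ab: "a \<ge> 2" "b \<ge> 2"
  shows "\<not> triangularizable D"
proof
  assume tri: "triangularizable D"
  interpret ring_derivation D by (rule k_derivation_ring_derivation) fact
  obtain L where L: "L \<in> graded_piece 1" "D (D L) = 0" "D L \<noteq> 0"
    using triangularizable_linear_form[OF D ker tri] .
  note deg = normal_form_degrees[OF D(1) L(3) nf ab]
  have gen: "subalg_gen {X, Y, Z} = UNIV"
    and gr: "X \<in> graded_piece 1" "Y \<in> graded_piece 1" "Z \<in> graded_piece 1"
    using nf by (auto simp: normal_form_def linear_system_of_variables_def coordinate_system_def)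
  obtain \<alpha> \<beta> \<zeta> where co: "coeffU L = \<alpha> * coeffU X + \<beta> * coeffU Y + \<zeta> * coeffU Z"
    "coeffV L = \<alpha> * coeffV X + \<beta> * coeffV Y + \<zeta> * coeffV Z"
    "coeffW L = \<alpha> * coeffW X + \<beta> * coeffW Y + \<zeta> * coeffW Z"
    using linear_part_generated[of L X Y Z] gen by blast
  have L_eq: "L = scal \<zeta> * Z + (scal \<beta> * Y + scal \<alpha> * X)"
  proof -
    have *: "linear_part (scal \<zeta> * Z + (scal \<beta> * Y + scal \<alpha> * X)) = linear_part L"
      unfolding linear_part_def by (simp add: co linear_coeffs_add linear_coeffs_mult algebra_simps)
    have "scal \<zeta> * Z + (scal \<beta> * Y + scal \<alpha> * X) \<in> graded_piece 1"
      using gr by (intro graded_piece_add graded_piece_smult)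
    then show ?thesis using * L(1) by (simp add: linear_part_id)
  qed
  have ker_scal: "D (scal u) = 0" for u using k_derivation_scal[OF D(1)] .
  have DX: "D (scal u * X) = 0" for u by (simp add: mult ker_scal deg(1))
  have "\<zeta> = 0"
  proof (rule ccontr)
    assume "\<zeta> \<noteq> 0"
    then have "has_deg (scal \<zeta> * Z) (a * b)" using has_deg_ker_mult[OF deg(4)] ker_scal by simp
    moreover have "a < a * b" using ab by simp
    then have "(D ^^ (a * b)) (scal \<beta> * Y + scal \<alpha> * X) = 0"
      using funpow_above_deg[OF deg(3)] funpow_mono[of 1 "scal \<alpha> * X" "a * b"] DX
      by (simp add: funpow_add funpow_ker_mult ker_scal)
    ultimately have "has_deg L (a * b)" unfolding L_eq by (rule has_deg_add)
    then have "(D ^^ (a * b)) L \<noteq> 0" by (simp add: has_deg_def)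
    moreover have "2 \<le> a * b" using ab by (metis le_trans mult_le_mono1 mult_le_mono nat_mult_1 one_le_numeral)
    ultimately show False using funpow_mono[of 2 L "a * b"] L(2) by (simp add: numeral_2_eq_2)
  qed
  moreover have "\<beta> = 0"
  proof (rule ccontr)
    assume "\<beta> \<noteq> 0"
    then have "has_deg (scal \<beta> * Y) a" using has_deg_ker_mult[OF deg(3)] ker_scal by simp
    moreover have "(D ^^ a) (scal \<alpha> * X) = 0"
      using funpow_mono[of 1 "scal \<alpha> * X" a] DX ab by simp
    ultimately have "has_deg L a" unfolding L_eq \<open>\<zeta> = 0\<close> by (simp add: has_deg_add scal_simps)
    then have "(D ^^ a) L \<noteq> 0" by (simp add: has_deg_def)
    then show False using funpow_mono[of 2 L a] L(2) ab by (simp add: numeral_2_eq_2)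
  qed
  ultimately have "D L = 0" unfolding L_eq by (simp add: DX scal_simps)
  then show False using L(3) by simp
qed

subsection \<open>Passing to the plane \<open>U = 1\<close>\<close>

lemma peval_smult: "ring_map \<phi> \<Longrightarrow> peval \<phi> (smult c F) y = \<phi> c * peval \<phi> F y"
  by (induction F) (simp_all add: peval_0 peval_pCons ring_map_mult algebra_simps)

text \<open>An element of a domain that is algebraic over an algebraically closed subfield lies in
  that field: linear factors of \<open>Q\<close> are split off until one vanishes at
  \<open>r\<close>.\<close>

lemma peval_eq_0_imp_const:
  fixes Q :: "'k::alg_closed_field poly"
  assumes "peval cst Q r = 0" "Q \<noteq> 0"
  shows "\<exists>a. r = cst a"
  using assms
proof (induction "degree Q" arbitrary: Q rule: less_induct)
  case less
  note hom = ring_map_peval[OF ring_map_cst]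
  show ?case
  proof (cases "degree Q = 0")
    case True
    then obtain a where "Q = [:a:]" by (rule degree_eq_zeroE)
    then show ?thesis using less.prems by (simp add: peval_pCons peval_0 ring_map_cst)
  next
    case False
    then obtain l where "poly Q l = 0" using alg_closed_imp_poly_has_root[of Q] by auto
    then obtain Q' where Q: "Q = [:-l, 1:] * Q'" by (auto simp: poly_eq_0_iff_dvd)
    have "peval cst [:-l, 1:] r = r - cst l"
      by (simp add: peval_pCons peval_0 ring_map_cst cst_simps)
    then have "(r - cst l) * peval cst Q' r = 0"
      using less.prems(1) unfolding Q ring_map_mult[OF hom] by simp
    then consider "r = cst l" | "peval cst Q' r = 0" by auto
    then show ?thesis
    proof cases
      case 2
      have "Q' \<noteq> 0" using less.prems(2) Q by auto
      then have "degree Q' < degree Q" unfolding Q by (subst degree_mult_eq) auto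
      then show ?thesis using less.hyps 2 \<open>Q' \<noteq> 0\<close> by blast
    qed blast
  qed
qed

text \<open>\<open>r\<close> lies in the kernel, so \<open>r = S(f) = S(G(r))\<close>. As
  \<open>deg G \<ge> 2\<close>, the composite of \<open>S\<close> and \<open>G\<close> is not the
  identity polynomial; hence \<open>r\<close> is algebraic over \<open>k\<close>, and
  \<open>r\<close> and \<open>f\<close> are constants.\<close>

lemma no_decomposition:
  fixes f :: "'k::{alg_closed_field,field_char_0} poly poly"
  assumes ker: "\<And>h. jac f h = 0 \<Longrightarrow> \<exists>S. h = peval cst S f"
    and f: "f = peval cst G r" "\<And>a. f \<noteq> cst a" and deg: "degree G \<ge> 2"
  shows False
proof -
  have "jac f r = 0" unfolding f(1) by (rule jac_peval)
  then obtain S where "r = peval cst S f" using ker by blast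
  then have r: "r = peval cst (pcompose S G) r" using f(1) peval_pcompose[OF ring_map_cst] by metis
  have hom: "ring_map (\<lambda>F. peval cst F r)" by (rule ring_map_peval[OF ring_map_cst])
  have "peval cst [:0, 1:] r = r" by (simp add: peval_pCons peval_0 ring_map_cst cst_simps)
  then have "peval cst (pcompose S G - [:0, 1:]) r = 0"
    unfolding ring_map_diff[OF hom] using r by simp
  moreover have "pcompose S G - [:0, 1:] \<noteq> 0"
  proof
    assume "pcompose S G - [:0, 1:] = 0"
    then have "degree (pcompose S G) = degree [:0, 1 :: 'k:]" by simp
    then have "degree S * degree G = 1" by (simp add: degree_pcompose)
    then show False using deg by simp
  qed
  ultimately obtain a where a: "r = cst a" using peval_eq_0_imp_const by blast
  have "f = cst (poly G a)"
  proof -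
    have "peval cst G (cst a) = cst (poly G a)"
      by (induction G) (simp_all add: peval_0 peval_pCons ring_map_cst cst_simps)
    then show ?thesis using f(1) a by simp
  qed
  then show False using f(2) by blast
qed

lemma dehom_loc_nil:
  fixes P :: "'k::field_char_0 poly3"
  assumes "lnd (jacobian_deriv varU P)"
  shows "loc_nil (dehom P)"
  unfolding loc_nil_def
proof
  fix h :: "'k poly poly"
  obtain F n where F: "dehom F = h" using homogenization_exists by metis
  have "dehom ((jacobian_deriv varU P ^^ k) F) = (jac (dehom P) ^^ k) h" for k
    by (induction k) (simp_all add: F dehom_jacobian)
  moreover obtain k where "(jacobian_deriv varU P ^^ k) F = 0"
    using assms unfolding lnd_def by blast
  ultimately have "(jac (dehom P) ^^ k) h = 0" by (metis dehom_simps(1))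
  then show "\<exists>k. (jac (dehom P) ^^ k) h = 0" ..
qed

lemma dehom_subalg_gen:
  assumes "F \<in> subalg_gen {varU, P}"
  shows "\<exists>S. dehom F = peval cst S (dehom P)"
proof -
  note hom = ring_map_peval[OF ring_map_cst, of "dehom P"]
  have peval_const: "peval cst [:c:] (dehom P) = cst c" for c
    by (simp add: peval_pCons peval_0 ring_map_cst)
  show ?thesis
    using assms
  proof induction
    case (const c)
    show ?case by (metis peval_const dehom_gens(1))
  next
    case (gen s)
    have "peval cst [:0, 1:] (dehom P) = dehom P"
      by (simp add: peval_pCons peval_0 ring_map_cst cst_simps)
    moreover have "dehom varU = peval cst [:1:] (dehom P)"
      by (simp add: peval_const cst_simps)
    ultimately show ?case using gen by (metis empty_iff insert_iff)
  next
    case (add f g)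
    then show ?case by (metis dehom_simps(3) ring_map_add[OF hom])
  next
    case (mult f g)
    then show ?case by (metis dehom_simps(4) ring_map_mult[OF hom])
  qed
qed

text \<open>A homogenization \<open>F\<close> of \<open>h\<close> is sent by \<open>D\<close> to a
  homogeneous element that becomes 0 at \<open>U = 1\<close>, so \<open>D F = 0\<close> by
  injectivity, and the known generators of \<open>ker D\<close> describe \<open>h\<close>.\<close>

lemma dehom_kernel:
  fixes P :: "'k::field_char_0 poly3"
  assumes hom: "homogeneous_deriv (jacobian_deriv varU P) d"
    and ker: "deriv_ker (jacobian_deriv varU P) = subalg_gen {varU, P}"
    and h: "jac (dehom P) h = 0"
  shows "\<exists>S. h = peval cst S (dehom P)"
proof -
  obtain F n where F: "F \<in> graded_piece (int n)" "dehom F = h" using homogenization_exists .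
  have "jacobian_deriv varU P F \<in> graded_piece (int n + d)"
    using hom F(1) unfolding homogeneous_deriv_def by blast
  moreover have "dehom (jacobian_deriv varU P F) = dehom 0"
    using F(2) h by (simp add: dehom_jacobian dehom_simps)
  ultimately have "jacobian_deriv varU P F = 0" using dehom_inj graded_piece_0 by blast
  then have "F \<in> subalg_gen {varU, P}" using ker by (auto simp: deriv_ker_def)
  from dehom_subalg_gen[OF this] F(2) show ?thesis by simp
qed

text \<open>The Jacobian of \<open>U\<close>, \<open>U\<close>, \<open>g\<close> vanishes, so
  \<open>P = U * Q\<close> would make every value of the derivation a multiple of
  \<open>U\<close>.\<close>

lemma irreducible_not_dvd:
  fixes P :: "'k::field_char_0 poly3"
  assumes irr: "irreducible_deriv (jacobian_deriv varU P)"
  shows "P \<noteq> varU * Q"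
proof
  assume P: "P = varU * Q"
  interpret B: module "(*) :: 'k poly3 \<Rightarrow> 'k poly3 \<Rightarrow> 'k poly3"
    by standard (simp_all add: algebra_simps)
  have "jacobian_deriv varU P g = varU * jacobian_deriv varU Q g" for g
  proof -
    interpret J: ring_derivation "\<lambda>B. jacobian_deriv varU B g" by (rule ring_derivation_jacobian2)
    show ?thesis unfolding P by (simp add: J.mult)
  qed
  then have "range (jacobian_deriv varU P) \<subseteq> range ((*) varU)" by auto
  moreover have "B.subspace (range ((*) varU))"
  proof (rule B.subspaceI)
    show "0 \<in> range ((*) (varU :: 'k poly3))" by (rule range_eqI[of _ _ 0]) simp
    show "x + y \<in> range ((*) varU)" if "x \<in> range ((*) varU)" "y \<in> range ((*) varU)" for x y :: "'k poly3"
      using that by (auto simp flip: distrib_left)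
    show "c * x \<in> range ((*) varU)" if "x \<in> range ((*) varU)" for c x :: "'k poly3"
      using that by (auto simp: mult.left_commute[of c])
  qed
  ultimately have "B.span (range (jacobian_deriv varU P)) \<subseteq> range ((*) varU)"
    by (rule B.span_minimal)
  moreover have "range ((*) (varU :: 'k poly3)) \<noteq> UNIV"
  proof
    assume "range ((*) (varU :: 'k poly3)) = UNIV"
    then obtain g :: "'k poly3" where "1 = varU * g" by (metis UNIV_I imageE)
    then have "coeff1 (1 :: 'k poly3) = coeff1 (varU * g)" by simp
    then show False by (simp add: coeff1_def varU_def)
  qed
  ultimately show False using irr unfolding irreducible_deriv_def by blast
qed

text \<open>Without a component of degree \<open>n\<close>, \<open>dehom P\<close> would also come
  from a form \<open>Q\<close> of degree \<open>n - 1\<close>, and then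
  \<open>P = U * Q\<close>.\<close>

lemma dehom_leading_form:
  fixes P :: "'k::field_char_0 poly3"
  assumes irr: "irreducible_deriv (jacobian_deriv varU P)" and P: "P \<in> graded_piece (int n)" and "n > 0"
  obtains g where "leading_form 1 1 (int n) (dehom P) g" "g \<noteq> 0"
proof -
  have le: "i + j \<le> n" if "coeff (coeff (dehom P) j) i \<noteq> 0" for i j
    using that coeff_dehom_graded[OF P, of j i] by (auto split: if_splits)
  obtain g where g: "leading_form 1 1 (int n) (dehom P) g"
  proof (rule leading_form_exists[of "int n" 1 1 "dehom P"])
    show "coeff (coeff (dehom P) j) i = 0" if "int n < int (1 * i + 1 * j)" for i j
      using le[of j i] that by (metis mult_1 not_le of_nat_less_iff)
  qed
  have "g \<noteq> 0"
  proof
    assume "g = 0"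
    have "i + j \<le> n - 1" if "coeff (coeff (dehom P) j) i \<noteq> 0" for i j
    proof (rule ccontr)
      assume "\<not> i + j \<le> n - 1"
      then have "int (1 * i + 1 * j) = int n" using le[OF that] by simp
      from leading_formD(1)[OF g this] \<open>g = 0\<close> that show False by simp
    qed
    then obtain Q where Q: "Q \<in> graded_piece (int (n - 1))" "dehom Q = dehom P"
      using homogenization by metis
    have "varU * Q \<in> graded_piece (int n)"
      using graded_piece_mult[OF graded_piece_varU Q(1)] \<open>n > 0\<close> by (simp add: of_nat_diff)
    then have "P = varU * Q" using dehom_inj[OF P] Q(2) by (simp add: dehom_simps)
    then show False using irreducible_not_dvd[OF irr] by blast
  qed
  then show ?thesis using that g by blast
qed

text \<open>The last conclusion is the invertibility of the linear change, stated for an arbitrary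
  generated subalgebra so that it can certify coordinate systems.\<close>

lemma linear_lifts:
  assumes "(x0, y0) = (vary, varx) \<or> (\<exists>l. (x0, y0) = (varx, vary - cst l * varx))"
  obtains X0 Y0 :: "'k::field poly3" where "dehom X0 = x0" "dehom Y0 = y0"
    "X0 \<in> graded_piece 1" "Y0 \<in> graded_piece 1"
    "\<And>S. X0 \<in> subalg_gen S \<Longrightarrow> Y0 \<in> subalg_gen S \<Longrightarrow> varV \<in> subalg_gen S \<and> varW \<in> subalg_gen S"
proof -
  consider "x0 = vary" "y0 = varx" | l where "x0 = varx" "y0 = vary - cst l * varx"
    using assms by auto
  then show ?thesis
  proof cases
    case 1
    then show ?thesis
      using that[of varW varV] graded_piece_varV graded_piece_varW by simp
  next
    case 2
    show ?thesis
    proof (rule that[of varV "varW - scal l * varV"])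
      show "varW - scal l * varV \<in> graded_piece 1"
        by (intro graded_piece_diff graded_piece_smult graded_piece_varV graded_piece_varW)
      show "varV \<in> subalg_gen S \<and> varW \<in> subalg_gen S"
        if "varV \<in> subalg_gen S" "varW - scal l * varV \<in> subalg_gen S" for S
        using subalg_gen.add[OF that(2) subalg_gen.mult[OF subalg_gen.const[of l] that(1)]] that(1)
        by simp
    qed (use 2 in \<open>simp_all add: dehom_simps graded_piece_varV\<close>)
  qed
qed

text \<open>Homogenizing gives \<open>P = Q(U, Y0) + e U^(n-1) X0\<close>, which is linear in
  \<open>X0\<close>. Then \<open>D U = 0\<close>, \<open>D Y0\<close> is a constant times
  \<open>U^(n-1)\<close>, and \<open>D X0\<close> lies in \<open>k[U, Y0]\<close>, so
  \<open>U\<close>, \<open>Y0\<close>, \<open>X0\<close> is a triangular system.\<close>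

lemma triangularizable_of_plane_form:
  fixes P :: "'k::field_char_0 poly3"
  assumes P: "P \<in> graded_piece (int n)" "n > 0"
    and xy: "(x0, y0) = (vary, varx) \<or> (\<exists>l. (x0, y0) = (varx, vary - cst l * varx))"
    and f: "dehom P = peval cst G y0 + cst e * x0" and G: "degree G = n"
  shows "triangularizable (jacobian_deriv varU P)"
proof -
  obtain X0 Y0 where dehom: "dehom X0 = x0" "dehom Y0 = y0"
    and gr: "X0 \<in> graded_piece 1" "Y0 \<in> graded_piece 1"
    and gen: "\<And>S. X0 \<in> subalg_gen S \<Longrightarrow> Y0 \<in> subalg_gen S \<Longrightarrow> varV \<in> subalg_gen S \<and> varW \<in> subalg_gen S"
    by (rule linear_lifts[OF xy]) blast
  define Q where "Q = (\<Sum>i\<le>n. scal (coeff G i) * varU ^ (n - i) * Y0 ^ i)"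
  define R where "R = scal e * varU ^ (n - 1) * X0"
  have "Q \<in> graded_piece (int n)"
    unfolding Q_def
  proof (rule graded_piece_sum)
    fix i assume "i \<in> {..n}"
    then have "int n = 0 + int (n - i) * 1 + int i * 1" by simp
    then show "scal (coeff G i) * varU ^ (n - i) * Y0 ^ i \<in> graded_piece (int n)"
      by (simp only:) (intro graded_piece_mult graded_piece_power graded_piece_scal graded_piece_varU gr)
  qed
  moreover have "R \<in> graded_piece (int n)"
  proof -
    have "int n = 0 + int (n - 1) * 1 + 1" using \<open>n > 0\<close> by simp
    then show ?thesis
      unfolding R_def
      by (simp only:) (intro graded_piece_mult graded_piece_power graded_piece_scal graded_piece_varU gr)
  qed
  moreover have "dehom (Q + R) = dehom P"
    using peval_altdef[OF ring_map_cst, of G n y0] G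
    by (simp add: Q_def R_def f dehom_simps dehom)
  ultimately have P_eq: "P = Q + R" using dehom_inj[OF P(1)] graded_piece_add by metis
  let ?J = "jacobian_deriv varU"
  have const: "?J A B \<in> range scal" if "A \<in> graded_piece 1" "B \<in> graded_piece 1" for A B :: "'k poly3"
    using jacobian_linear_forms[OF graded_piece_varU that] by (metis rangeI)
  \<comment> \<open>By the product rule only the generators matter, and the Jacobian of three linear
    forms is a constant.\<close>
  have J_Q: "?J F B \<in> subalg_gen {varU, Y0}" if "F \<in> subalg_gen {varU, Y0}" "B \<in> graded_piece 1" for F B
  proof -
    interpret J: ring_derivation "\<lambda>F. ?J F B" by (rule ring_derivation_jacobian2)
    from that(1) show ?thesis
    proof induction
      case (const c)
      show ?case using subalg_gen.const[of 0] by (simp add: scal_simps)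
    next
      case (gen s)
      then show ?case
        using const[OF gr(2) that(2)] subalg_gen.const[of 0]
        by (auto simp: scal_simps intro: subalg_gen.const)
    next
      case (add f g)
      then show ?case by (simp add: J.add subalg_gen.add)
    next
      case (mult f g)
      then show ?case by (simp add: J.mult subalg_gen.add subalg_gen.mult)
    qed
  qed
  have U: "varU \<in> subalg_gen (insert varU S)" for S :: "'k poly3 set"
    by (rule subalg_gen.gen) simp
  have Y: "Y0 \<in> subalg_gen {varU, Y0}" by (rule subalg_gen.gen) simp
  have Q: "Q \<in> subalg_gen {varU, Y0}"
    unfolding Q_def
    by (intro subalg_gen_sum subalg_gen.mult subalg_gen_power subalg_gen.const U Y)
  have DY: "?J P Y0 \<in> subalg_gen {varU}"
  proof -
    interpret J: ring_derivation "\<lambda>F. ?J F Y0" by (rule ring_derivation_jacobian2)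
    obtain c where c: "?J X0 Y0 = scal c" using const[OF gr] by blast
    have "?J P Y0 = scal e * varU ^ (n - 1) * scal c"
      unfolding P_eq Q_def R_def by (simp add: J.add J.sum J.mult J.power c)
    then show ?thesis using U[of "{}"]
      by (simp add: subalg_gen.mult subalg_gen.const subalg_gen_power)
  qed
  have DX: "?J P X0 \<in> subalg_gen {varU, Y0}"
  proof -
    interpret J: ring_derivation "\<lambda>F. ?J F X0" by (rule ring_derivation_jacobian2)
    have "?J P X0 = ?J Q X0"
      unfolding P_eq R_def by (simp add: J.add J.mult J.power)
    then show ?thesis using J_Q[OF Q gr(1)] by simp
  qed
  have "varV \<in> subalg_gen {varU, Y0, X0} \<and> varW \<in> subalg_gen {varU, Y0, X0}"
    by (intro gen subalg_gen.gen) simp_all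
  then have "coordinate_system varU Y0 X0"
    unfolding coordinate_system_def using subalg_gen_UNIV U by blast
  moreover have "?J P varU \<in> range scal" by (rule range_eqI[of _ _ 0]) (simp add: scal_simps)
  ultimately show ?thesis unfolding triangularizable_def using DX DY by blast
qed

lemma homogeneous_polynomial_of_univariate:
  fixes H :: "'k::field poly"
  assumes "degree H = b" "lead_coeff H = 1"
  obtains h where "homogeneous2 b h" "lead_coeff h = 1" "\<And>j. j \<le> b \<Longrightarrow> coeff (coeff h j) (b - j) = coeff H j"
proof
  let ?h = "\<Sum>j\<le>b. monom (monom (coeff H j) (b - j)) j"
  have h: "coeff ?h j = (if j \<le> b then monom (coeff H j) (b - j) else 0)" for j
    by (simp add: coeff_sum)
  show "homogeneous2 b ?h" unfolding homogeneous2_def h by auto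
  have "coeff ?h b = 1" using assms by (simp add: h monom_0)
  moreover have "degree ?h = b"
    by (rule antisym, intro degree_le allI impI, simp add: h)
      (rule le_degree, use \<open>coeff ?h b = 1\<close> in simp)
  ultimately show "lead_coeff ?h = 1" by simp
  show "coeff (coeff ?h j) (b - j) = coeff H j" if "j \<le> b" for j using that by (simp add: h)
qed

text \<open>Homogenizing the second plane shape gives the normal form up to two adjustments: the
  leading coefficient of \<open>G\<close> has to move into \<open>T\<close> while \<open>h\<close>
  stays monic, and the constant term of \<open>G\<close> has to be absorbed because the normal form
  has no separate summand \<open>X ^ (a * b)\<close>.\<close>

lemma normal_form_of_plane_form:
  fixes P :: "'k::{alg_closed_field,field_char_0} poly3"
  assumes P: "P \<in> graded_piece (int (a * b))"
    and xy: "(x0, y0) = (vary, varx) \<or> (\<exists>l. (x0, y0) = (varx, vary - cst l * varx))"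
    and f: "dehom P = peval cst G (peval cst H y0 - cst l * x0) + cst e * y0"
    and G: "degree G = a" and H: "degree H = b" "lead_coeff H = 1"
    and ne: "l \<noteq> 0" "e \<noteq> 0" and ab: "a > 0" "b > 0"
  shows "\<exists>X Y Z h \<gamma> c. normal_form (jacobian_deriv varU P) P a b X Y Z h \<gamma> c"
proof -
  obtain X0 Y0 where dehom: "dehom X0 = x0" "dehom Y0 = y0"
    and gr: "X0 \<in> graded_piece 1" "Y0 \<in> graded_piece 1"
    and gen: "\<And>S. X0 \<in> subalg_gen S \<Longrightarrow> Y0 \<in> subalg_gen S \<Longrightarrow> varV \<in> subalg_gen S \<and> varW \<in> subalg_gen S"
    by (rule linear_lifts[OF xy]) blast
  \<comment> \<open>Scaling \<open>Y\<close> by \<zeta> calls for scaling \<open>H\<close> by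
    \<open>z = \<zeta> ^ b\<close> to keep it monic, and \<open>z ^ a\<close> is then the leading
    coefficient of \<open>G\<close>. One root thus makes \<open>h\<close> monic in \<open>Y\<close>
    and \<open>P\<close> monic in \<open>T\<close>.\<close>
  obtain \<zeta> where \<zeta>: "\<zeta> ^ (a * b) = lead_coeff G"
    using nth_root_exists[of "a * b" "lead_coeff G"] ab by auto
  have "G \<noteq> 0" using G ab by auto
  then have "\<zeta> \<noteq> 0" using \<zeta> ab by (metis leading_coeff_0_iff mult_pos_pos zero_power)
  define z where "z = \<zeta> ^ b"
  have z: "z \<noteq> 0" "z ^ a = coeff G a"
    using \<open>\<zeta> \<noteq> 0\<close> \<zeta> G by (simp_all add: z_def power_mult[symmetric] mult.commute)
  \<comment> \<open>The shift of \<open>Y\<close> takes up the constant term of \<open>G\<close>: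
    \<open>e * (y0 + \<kappa>) = e * y0 + coeff G 0\<close>.\<close>
  define \<kappa> where "\<kappa> = coeff G 0 / e"
  define Y where "Y = scal \<zeta> * (Y0 + scal \<kappa> * varU)"
  define Z where "Z = scal (- z * l) * X0"
  \<comment> \<open>The inner polynomial undoes the passage from \<open>y0\<close> to
    \<open>Y\<close>, so at \<open>U = 1\<close> this becomes \<open>z\<close> times
    \<open>H\<close> at \<open>y0\<close>.\<close>
  define H' where "H' = smult z (pcompose H [:- \<kappa>, 1 / \<zeta>:])"
  \<comment> \<open>The denominators compensate the scalings of \<open>T\<close> and
    \<open>Y\<close>. The index \<open>a\<close> carries \<open>e\<close> in place of the constant
    term of \<open>G\<close>, which \<kappa> has taken over.\<close>
  define c where "c i = (if i = a then e / \<zeta> else coeff G (a - i) / z ^ (a - i))" for i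
  have H': "degree H' = b" "lead_coeff H' = 1"
    using \<open>\<zeta> \<noteq> 0\<close> z(1) H ab lead_coeff_comp[of "[:- \<kappa>, 1 / \<zeta>:]" H]
    by (simp_all add: H'_def degree_pcompose z_def power_divide)
  obtain h where h: "homogeneous2 b h" "lead_coeff h = 1"
    "\<And>j. j \<le> b \<Longrightarrow> coeff (coeff h j) (b - j) = coeff H' j"
    using homogeneous_polynomial_of_univariate[OF H'] by blast
  define T where "T = slice_form b h varU Y Z"
  have grY: "Y \<in> graded_piece 1" and grZ: "Z \<in> graded_piece 1"
    unfolding Y_def Z_def
    by (intro graded_piece_smult graded_piece_add gr graded_piece_varU)+
  have T_eq: "T = (\<Sum>j\<le>b. scal (coeff H' j) * varU ^ (b - j) * Y ^ j) + varU ^ (b - 1) * Z"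
    by (simp add: T_def slice_form_def eval2_homogeneous[OF h(1)] h(3))
  have grT: "T \<in> graded_piece (int b)"
    unfolding T_eq
  proof (intro graded_piece_add graded_piece_sum)
    fix j assume "j \<in> {..b}"
    then have "int b = 0 + int (b - j) * 1 + int j * 1" by simp
    then show "scal (coeff H' j) * varU ^ (b - j) * Y ^ j \<in> graded_piece (int b)"
      by (simp only:) (intro graded_piece_mult graded_piece_power graded_piece_scal graded_piece_varU grY)
  next
    have "int b = int (b - 1) * 1 + 1" using ab by simp
    then show "varU ^ (b - 1) * Z \<in> graded_piece (int b)"
      by (simp only:) (intro graded_piece_mult graded_piece_power graded_piece_varU grZ)
  qed
  define T0 where "T0 = peval cst H y0 - cst l * x0"
  have dehom_Y: "dehom Y = cst \<zeta> * (y0 + cst \<kappa>)"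
    by (simp add: Y_def dehom_simps dehom)
  have dehom_T: "dehom T = cst z * T0"
  proof -
    have inv: "cst (1 / \<zeta>) * cst \<zeta> = 1"
      using \<open>\<zeta> \<noteq> 0\<close> by (simp flip: cst_simps(4)) (simp add: cst_simps)
    have "peval cst [:- \<kappa>, 1 / \<zeta>:] (dehom Y) = cst (- \<kappa>) + (cst (1 / \<zeta>) * cst \<zeta>) * (y0 + cst \<kappa>)"
      by (simp add: peval_pCons peval_0 ring_map_cst dehom_Y mult_ac)
    then have "peval cst [:- \<kappa>, 1 / \<zeta>:] (dehom Y) = y0"
      unfolding inv by (simp add: cst_simps)
    then have "peval cst H' (dehom Y) = cst z * peval cst H y0"
      by (simp add: H'_def peval_smult ring_map_cst peval_pcompose)
    moreover have "peval cst H' (dehom Y) = (\<Sum>j\<le>b. cst (coeff H' j) * dehom Y ^ j)"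
      using H'(1) by (intro peval_altdef ring_map_cst) simp
    ultimately show ?thesis
      by (simp add: T_eq Z_def T0_def dehom_simps dehom cst_simps algebra_simps)
  qed
  define R where "R = T ^ a + (\<Sum>i=1..a-1. scal (c i) * varU ^ (i * b) * T ^ (a - i))
      + scal (c a) * varU ^ (a * b - 1) * Y"
  have "R \<in> graded_piece (int (a * b))"
    unfolding R_def
  proof (intro graded_piece_add graded_piece_sum)
    show "T ^ a \<in> graded_piece (int (a * b))"
      using graded_piece_power[OF grT, of a] by simp
  next
    fix i assume "i \<in> {1..a - 1}"
    then have "i \<le> a" by auto
    then have "a * b = i * b + (a - i) * b" by (simp flip: add_mult_distrib)
    then have "int (a * b) = 0 + int (i * b) * 1 + int (a - i) * int b"
      by (metis add_0 mult.right_neutral of_nat_add of_nat_mult)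
    then show "scal (c i) * varU ^ (i * b) * T ^ (a - i) \<in> graded_piece (int (a * b))"
      by (simp only:) (intro graded_piece_mult graded_piece_power graded_piece_scal graded_piece_varU grT)
  next
    have "int (a * b) = 0 + int (a * b - 1) * 1 + 1"
      using ab by (simp add: Suc_leI of_nat_diff)
    then show "scal (c a) * varU ^ (a * b - 1) * Y \<in> graded_piece (int (a * b))"
      by (simp only:) (intro graded_piece_mult graded_piece_power graded_piece_scal graded_piece_varU grY)
  qed
  moreover have "dehom R = dehom P"
  proof -
    have summand: "cst (c i) * (cst z * T0) ^ (a - i) = cst (coeff G (a - i)) * T0 ^ (a - i)"
      if "i \<in> {1..a - 1}" for i
    proof -
      have "c i * z ^ (a - i) = coeff G (a - i)"
        using that z(1) by (auto simp: c_def)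
      then have "cst (coeff G (a - i)) = cst (c i) * cst z ^ (a - i)" by (metis cst_simps(4,7))
      then show ?thesis by (simp add: power_mult_distrib mult_ac)
    qed
    have last_term: "cst (c a) * dehom Y = cst e * y0 + cst (coeff G 0)"
    proof -
      have "cst (c a) * dehom Y = cst (c a * \<zeta>) * y0 + cst (c a * \<zeta> * \<kappa>)"
        by (simp add: dehom_Y cst_simps algebra_simps)
      moreover have "c a * \<zeta> = e" "e * \<kappa> = coeff G 0"
        using \<open>\<zeta> \<noteq> 0\<close> ne by (simp_all add: c_def \<kappa>_def)
      ultimately show ?thesis by simp
    qed
    have "dehom R = (cst z * T0) ^ a + (\<Sum>i=1..a-1. cst (c i) * (cst z * T0) ^ (a - i)) + cst (c a) * dehom Y"
      by (simp add: R_def dehom_simps dehom_T)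
    also have "(cst z * T0) ^ a = cst (coeff G a) * T0 ^ a"
      by (simp add: power_mult_distrib z(2)[symmetric] cst_simps)
    also have "(\<Sum>i=1..a-1. cst (c i) * (cst z * T0) ^ (a - i)) = (\<Sum>i=1..a-1. cst (coeff G (a - i)) * T0 ^ (a - i))"
      by (rule sum.cong[OF refl summand])
    also have "\<dots> = (\<Sum>i=1..a-1. cst (coeff G i) * T0 ^ i)"
      using ab by (subst (2) sum.atLeastAtMost_rev) simp
    also have "cst (coeff G a) * T0 ^ a + (\<Sum>i=1..a-1. cst (coeff G i) * T0 ^ i) + cst (c a) * dehom Y =
        (\<Sum>i\<le>a. cst (coeff G i) * T0 ^ i) + cst e * y0"
    proof -
      have "{..a} = insert 0 (insert a {1..a - 1})" using ab by auto
      then have "(\<Sum>i\<le>a. cst (coeff G i) * T0 ^ i) =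
          cst (coeff G 0) + (cst (coeff G a) * T0 ^ a + (\<Sum>i=1..a-1. cst (coeff G i) * T0 ^ i))"
        using ab by simp
      then show ?thesis unfolding last_term by (simp add: algebra_simps)
    qed
    also have "\<dots> = dehom P"
      unfolding f T0_def[symmetric] using peval_altdef[OF ring_map_cst, of G a T0] G by simp
    finally show ?thesis .
  qed
  ultimately have P_eq: "P = R" using dehom_inj[OF P] by metis
  have lin: "linear_system_of_variables varU Y Z"
  proof -
    let ?S = "{varU, Y, Z}"
    have mem: "varU \<in> subalg_gen ?S" "Y \<in> subalg_gen ?S" "Z \<in> subalg_gen ?S"
      by (rule subalg_gen.gen; simp)+
    have inv: "scal u * (scal v * F) = F" if "u * v = 1" for u v and F :: "'k poly3"
      using that by (simp flip: mult.assoc scal_simps(4)) (simp add: scal_simps)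
    have "X0 = scal (1 / (- z * l)) * Z"
      unfolding Z_def using z(1) ne by (subst inv) auto
    then have "X0 \<in> subalg_gen ?S"
      using subalg_gen.mult[OF subalg_gen.const mem(3)] by metis
    moreover have "Y0 = scal (1 / \<zeta>) * Y + scal (- \<kappa>) * varU"
      unfolding Y_def using \<open>\<zeta> \<noteq> 0\<close> by (subst inv) (auto simp: scal_simps)
    then have "Y0 \<in> subalg_gen ?S"
      using subalg_gen.add[OF subalg_gen.mult[OF subalg_gen.const mem(2)]
          subalg_gen.mult[OF subalg_gen.const mem(1)]] by metis
    ultimately have "varV \<in> subalg_gen ?S \<and> varW \<in> subalg_gen ?S" by (rule gen)
    then show ?thesis
      unfolding linear_system_of_variables_def coordinate_system_def
      using subalg_gen_UNIV mem(1) graded_piece_varU grY grZ by blast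
  qed
  have "c a \<noteq> 0" using ne \<open>\<zeta> \<noteq> 0\<close> by (simp add: c_def)
  moreover have "jacobian_deriv varU P = (\<lambda>g. scal 1 * jacobian_deriv varU P g)"
    by (simp add: scal_simps)
  ultimately have "normal_form (jacobian_deriv varU P) P a b varU Y Z h 1 c"
    using lin h P_eq unfolding normal_form_def Let_def R_def T_def by simp
  then show ?thesis by blast
qed

theorem theorem3p7:
  fixes p q :: nat
    and D :: "'k::{alg_closed_field, field_char_0} poly3 \<Rightarrow> 'k poly3"
    and P :: "'k poly3"
  assumes "prime p" and "prime q"
    and "lnd D" and "irreducible_deriv D"
    and "homogeneous_deriv D (int p * int q - 2)"
    and "deriv_rank D = 2"
    and "D varU = 0"
    and "P \<in> graded_piece (int p * int q)"
    and "deriv_ker D = subalg_gen {varU, P}"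
    and "D = jacobian_deriv varU P"
  shows "(\<not> triangularizable D \<longleftrightarrow>
            (\<exists>a b. ((a, b) = (p, q) \<or> (a, b) = (q, p)) \<and>
               (\<exists>X Y Z h \<gamma> c. normal_form D P a b X Y Z h \<gamma> c))) \<and>
         (\<forall>a b X Y Z h \<gamma> c.
            ((a, b) = (p, q) \<or> (a, b) = (q, p)) \<and> normal_form D P a b X Y Z h \<gamma> c \<longrightarrow>
              deg_deriv D Y = Fin a \<and> deg_deriv D Z = Fin (a * b) \<and>
              local_slice D (slice_form b h X Y Z))"
proof -
  note D_eq = \<open>D = jacobian_deriv varU P\<close>
  have pq2: "p \<ge> 2" "q \<ge> 2" using assms(1,2) by (auto intro: prime_ge_2_nat)
  have "2 * 2 \<le> p * q" using pq2 by (rule mult_le_mono)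
  then have N: "p * q \<ge> 4" by simp
  then have Npos: "p * q > 0" by linarith
  \<comment> \<open>A positive degree of \<open>D\<close> forces \<open>D X1 = 0\<close> in a
    triangular system, and \<open>pq \<noteq> 1\<close> means that \<open>P\<close> has no linear
    part.\<close>
  from N have "int p * int q \<ge> 4" by (metis of_nat_le_iff of_nat_mult of_nat_numeral)
  then have d: "int p * int q - 2 > 0" "int p * int q \<noteq> 1" by auto
  have der: "k_derivation D" using \<open>lnd D\<close> by (simp add: lnd_def)
  have P: "P \<in> graded_piece (int (p * q))" using assms(8) by simp
  have ab2: "a \<ge> 2" "b \<ge> 2" "a * b = p * q" if "(a, b) = (p, q) \<or> (a, b) = (q, p)" for a b
    using that pq2 by auto
  obtain g0 where g0: "D g0 \<noteq> 0" using assms(5) by (auto simp: homogeneous_deriv_def)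

  have not_tri: "\<not> triangularizable D"
    if "(a, b) = (p, q) \<or> (a, b) = (q, p)" "normal_form D P a b X Y Z h \<gamma> c" for a b X Y Z h \<gamma> c
    using normal_form_not_triangularizable[OF der assms(5) d(1) assms(9,8) d(2) that(2)] ab2[OF that(1)]
    by blast

  have nf: "\<exists>a b. ((a, b) = (p, q) \<or> (a, b) = (q, p)) \<and>
      (\<exists>X Y Z h \<gamma> c. normal_form D P a b X Y Z h \<gamma> c)" if nt: "\<not> triangularizable D"
  proof -
    have nil: "loc_nil (dehom P)" using dehom_loc_nil \<open>lnd D\<close> D_eq by blast
    have ker: "\<exists>S. h = peval cst S (dehom P)" if "jac (dehom P) h = 0" for h
      using dehom_kernel[OF assms(5)[unfolded D_eq] assms(9)[unfolded D_eq] that] .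
    obtain g where g: "leading_form 1 1 (int (p * q)) (dehom P) g" "g \<noteq> 0"
      using dehom_leading_form[OF assms(4)[unfolded D_eq] P Npos] by blast
    \<comment> \<open>A constant has no component in degree \<open>pq > 0\<close>, while the top
      form \<open>g\<close> is nonzero.\<close>
    have nonconst: "dehom P \<noteq> cst u" for u
    proof
      assume "dehom P = cst u"
      then have "leading_form 1 1 (int (p * q)) (dehom P) 0"
        using leading_form_lower[OF leading_form_cst[of 1 1 u], of "int (p * q)"] Npos
        by (simp only: of_nat_0_less_iff)
      then show False using leading_form_unique[OF g(1)] g(2) by blast
    qed
    obtain x0 y0 where xy: "(x0, y0) = (vary, varx) \<or> (\<exists>l. (x0, y0) = (varx, vary - cst l * varx))"
      and cases: "(\<exists>G e. dehom P = peval cst G y0 + cst e * x0 \<and> degree G = p * q) \<or>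
        (\<exists>a b G H l e. ((a, b) = (p, q) \<or> (a, b) = (q, p)) \<and>
           dehom P = peval cst G (peval cst H y0 - cst l * x0) + cst e * y0 \<and>
           degree G = a \<and> degree H = b \<and> lead_coeff H = 1 \<and> l \<noteq> 0)"
      by (rule plane_structure[OF nil g assms(1,2)]) (erule (1) that)
    \<comment> \<open>The first shape would make \<open>D\<close> triangularizable.\<close>
    have "\<not> (\<exists>G e. dehom P = peval cst G y0 + cst e * x0 \<and> degree G = p * q)"
      using triangularizable_of_plane_form[OF P Npos xy] nt D_eq by blast
    with cases obtain a b G H l e where ab: "(a, b) = (p, q) \<or> (a, b) = (q, p)"
      and f: "dehom P = peval cst G (peval cst H y0 - cst l * x0) + cst e * y0"
      and GH: "degree G = a" "degree H = b" "lead_coeff H = 1" "l \<noteq> 0" by blast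
    \<comment> \<open>With \<open>e = 0\<close>, \<open>dehom P\<close> would be a composite
      \<open>G(r)\<close> with \<open>degree G = a \<ge> 2\<close>, against the description of its
      kernel.\<close>
    have "e \<noteq> 0"
    proof
      assume "e = 0"
      then have "dehom P = peval cst G (peval cst H y0 - cst l * x0)" using f by (simp add: cst_simps)
      then show False using no_decomposition[OF ker _ nonconst] GH(1) ab2[OF ab] by blast
    qed
    then have "\<exists>X Y Z h \<gamma> c. normal_form D P a b X Y Z h \<gamma> c"
      using normal_form_of_plane_form[OF _ xy f GH, folded D_eq] P ab2[OF ab] by simp
    with ab show ?thesis by (intro exI[of _ a] exI[of _ b] conjI)
  qed

  have degs: "deg_deriv D Y = Fin a \<and> deg_deriv D Z = Fin (a * b) \<and> local_slice D (slice_form b h X Y Z)"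
    if "(a, b) = (p, q) \<or> (a, b) = (q, p)" "normal_form D P a b X Y Z h \<gamma> c" for a b X Y Z h \<gamma> c
    using normal_form_degrees[OF der g0 that(2)] ab2[OF that(1)] deg_deriv_has_deg[OF der] by simp
  show ?thesis
  proof (intro conjI iffI)
    show "\<exists>a b. ((a, b) = (p, q) \<or> (a, b) = (q, p)) \<and>
        (\<exists>X Y Z h \<gamma> c. normal_form D P a b X Y Z h \<gamma> c)" if "\<not> triangularizable D"
      using that by (rule nf)
    show "\<not> triangularizable D"
      if "\<exists>a b. ((a, b) = (p, q) \<or> (a, b) = (q, p)) \<and>
        (\<exists>X Y Z h \<gamma> c. normal_form D P a b X Y Z h \<gamma> c)"
      using that by (elim exE conjE) (rule not_tri)
  qed (intro allI impI, elim conjE, rule degs)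
qed

end
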